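(* Let $U:\mathbb{R}^d\to\mathbb{R}$ be in $\mathcal{C}^4(\mathbb{R}^d)$ with $\int e^{-U(x)}dx<\infty$, having a global minimum at $0$ with $U(0)=0$, and such that $L:=\sup\|D^2U\|<\infty$, $L_H:=\sup\|D^3U\|<\infty$, $L_I:=\sup\|D^4U\|<\infty$. Let $\mu(dx)=Z^{-1}e^{-U(x)}dx$ with $Z=\int e^{-U(x)}dx$. Let $T>0$ and $h>0$ satisfy $T/h\in\mathbb{N}$ and $L(T^2+Th)\le 1/6$. Let $\tilde\pi$ be the transition kernel of unadjusted Hamiltonian Monte Carlo with duration $T$ and step size $h$. Suppose that there is an invariant probability measure $\tilde\mu$ of $\tilde\pi$ such that (A5) there exist constants $M_1,c\in(0,\infty)$ such that for any $m\in\mathbb{N}_0$ and any probability measure $\nu$ on $\mathbb{R}^d$, $W^1(\nu\tilde\pi^m,\tilde\mu)\le M_1e^{-cm}W^1(\nu,\tilde\mu)$; (A6) there exists a constant $M_2\in(0,\infty)$ such that $W^1(\mu,\tilde\mu)\le M_2h^2$. Then for any $m\in\mathbb{N}_0$ and any probability measure $\nu$ on $\mathbb{R}^d$, $$\begin{aligned}\mathrm{TV}(\mu,\nu\tilde\pi^{m+1})\ \le\ &\tfrac32\left(T^{-2}+27\,d\,L_H^2\,T^4\right)^{1/2}M_1\,W^1(\tilde\mu,\nu)\,e^{-cm}\\&+h^2\left[\tfrac32\left(T^{-2}+27\,d\,L_H^2\,T^4\right)^{1/2}M_2+C\right],\end{aligned}$$ where $$\begin{aligned}C:=\Big[&d^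3\big(4L_I^2T^4+14L_H^2L_IT^6+14L_H^4T^8\big)+d^2\big(35L_H^2T^2+8L_I^2T^4+28L_H^2L_IT^6+28L_H^4T^8\big)\\&+d\big(16L^2+4L_H^2T^2\big)+\big(2dL_H^2+L^2T^{-2}\big)\int|x|^2\mu(dx)\\&+\big(dL_I^2+dL_H^2L_IT^2+dL_H^4T^4+L_H^2T^{-2}\big)\int|x|^4\mu(dx)\Big]^{1/2}.\end{aligned}$$
   Context: $|\cdot|$ is the Euclidean norm and $\|\cdot\|$ the operator norm of a multilinear form (supremum over unit vectors in each argument). Velocity Verlet: for $h>0$ let $\lfloor t\rfloor_h=\max\{s\in h\mathbb{Z}:s\le t\}$ and $\lceil t\rceil_h=\min\{s\in h\mathbb{Z}:s\ge t\}$. For $(x,v)\in\mathbb{R}^{2d}$, $(\tilde q_t(x,v),\tilde v_t(x,v))_{t\ge0}$ is the continuous, piecewise differentiable solution of $$\tfrac{d}{dt}\tilde q_t=\tilde v_{\lfloor t\rfloor_h}-(t-\lfloor t\rfloor_h)\nabla U(\tilde q_{\lfloor t\rfloor_h}),\qquad \tfrac{d}{dt}\tilde v_t=-\tfrac12\left(\nabla U(\tilde q_{\lfloor t\rfloor_h})+\nabla U(\tilde q_{\lceil t\rceil_h})\right)$$ with $(\tilde q_0,\tilde v_0)=(x,v)$. Equivalently, on the grid $t_k=kh$: $\tilde q_{t_{k+1}}=\tilde q_{t_k}+h\tilde v_{t_k}-\frac{h^2}{2}\nabla U(\tilde q_{t_k})$ and $\tilde v_{t_{k+1}}=\tilde v_{t_k}-\frac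 h2[\nabla U(\tilde q_{t_k})+\nabla U(\tilde q_{t_{k+1}})]$. The unadjusted HMC (uHMC) kernel with duration $T$ and step size $h$ is $\tilde\pi(x,A)=P[\tilde q_T(x,\xi)\in A]$ with $\xi\sim\mathcal N(0,I_d)$. For a probability measure $\nu$, $\nu\tilde\pi(A)=\int\nu(dx)\tilde\pi(x,A)$, and $\tilde\pi^m$ is the $m$-fold composition ($\tilde\pi^0$ is the identity). $\mathrm{TV}(\nu,\eta)=\sup_A|\nu(A)-\eta(A)|$ over Borel sets $A$. $W^1(\nu,\eta)=\inf E[|X-Y|]$ over all couplings $(X,Y)$ of $\nu,\eta$ (possibly $+\infty$). *)

theory Defs
  imports "HOL-Probability.Probability"
begin

definition deriv_blinfun ::
  "('a::real_normed_vector \<Rightarrow> 'b::real_normed_vector) \<Rightarrow> 'a \<Rightarrow> 'a \<Rightarrow>\<^sub>L 'b" where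
  "deriv_blinfun f x = Blinfun (frechet_derivative f (at x))"

text \<open>The \<open>k\<close>-th derivative of \<open>U\<close> at \<open>x\<close> is the curried \<open>k\<close>-linear form obtained by iterating
  the Frechet derivative; the nested operator norm of \<^typ>\<open>'a \<Rightarrow>\<^sub>L 'b\<close> is the supremum over unit
  vectors in each argument.\<close>

definition D2 :: "('a::real_normed_vector \<Rightarrow> real) \<Rightarrow> 'a \<Rightarrow> 'a \<Rightarrow>\<^sub>L 'a \<Rightarrow>\<^sub>L real" where
  "D2 U = deriv_blinfun (deriv_blinfun U)"

definition D3 :: "('a::real_normed_vector \<Rightarrow> real) \<Rightarrow> 'a \<Rightarrow> 'a \<Rightarrow>\<^sub>L 'a \<Rightarrow>\<^sub>L 'a \<Rightarrow>\<^sub>L real" where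
  "D3 U = deriv_blinfun (D2 U)"

definition D4 :: "('a::real_normed_vector \<Rightarrow> real) \<Rightarrow> 'a \<Rightarrow> 'a \<Rightarrow>\<^sub>L 'a \<Rightarrow>\<^sub>L 'a \<Rightarrow>\<^sub>L 'a \<Rightarrow>\<^sub>L real" where
  "D4 U = deriv_blinfun (D3 U)"

definition C4 :: "('a::real_normed_vector \<Rightarrow> real) \<Rightarrow> bool" where
  "C4 U \<longleftrightarrow>
     (\<forall>x. U differentiable at x) \<and>
     (\<forall>x. deriv_blinfun U differentiable at x) \<and>
     (\<forall>x. D2 U differentiable at x) \<and>
     (\<forall>x. D3 U differentiable at x) \<and>
     continuous_on UNIV (D4 U)"

definition grad :: "('a::real_inner \<Rightarrow> real) \<Rightarrow> 'a \<Rightarrow> 'a" where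
  "grad U x = (THE g. GDERIV U x :> g)"

definition verlet_step ::
  "('a::real_inner \<Rightarrow> real) \<Rightarrow> real \<Rightarrow> 'a \<times> 'a \<Rightarrow> 'a \<times> 'a" where
  "verlet_step U h = (\<lambda>(q, v).
     let q' = q + h *\<^sub>R v - (h\<^sup>2 / 2) *\<^sub>R grad U q
     in (q', v - (h / 2) *\<^sub>R (grad U q + grad U q')))"

text \<open>The continuous-time description of velocity Verlet: a continuous path solving the piecewise
  differential equation away from the grid \<open>h\<int>\<close>. At the grid points it is the iteration of
  \<^const>\<open>verlet_step\<close>.\<close>

definition verlet_path ::
  "('a::real_inner \<Rightarrow> real) \<Rightarrow> real \<Rightarrow> (real \<Rightarrow> 'a) \<Rightarrow> (real \<Rightarrow> 'a) \<Rightarrow> bool" where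
  "verlet_path U h q v \<longleftrightarrow>
     continuous_on {0..} q \<and> continuous_on {0..} v \<and>
     (\<forall>t>0. t / h \<notin> \<int> \<longrightarrow>
        (let a = h * \<lfloor>t / h\<rfloor>; b = h * \<lceil>t / h\<rceil> in
         (q has_vector_derivative v a - (t - a) *\<^sub>R grad U (q a)) (at t) \<and>
         (v has_vector_derivative - (1 / 2) *\<^sub>R (grad U (q a) + grad U (q b))) (at t)))"

lemma verlet_path_grid:
  fixes U :: "'a::euclidean_space \<Rightarrow> real"
  assumes h: "h > 0" and path: "verlet_path U h q v"
  shows "(q (real k * h), v (real k * h)) = (verlet_step U h ^^ k) (q 0, v 0)"
proof (induction k)
  case 0
  show ?case by simp
next
  case (Suc k)
  define a where "a = real k * h"
  define b where "b = real (Suc k) * h"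
  have ab: "0 \<le> a" "a < b" "b - a = h" using h by (auto simp: a_def b_def algebra_simps)
  define w where "w = - (1 / 2) *\<^sub>R (grad U (q a) + grad U (q b))"
  have der: "(q has_vector_derivative v a - (t - a) *\<^sub>R grad U (q a)) (at t) \<and>
             (v has_vector_derivative w) (at t)" if t: "t \<in> {a<..<b}" for t
  proof -
    have l: "real k < t / h" and u: "t / h < real k + 1"
      using t h by (auto simp: a_def b_def field_simps)
    have fl: "\<lfloor>t / h\<rfloor> = int k" and ce: "\<lceil>t / h\<rceil> = int (Suc k)"
      using l u by (auto simp: floor_eq_iff ceiling_eq_iff)
    have "t / h \<notin> \<int>"
    proof
      assume "t / h \<in> \<int>"
      then have "real_of_int \<lfloor>t / h\<rfloor> = t / h" by simp
      then show False using fl l by simp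
    qed
    moreover have "h * real_of_int \<lfloor>t / h\<rfloor> = a" "h * real_of_int \<lceil>t / h\<rceil> = b"
      unfolding fl ce by (simp_all add: a_def b_def)
    moreover have "t > 0" using t ab by auto
    ultimately show ?thesis
      using path unfolding verlet_path_def Let_def w_def by metis
  qed
  have cq: "continuous_on {a..b} q" and cv: "continuous_on {a..b} v"
    using path ab unfolding verlet_path_def by (auto elim: continuous_on_subset)
  have "((\<lambda>t. v a - (t - a) *\<^sub>R grad U (q a)) has_integral q b - q a) {a..b}"
    using fundamental_theorem_of_calculus_interior[of a b q] ab cq der by auto
  moreover have "((\<lambda>t. v a - (t - a) *\<^sub>R grad U (q a)) has_integral
      (b *\<^sub>R v a - ((b - a)\<^sup>2 / 2) *\<^sub>R grad U (q a)) - (a *\<^sub>R v a - ((a - a)\<^sup>2 / 2) *\<^sub>R grad U (q a))) {a..b}"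
    using ab by (intro fundamental_theorem_of_calculus)
      (auto intro!: derivative_eq_intros simp: has_vector_derivative_def algebra_simps diff_divide_distrib)
  ultimately have "q b - q a =
      (b *\<^sub>R v a - ((b - a)\<^sup>2 / 2) *\<^sub>R grad U (q a)) - (a *\<^sub>R v a - ((a - a)\<^sup>2 / 2) *\<^sub>R grad U (q a))"
    by (rule has_integral_unique)
  also have "\<dots> = (b - a) *\<^sub>R v a - ((b - a)\<^sup>2 / 2) *\<^sub>R grad U (q a)"
    by (simp add: scaleR_left_diff_distrib)
  finally have qb: "q b = q a + h *\<^sub>R v a - (h\<^sup>2 / 2) *\<^sub>R grad U (q a)"
    unfolding ab(3) by (metis add_diff_eq add.commute diff_add_cancel)
  have "((\<lambda>t. w) has_integral v b - v a) {a..b}"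
    using fundamental_theorem_of_calculus_interior[of a b v] ab cv der by auto
  moreover have "((\<lambda>t. w) has_integral (b - a) *\<^sub>R w) {a..b}"
    using has_integral_const_real[of w a b] ab by simp
  ultimately have "v b - v a = (b - a) *\<^sub>R w"
    by (rule has_integral_unique)
  then have vb: "v b = v a - (h / 2) *\<^sub>R (grad U (q a) + grad U (q b))"
    unfolding ab(3) by (simp add: w_def algebra_simps)
  have "(verlet_step U h ^^ Suc k) (q 0, v 0) = verlet_step U h (q a, v a)"
    using Suc by (simp add: a_def)
  also have "\<dots> = (q b, v b)"
    using qb vb by (simp add: verlet_step_def Let_def)
  finally show ?case by (simp add: b_def)
qed

definition std_gaussian :: "'a::euclidean_space measure" where
  "std_gaussian = density lborel (\<lambda>x. ennreal (\<Prod>b\<in>Basis. std_normal_density (x \<bullet> b)))"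

text \<open>Only used when \<open>T / h\<close> is a natural number, so that \<open>nat \<lfloor>T / h\<rfloor>\<close> is the number of steps.\<close>

definition uhmc_kernel ::
  "('a::euclidean_space \<Rightarrow> real) \<Rightarrow> real \<Rightarrow> real \<Rightarrow> 'a \<Rightarrow> 'a measure" where
  "uhmc_kernel U T h x =
     distr std_gaussian borel (\<lambda>\<xi>. fst ((verlet_step U h ^^ nat \<lfloor>T / h\<rfloor>) (x, \<xi>)))"

text \<open>The action \<open>\<nu>\<pi>\<close> of a kernel on a measure is the monadic \<^const>\<open>bind\<close>.\<close>

primrec kernel_pow ::
  "('a::topological_space \<Rightarrow> 'a measure) \<Rightarrow> nat \<Rightarrow> 'a \<Rightarrow> 'a measure" where
  "kernel_pow K 0 = return borel"
| "kernel_pow K (Suc m) = (\<lambda>x. kernel_pow K m x \<bind> K)"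

definition borel_prob :: "'a::topological_space measure \<Rightarrow> bool" where
  "borel_prob \<nu> \<longleftrightarrow> prob_space \<nu> \<and> sets \<nu> = sets borel"

definition TV :: "'a::topological_space measure \<Rightarrow> 'a measure \<Rightarrow> real" where
  "TV \<nu> \<eta> = (SUP A\<in>sets borel. \<bar>measure \<nu> A - measure \<eta> A\<bar>)"

definition couplings ::
  "'a::topological_space measure \<Rightarrow> 'a measure \<Rightarrow> ('a \<times> 'a) measure set" where
  "couplings \<nu> \<eta> = {\<gamma>. prob_space \<gamma> \<and> sets \<gamma> = sets (borel \<Otimes>\<^sub>M borel) \<and>
     distr \<gamma> borel fst = \<nu> \<and> distr \<gamma> borel snd = \<eta>}"

definition W1 :: "'a::real_normed_vector measure \<Rightarrow> 'a measure \<Rightarrow> ennreal" where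
  "W1 \<nu> \<eta> = (INF \<gamma>\<in>couplings \<nu> \<eta>. \<integral>\<^sup>+ p. ennreal (norm (fst p - snd p)) \<partial>\<gamma>)"

definition gibbs :: "('a::euclidean_space \<Rightarrow> real) \<Rightarrow> 'a measure" where
  "gibbs U = density lborel (\<lambda>x. ennreal (exp (- U x) / (\<integral>y. exp (- U y) \<partial>lborel)))"

definition moment :: "'a::real_normed_vector measure \<Rightarrow> nat \<Rightarrow> ennreal" where
  "moment \<mu> p = (\<integral>\<^sup>+ x. ennreal (norm x ^ p) \<partial>\<mu>)"

definition ennreal_sqrt :: "ennreal \<Rightarrow> ennreal" where
  "ennreal_sqrt a = (if a = \<top> then \<top> else ennreal (sqrt (enn2real a)))"

text \<open>The moments of \<open>\<mu>\<close> may be infinite (for example for \<open>U x = p * ln (1 + \<bar>x\<bar>\<^sup>2)\<close>), in which case the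
  constant is \<^term>\<open>\<top> :: ennreal\<close>.\<close>

definition bias_const ::
  "real \<Rightarrow> real \<Rightarrow> real \<Rightarrow> real \<Rightarrow> real \<Rightarrow> 'a::real_normed_vector measure \<Rightarrow> ennreal" where
  "bias_const d L L\<^sub>H L\<^sub>I T \<mu> = ennreal_sqrt (
     ennreal (d^3 * (4 * L\<^sub>I^2 * T^4 + 14 * L\<^sub>H^2 * L\<^sub>I * T^6 + 14 * L\<^sub>H^4 * T^8)
       + d^2 * (35 * L\<^sub>H^2 * T^2 + 8 * L\<^sub>I^2 * T^4 + 28 * L\<^sub>H^2 * L\<^sub>I * T^6 + 28 * L\<^sub>H^4 * T^8)
       + d * (16 * L^2 + 4 * L\<^sub>H^2 * T^2))
     + ennreal (2 * d * L\<^sub>H^2 + L^2 / T^2) * moment \<mu> 2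
     + ennreal (d * L\<^sub>I^2 + d * L\<^sub>H^2 * L\<^sub>I * T^2 + d * L\<^sub>H^4 * T^4 + L\<^sub>H^2 / T^2) * moment \<mu> 4)"

end

theory Submission
  imports Defs
begin

text \<open>
  By the triangle inequality it suffices to bound the distance of \<open>\<mu>\<close> from \<open>\<mu>\<pi>\<close> and to show that
  \<open>\<pi>\<close> maps Wasserstein closeness to closeness in total variation.

  For the latter, let \<open>\<Phi>\<close> be the map of velocities such that Verlet started in \<open>(y, \<Phi> v)\<close> ends at the
  same position as Verlet started in \<open>(x, v)\<close>. It is a small perturbation of the identity, and the total
  variation distance of \<open>\<pi> x\<close> and \<open>\<pi> y\<close> is at most that of a standard Gaussian and its image under
  \<open>\<Phi>\<close>. Write \<open>\<Phi> = id + g\<close>. Gaussian integration by parts cancels the divergence of \<open>g\<close> in the relative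
  entropy against the trace of \<open>Dg\<close> in the logarithm of the Jacobian, so that only \<open>\<bar>g\<bar>\<^sup>2\<close> and the
  squared Frobenius norm of \<open>Dg\<close> remain.

  For the former no exact Hamiltonian flow is needed. Let \<open>\<rho>\<close> be the product of \<open>\<mu>\<close> with the standard
  Gaussian and \<open>\<Theta>\<close> one Verlet step. Since \<open>\<mu>\<pi>\<close> is the position marginal of the image of \<open>\<rho>\<close> under
  \<open>\<Theta>\<^sup>n\<close>, the distance is at most \<open>n\<close> times that of \<open>\<rho>\<close> and its image under \<open>\<Theta>\<close>. In terms of the
  midpoint \<open>m\<close> and the half-step velocity \<open>w\<close> both measures have densities, \<open>f (m, w)\<close> and
  \<open>f (m, - w)\<close>, with respect to Lebesgue measure times a standard Gaussian, because \<open>\<Theta>\<close> is volume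
  preserving and reversible. Their difference is odd in \<open>w\<close>, hence its \<open>L\<^sup>1\<close> norm is controlled by that
  of its gradient, in which the terms of order \<open>h\<^sup>2\<close> cancel up to the difference itself; this is
  absorbed when the claimed bound is below 1, and otherwise there is nothing to prove.
\<close>

section \<open>The standard Gaussian measure\<close>

text \<open>A run has n = T / h steps, so a bias of order h^2 forces an error of order h^3 per step.
  One factor h^2 / 4 is exact: it sits in the w-derivative of the density f. The missing power of h
  comes from the odd part f (m, w) - f (m, - w), whose derivative contains two nearly opposite
  velocities. What resists is the difference of the two densities multiplied by |v|, which is
  unbounded. There |v| is replaced by sqrt d plus a fluctuation: the first part returns the L^1 norm
  under estimation with a factor L h^2 sqrt d, the second is multiplied by the relative difference
  of the densities, an energy error of order h^3. The moments of \<mu> may be infinite, so these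
  terms are integrated through moments of the gradient, which is sub-Gaussian with variance proxy L
  in every direction. On the smoothing side the entropy argument is run with the affinity, the
  integral of sqrt r for the density ratio r. For this a lower bound of log r that is integrable and
  has a computable mean is enough.\<close>

definition gauss_density :: "'a::euclidean_space \<Rightarrow> real" where
  "gauss_density x = (\<Prod>b\<in>Basis. std_normal_density (x \<bullet> b))"

lemma gauss_density_eq:
  "gauss_density (x::'a::euclidean_space) = (1 / sqrt (2 * pi)) ^ DIM('a) * exp (- (norm x)\<^sup>2 / 2)"
proof -
  have "gauss_density x = (\<Prod>b\<in>(Basis::'a set). (1 / sqrt (2 * pi)) * exp (- ((x \<bullet> b)\<^sup>2 / 2)))"
    by (simp add: gauss_density_def std_normal_density_def)
  also have "\<dots> = (1 / sqrt (2 * pi)) ^ DIM('a) * exp (\<Sum>b\<in>Basis. - ((x \<bullet> b)\<^sup>2 / 2))"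
    by (simp only: prod.distrib prod_constant exp_sum finite_Basis)
  also have "(\<Sum>b\<in>Basis. - ((x \<bullet> b)\<^sup>2 / 2)) = - (norm x)\<^sup>2 / 2"
    unfolding euclidean_inner[of x x] power2_norm_eq_inner
    by (simp add: sum_negf sum_divide_distrib[symmetric] power2_eq_square)
  finally show ?thesis .
qed

lemma gauss_density_pos: "0 < gauss_density x"
  by (simp add: gauss_density_eq)

lemma gauss_density_nonneg [simp]: "0 \<le> gauss_density x"
  by (simp add: gauss_density_eq)

lemma measurable_gauss_density [measurable]: "gauss_density \<in> borel_measurable borel"
  unfolding gauss_density_def by measurable

lemma std_gaussian_eq: "std_gaussian = density lborel (\<lambda>x. ennreal (gauss_density x))"
  by (simp add: std_gaussian_def gauss_density_def)

lemma sets_std_gaussian [simp, measurable_cong]: "sets std_gaussian = sets borel"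
  by (simp add: std_gaussian_def)

lemma space_std_gaussian [simp]: "space std_gaussian = UNIV"
  by (simp add: std_gaussian_def)

lemma nn_integral_std_gaussian:
  "f \<in> borel_measurable borel \<Longrightarrow>
    (\<integral>\<^sup>+ x. f x \<partial>std_gaussian) = (\<integral>\<^sup>+ x. ennreal (gauss_density x) * f x \<partial>lborel)"
  unfolding std_gaussian_eq by (rule nn_integral_density) auto

lemma nn_integral_std_gaussian_prod:
  assumes [measurable]: "\<And>b. b \<in> Basis \<Longrightarrow> f b \<in> borel_measurable borel"
    and nn: "\<And>b x. b \<in> Basis \<Longrightarrow> 0 \<le> f b x"
  shows "(\<integral>\<^sup>+ x. ennreal (\<Prod>b\<in>(Basis::'a::euclidean_space set). f b (x \<bullet> b)) \<partial>std_gaussian) =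
    (\<Prod>b\<in>(Basis::'a set). \<integral>\<^sup>+ x. ennreal (std_normal_density x * f b x) \<partial>lborel)"
proof -
  have "(\<integral>\<^sup>+ x. ennreal (\<Prod>b\<in>(Basis::'a set). f b (x \<bullet> b)) \<partial>std_gaussian) =
      (\<integral>\<^sup>+ x. (\<Prod>b\<in>(Basis::'a set). ennreal (std_normal_density (x \<bullet> b) * f b (x \<bullet> b))) \<partial>lborel)"
    using nn by (subst nn_integral_std_gaussian)
      (auto simp: gauss_density_def prod.distrib[symmetric] prod_ennreal ennreal_mult[symmetric] prod_nonneg
        intro!: nn_integral_cong)
  also have "\<dots> = (\<Prod>b\<in>(Basis::'a set). \<integral>\<^sup>+ x. ennreal (std_normal_density x * f b x) \<partial>lborel)"
    using nn by (intro nn_integral_lborel_prod) auto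
  finally show ?thesis .
qed

section \<open>Moments of the standard Gaussian\<close>

lemma nn_integral_std_normal_moment:
  "(\<integral>\<^sup>+ x. ennreal (std_normal_density x * x ^ (2 * k)) \<partial>lborel) = ennreal (fact (2 * k) / (2 ^ k * fact k))"
  using std_normal_moment_even[of k] by (subst nn_integral_eq_integral)
    (auto simp: has_bochner_integral_iff zero_le_even_power)

lemma nn_integral_std_normal_1: "(\<integral>\<^sup>+ x. ennreal (std_normal_density x) \<partial>lborel) = 1"
  using nn_integral_std_normal_moment[of 0] by simp

lemma prob_space_std_gaussian: "prob_space (std_gaussian :: 'a::euclidean_space measure)"
proof
  show "emeasure (std_gaussian :: 'a measure) (space std_gaussian) = 1"
    using nn_integral_std_gaussian_prod[where f="\<lambda>(b::'a) _. 1"]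
    by (simp add: nn_integral_std_normal_1)
qed

interpretation std_gaussian: prob_space "std_gaussian :: 'a::euclidean_space measure"
  by (rule prob_space_std_gaussian)

lemma nn_integral_std_gaussian_moment:
  assumes b: "(b::'a::euclidean_space) \<in> Basis"
  shows "(\<integral>\<^sup>+ x. ennreal ((x \<bullet> b) ^ (2 * k)) \<partial>std_gaussian) = ennreal (fact (2 * k) / (2 ^ k * fact k))"
proof -
  have "(\<integral>\<^sup>+ x. ennreal ((x \<bullet> b) ^ (2 * k)) \<partial>std_gaussian) =
     (\<integral>\<^sup>+ x. ennreal (\<Prod>c\<in>Basis. (if c = b then (x \<bullet> c) ^ (2 * k) else 1)) \<partial>std_gaussian)"
    using b by (simp add: prod.delta)
  also have "\<dots> = (\<Prod>c\<in>(Basis::'a set). if c = b then ennreal (fact (2 * k) / (2 ^ k * fact k)) else 1)"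
    by (subst nn_integral_std_gaussian_prod[of "\<lambda>c y. if c = b then y ^ (2 * k) else 1"])
       (auto simp: zero_le_even_power nn_integral_std_normal_moment nn_integral_std_normal_1 simp del: prod.delta prod.delta' intro!: prod.cong)
  also have "\<dots> = ennreal (fact (2 * k) / (2 ^ k * fact k))"
    using b by (simp add: prod.delta)
  finally show ?thesis .
qed

lemma nn_integral_std_gaussian_moment_22:
  assumes b: "(b::'a::euclidean_space) \<in> Basis" "c \<in> Basis" "b \<noteq> c"
  shows "(\<integral>\<^sup>+ x. ennreal ((x \<bullet> b)\<^sup>2 * (x \<bullet> c)\<^sup>2) \<partial>std_gaussian) = 1"
proof -
  have "(\<integral>\<^sup>+ x. ennreal ((x \<bullet> b)\<^sup>2 * (x \<bullet> c)\<^sup>2) \<partial>std_gaussian) =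
     (\<integral>\<^sup>+ x. ennreal (\<Prod>e\<in>Basis. (if e \<in> {b, c} then (x \<bullet> e) ^ (2 * 1) else 1)) \<partial>std_gaussian)"
    using b by (subst prod.inter_restrict[symmetric]) (auto simp: Int_absorb1)
  also have "\<dots> = (\<Prod>e\<in>(Basis::'a set). 1)"
  proof (subst nn_integral_std_gaussian_prod[of "\<lambda>e y. if e \<in> {b, c} then y ^ (2 * 1) else 1"], safe intro!: prod.cong)
    fix e :: 'a
    show "(\<integral>\<^sup>+ y. ennreal (std_normal_density y * (if e \<in> {b, c} then y ^ (2 * 1) else 1)) \<partial>lborel) = 1"
      using nn_integral_std_normal_moment[of 1] by (cases "e \<in> {b, c}") (simp_all only: if_True if_False, simp_all add: nn_integral_std_normal_1)
  qed auto
  finally show ?thesis by simp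
qed

lemma integral_std_gaussian_moment:
  assumes b: "(b::'a::euclidean_space) \<in> Basis"
  shows "has_bochner_integral std_gaussian (\<lambda>x. (x \<bullet> b) ^ (2 * k)) (fact (2 * k) / (2 ^ k * fact k))"
  by (rule has_bochner_integral_nn_integral)
     (auto simp: zero_le_even_power nn_integral_std_gaussian_moment[OF b])

lemma integral_std_gaussian_moment_22:
  assumes b: "(b::'a::euclidean_space) \<in> Basis" "c \<in> Basis"
  shows "has_bochner_integral std_gaussian (\<lambda>x. (x \<bullet> b)\<^sup>2 * (x \<bullet> c)\<^sup>2) (if b = c then 3 else 1)"
proof (cases "b = c")
  case True
  then show ?thesis using integral_std_gaussian_moment[OF b(1), of 2]
    by (simp add: power2_eq_square power4_eq_xxxx fact_numeral mult.assoc)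
next
  case False
  then show ?thesis using nn_integral_std_gaussian_moment_22[OF b False]
    by (auto intro!: has_bochner_integral_nn_integral)
qed

lemma norm_power2_eq_sum: "(norm (x::'a::euclidean_space))\<^sup>2 = (\<Sum>b\<in>Basis. (x \<bullet> b)\<^sup>2)"
  unfolding power2_norm_eq_inner euclidean_inner[of x x] by (simp add: power2_eq_square)

lemma integral_std_gaussian_norm2:
  "has_bochner_integral std_gaussian (\<lambda>x::'a::euclidean_space. (norm x)\<^sup>2) DIM('a)"
proof -
  have "has_bochner_integral std_gaussian (\<lambda>x::'a. \<Sum>b\<in>Basis. (x \<bullet> b)\<^sup>2) (\<Sum>b\<in>(Basis::'a set). 1)"
    using integral_std_gaussian_moment[where k=1] by (intro has_bochner_integral_sum) simp
  then show ?thesis by (simp add: norm_power2_eq_sum)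
qed

text \<open>In the expansion of the squared sum the d diagonal pairs contribute 3 each and all other
  pairs 1.\<close>

lemma integral_std_gaussian_norm4:
  "has_bochner_integral std_gaussian (\<lambda>x::'a::euclidean_space. (norm x)^4) (real DIM('a) ^ 2 + 2 * real DIM('a))"
proof -
  have "has_bochner_integral std_gaussian (\<lambda>x::'a. \<Sum>b\<in>Basis. \<Sum>c\<in>Basis. (x \<bullet> b)\<^sup>2 * (x \<bullet> c)\<^sup>2)
      (\<Sum>b\<in>(Basis::'a set). \<Sum>c\<in>(Basis::'a set). if b = c then 3 else 1)"
    by (intro has_bochner_integral_sum integral_std_gaussian_moment_22)
  moreover have "(\<Sum>b\<in>(Basis::'a set). \<Sum>c\<in>(Basis::'a set). if b = c then 3 else 1 :: real) =
      (\<Sum>b\<in>(Basis::'a set). (\<Sum>c\<in>(Basis::'a set). 1 + (if b = c then 2 else 0)))"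
    by (intro sum.cong) auto
  moreover have "\<dots> = real DIM('a) ^ 2 + 2 * real DIM('a)"
    by (simp add: sum.distrib power2_eq_square algebra_simps)
  moreover have "(\<Sum>b\<in>Basis. \<Sum>c\<in>Basis. (x \<bullet> b)\<^sup>2 * (x \<bullet> c)\<^sup>2) = (norm x)^4" for x :: 'a
  proof -
    have "(norm x)^4 = (norm x)\<^sup>2 * (norm x)\<^sup>2" by (simp add: power2_eq_square power4_eq_xxxx)
    then show ?thesis by (simp add: norm_power2_eq_sum sum_product)
  qed
  ultimately show ?thesis by simp
qed

text \<open>The variance is of order d and not d^2. This concentration makes the relative
  fluctuation of |v|^2, called \<open>spread\<close> below, of order 1 / sqrt d.\<close>

lemma integral_std_gaussian_norm2_variance:
  "has_bochner_integral std_gaussian (\<lambda>x::'a::euclidean_space. ((norm x)\<^sup>2 - real DIM('a))\<^sup>2) (2 * real DIM('a))"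
proof -
  have "has_bochner_integral std_gaussian
      (\<lambda>x::'a. (norm x)^4 - (2 * real DIM('a)) * (norm x)\<^sup>2 + real DIM('a) ^ 2)
      ((real DIM('a) ^ 2 + 2 * real DIM('a)) - (2 * real DIM('a)) * real DIM('a) + real DIM('a) ^ 2)"
    using has_bochner_integral_integrable[OF std_gaussian.integrable_const, of "real DIM('a) ^ 2"]
    by (intro has_bochner_integral_add has_bochner_integral_diff has_bochner_integral_mult_right
        integral_std_gaussian_norm4 integral_std_gaussian_norm2) (simp add: std_gaussian.prob_space[simplified])
  then show ?thesis
    by (simp add: power2_eq_square power4_eq_xxxx algebra_simps)
qed

text \<open>Jensen's inequality for the convex function x^(k+1) with equal weights.\<close>

lemma power_sum_le:
  fixes a :: "'b \<Rightarrow> real"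
  assumes "finite B" "\<And>b. b \<in> B \<Longrightarrow> 0 \<le> a b"
  shows "(\<Sum>b\<in>B. a b) ^ Suc k \<le> real (card B) ^ k * (\<Sum>b\<in>B. a b ^ Suc k)"
proof (cases "B = {}")
  case False
  then have c: "0 < real (card B)" using assms by (simp add: card_gt_0_iff)
  have "convex_on {0..} (\<lambda>x::real. x ^ Suc k)"
    by (rule convex_on_realI[where f'="\<lambda>x. real (Suc k) * x ^ k"])
       (auto intro!: derivative_eq_intros power_mono mult_left_mono simp del: power_Suc)
  then have "(\<Sum>b\<in>B. (1 / real (card B)) *\<^sub>R a b) ^ Suc k \<le> (\<Sum>b\<in>B. (1 / real (card B)) * a b ^ Suc k)"
    using assms c False by (intro convex_on_sum) auto
  then have "((\<Sum>b\<in>B. a b) / real (card B)) ^ Suc k \<le> (\<Sum>b\<in>B. a b ^ Suc k) / real (card B)"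
    by (simp add: sum_divide_distrib[symmetric] del: power_Suc)
  then have "(\<Sum>b\<in>B. a b) ^ Suc k \<le> real (card B) ^ Suc k * ((\<Sum>b\<in>B. a b ^ Suc k) / real (card B))"
    using c by (simp add: power_divide pos_divide_le_eq mult.commute del: power_Suc)
  then show ?thesis using c by simp
qed auto

lemma norm_even_power_le:
  "norm (x::'a::euclidean_space) ^ (2 * Suc k) \<le> real DIM('a) ^ k * (\<Sum>b\<in>Basis. (x \<bullet> b) ^ (2 * Suc k))"
  unfolding power_mult norm_power2_eq_sum by (rule power_sum_le) auto

text \<open>Power means reduce to the coordinate moment 15 = 5 * 3 * 1. The exact value d (d + 2) (d
  + 4) has the same order in d.\<close>

lemma nn_integral_norm6_le:
  "(\<integral>\<^sup>+ x. ennreal (norm (x::'a::euclidean_space) ^ 6) \<partial>std_gaussian) \<le> ennreal (15 * real DIM('a) ^ 3)"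
proof -
  have "(\<integral>\<^sup>+ x. ennreal (norm (x::'a) ^ 6) \<partial>std_gaussian) \<le>
     (\<integral>\<^sup>+ x. ennreal (real DIM('a) ^ 2) * (\<Sum>b\<in>(Basis::'a set). ennreal ((x \<bullet> b) ^ (2 * 3))) \<partial>std_gaussian)"
    using norm_even_power_le[where k=2 and 'a='a]
    by (intro nn_integral_mono)
       (auto simp: sum_ennreal ennreal_mult[symmetric] zero_le_even_power sum_nonneg simp flip: power_mult intro!: ennreal_leI)
  also have "\<dots> = ennreal (real DIM('a) ^ 2) * (\<Sum>b\<in>(Basis::'a set). ennreal 15)"
    by (subst nn_integral_cmult, simp, subst nn_integral_sum, simp)
       (simp add: nn_integral_std_gaussian_moment[where k=3, simplified] fact_numeral del: sum_constant cong: sum.cong)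
  also have "\<dots> = ennreal (15 * real DIM('a) ^ 3)"
    by (simp add: sum_ennreal ennreal_mult[symmetric] ennreal_of_nat_eq_real_of_nat power2_eq_square power3_eq_cube mult_ac
        flip: ennreal_numeral)
  finally show ?thesis .
qed

section \<open>Translations, exponential moments and linear forms\<close>

lemma nn_integral_lborel_translate:
  fixes f :: "'a::euclidean_space \<Rightarrow> ennreal"
  assumes [measurable]: "f \<in> borel_measurable borel"
  shows "(\<integral>\<^sup>+ x. f (x + c) \<partial>lborel) = (\<integral>\<^sup>+ x. f x \<partial>lborel)"
proof -
  have "(\<integral>\<^sup>+ x. f x \<partial>lborel) = (\<integral>\<^sup>+ x. f x \<partial>distr lborel borel ((+) c))"
    by (simp add: lborel_distr_plus)
  also have "\<dots> = (\<integral>\<^sup>+ x. f (c + x) \<partial>lborel)"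
    by (subst nn_integral_distr) auto
  finally show ?thesis by (simp add: add.commute)
qed

lemma gauss_density_translate:
  "gauss_density (x - c) = gauss_density x * exp (x \<bullet> c - (norm c)\<^sup>2 / 2)"
proof -
  have "- (norm (x - c))\<^sup>2 / 2 = - (norm x)\<^sup>2 / 2 + (x \<bullet> c - (norm c)\<^sup>2 / 2)"
    by (simp add: power2_norm_eq_inner inner_diff inner_commute field_simps)
  then show ?thesis by (simp add: gauss_density_eq exp_add[symmetric])
qed

text \<open>The Cameron-Martin formula. It gives the Laplace transform at once, and its real-valued
  version gives integration by parts.\<close>

lemma nn_integral_std_gaussian_translate:
  fixes f :: "'a::euclidean_space \<Rightarrow> ennreal"
  assumes [measurable]: "f \<in> borel_measurable borel"
  shows "(\<integral>\<^sup>+ x. f (x + c) \<partial>std_gaussian) =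
    (\<integral>\<^sup>+ x. ennreal (exp (x \<bullet> c - (norm c)\<^sup>2 / 2)) * f x \<partial>std_gaussian)"
proof -
  have "(\<integral>\<^sup>+ x. f (x + c) \<partial>std_gaussian) = (\<integral>\<^sup>+ x. ennreal (gauss_density ((x + c) - c)) * f (x + c) \<partial>lborel)"
    by (subst nn_integral_std_gaussian) auto
  also have "\<dots> = (\<integral>\<^sup>+ x. ennreal (gauss_density (x - c)) * f x \<partial>lborel)"
    by (rule nn_integral_lborel_translate) simp
  also have "\<dots> = (\<integral>\<^sup>+ x. ennreal (gauss_density x) * (ennreal (exp (x \<bullet> c - (norm c)\<^sup>2 / 2)) * f x) \<partial>lborel)"
    by (simp add: gauss_density_translate ennreal_mult mult.assoc)
  also have "\<dots> = (\<integral>\<^sup>+ x. ennreal (exp (x \<bullet> c - (norm c)\<^sup>2 / 2)) * f x \<partial>std_gaussian)"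
    by (subst nn_integral_std_gaussian) auto
  finally show ?thesis .
qed

lemma nn_integral_std_gaussian_exp:
  "(\<integral>\<^sup>+ x. ennreal (exp (x \<bullet> (c::'a::euclidean_space))) \<partial>std_gaussian) = ennreal (exp ((norm c)\<^sup>2 / 2))"
proof -
  have "1 = (\<integral>\<^sup>+ x. ennreal (exp (x \<bullet> c - (norm c)\<^sup>2 / 2)) * 1 \<partial>std_gaussian)"
    by (subst nn_integral_std_gaussian_translate[symmetric]) (auto simp: std_gaussian.emeasure_space_1[simplified])
  then have "ennreal (exp ((norm c)\<^sup>2 / 2)) = ennreal (exp ((norm c)\<^sup>2 / 2)) *
     (\<integral>\<^sup>+ x. ennreal (exp (x \<bullet> c - (norm c)\<^sup>2 / 2)) \<partial>std_gaussian)" by simp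
  also have "\<dots> = (\<integral>\<^sup>+ x. ennreal (exp (x \<bullet> c)) \<partial>std_gaussian)"
    by (subst nn_integral_cmult[symmetric]) (auto simp: ennreal_mult[symmetric] exp_add[symmetric] )
  finally show ?thesis by simp
qed

lemma cosh_ge_monomial: "x ^ (2 * k) / fact (2 * k) \<le> cosh (x::real)"
proof -
  have s: "(\<lambda>n. if even n then x ^ n /\<^sub>R fact n else 0) sums cosh x" by (rule cosh_converges)
  have "(\<Sum>n\<in>{2 * k}. if even n then x ^ n /\<^sub>R fact n else 0) \<le> (\<Sum>n. if even n then x ^ n /\<^sub>R fact n else 0)"
    using sums_summable[OF s] by (intro sum_le_suminf) (auto simp: zero_le_even_power)
  then show ?thesis using sums_unique[OF s] by (simp add: field_simps)
qed

lemma cosh_ge_quadratic: "1 + x\<^sup>2 / 2 \<le> cosh (x::real)"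
proof -
  have s: "(\<lambda>n. if even n then x ^ n /\<^sub>R fact n else 0) sums cosh x" by (rule cosh_converges)
  have "(\<Sum>n\<in>{0, 2}. if even n then x ^ n /\<^sub>R fact n else 0) \<le> (\<Sum>n. if even n then x ^ n /\<^sub>R fact n else 0)"
    using sums_summable[OF s] by (intro sum_le_suminf) (auto simp: zero_le_even_power)
  then show ?thesis using sums_unique[OF s] by (simp add: field_simps)
qed

lemma integral_std_gaussian_exp:
  "has_bochner_integral std_gaussian (\<lambda>x. exp (x \<bullet> (c::'a::euclidean_space))) (exp ((norm c)\<^sup>2 / 2))"
  by (rule has_bochner_integral_nn_integral) (auto simp: nn_integral_std_gaussian_exp)

lemma integrable_std_gaussian_inner2:
  "integrable std_gaussian (\<lambda>x. (x \<bullet> (c::'a::euclidean_space))\<^sup>2)"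
proof (rule Bochner_Integration.integrable_bound)
  show "integrable std_gaussian (\<lambda>x. exp (x \<bullet> c) + exp (x \<bullet> (- c)))"
    using integral_std_gaussian_exp[of c] integral_std_gaussian_exp[of "- c"]
    by (intro Bochner_Integration.integrable_add) (auto simp: has_bochner_integral_iff)
  show "AE x in std_gaussian. norm ((x \<bullet> c)\<^sup>2) \<le> norm (exp (x \<bullet> c) + exp (x \<bullet> - c))"
  proof (rule AE_I2)
    fix x
    show "norm ((x \<bullet> c)\<^sup>2) \<le> norm (exp (x \<bullet> c) + exp (x \<bullet> - c))"
      using cosh_ge_quadratic[of "x \<bullet> c"] by (simp add: cosh_field_def)
  qed
qed auto

text \<open>The second moment in an arbitrary direction is read off from the Laplace transform: s (x
  . c)^2 is at most 2 cosh (sqrt s (x . c)) - 2, whose mean is 2 exp (s |c|^2 / 2) - 2. Dividing by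
  s and letting s tend to 0 gives the bound.\<close>

lemma integral_std_gaussian_inner2_le:
  "(\<integral>x. (x \<bullet> (c::'a::euclidean_space))\<^sup>2 \<partial>std_gaussian) \<le> (norm c)\<^sup>2"
proof -
  let ?A = "(norm c)\<^sup>2" and ?I = "\<integral>x. (x \<bullet> c)\<^sup>2 \<partial>std_gaussian"
  have le: "?I \<le> ?A + s * ?A\<^sup>2 / 2" if s: "0 < s" "s * ?A \<le> 2" for s
  proof -
    let ?c = "sqrt s *\<^sub>R c"
    have n: "(norm ?c)\<^sup>2 = s * ?A" using s by (simp add: power_mult_distrib)
    have "s * ?I = (\<integral>x. s * (x \<bullet> c)\<^sup>2 \<partial>std_gaussian)" by simp
    also have "\<dots> \<le> (\<integral>x. exp (x \<bullet> ?c) + exp (x \<bullet> (- ?c)) - 2 \<partial>std_gaussian)"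
    proof (rule integral_mono)
      show "integrable std_gaussian (\<lambda>x. s * (x \<bullet> c)\<^sup>2)"
        by (simp add: integrable_std_gaussian_inner2)
      show "integrable std_gaussian (\<lambda>x. exp (x \<bullet> ?c) + exp (x \<bullet> (- ?c)) - 2)"
        using integral_std_gaussian_exp[of ?c] integral_std_gaussian_exp[of "- ?c"]
        by (intro Bochner_Integration.integrable_diff Bochner_Integration.integrable_add) (auto simp: has_bochner_integral_iff)
      fix x
      have "(sqrt s * (x \<bullet> c))\<^sup>2 = s * (x \<bullet> c)\<^sup>2" using s by (simp add: power_mult_distrib)
      then show "s * (x \<bullet> c)\<^sup>2 \<le> exp (x \<bullet> ?c) + exp (x \<bullet> (- ?c)) - 2"
        using cosh_ge_quadratic[of "sqrt s * (x \<bullet> c)"] by (simp add: cosh_field_def)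
    qed
    also have "\<dots> = 2 * exp (s * ?A / 2) - 2"
      using integral_std_gaussian_exp[of ?c] integral_std_gaussian_exp[of "- ?c"] n
      by (subst Bochner_Integration.integral_diff Bochner_Integration.integral_add;
          auto simp: has_bochner_integral_iff std_gaussian.prob_space[simplified])+
    \<comment> \<open>The restriction on s keeps the argument of exp in [0, 1], where exp y <= 1 + y
      + y^2.\<close>
    also have "\<dots> \<le> 2 * (1 + s * ?A / 2 + (s * ?A / 2)\<^sup>2) - 2"
      using exp_bound[of "s * ?A / 2"] s by auto
    also have "\<dots> = s * (?A + s * ?A\<^sup>2 / 2)" by (simp add: power2_eq_square field_simps)
    finally show ?thesis using s by simp
  qed
  have "((\<lambda>s. ?A + s * ?A\<^sup>2 / 2) \<longlongrightarrow> ?A + 0 * ?A\<^sup>2 / 2) (at_right 0)"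
    by (intro tendsto_intros) auto
  moreover have "eventually (\<lambda>s. ?I \<le> ?A + s * ?A\<^sup>2 / 2) (at_right 0)"
  proof -
    have "((\<lambda>s. s * ?A) \<longlongrightarrow> 0 * ?A) (at_right 0)" by (intro tendsto_intros)
    then have "eventually (\<lambda>s. s * ?A < 2) (at_right 0)"
      by (rule order_tendstoD) auto
    then show ?thesis using eventually_at_right_less[of 0]
      by eventually_elim (metis le less_imp_le)
  qed
  ultimately have "?I \<le> ?A + 0 * ?A\<^sup>2 / 2"
    by (rule tendsto_lowerbound) auto
  then show ?thesis by simp
qed

text \<open>With l y = y . a, the arithmetic-geometric mean inequality |l y| <= (l y)^2 / (2 |a|) +
  |a| / 2 reduces the claim to the second moment. The exact mean sqrt (2 / pi) |a| is only slightly
  smaller, and no factor depends on the dimension.\<close>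

lemma nn_integral_std_gaussian_linear_le:
  fixes l :: "'a::euclidean_space \<Rightarrow> real"
  assumes l: "linear l" and K: "\<And>y. \<bar>l y\<bar> \<le> K * norm y"
  shows "(\<integral>\<^sup>+ y. ennreal \<bar>l y\<bar> \<partial>std_gaussian) \<le> ennreal K"
proof -
  define a where "a = (\<Sum>b\<in>Basis. l b *\<^sub>R b)"
  have la: "l y = y \<bullet> a" for y
  proof -
    have "l y = l (\<Sum>b\<in>Basis. (y \<bullet> b) *\<^sub>R b)" by (simp add: euclidean_representation)
    also have "\<dots> = (\<Sum>b\<in>Basis. (y \<bullet> b) * l b)" by (simp add: linear_sum[OF l] linear_scale[OF l])
    finally show ?thesis by (simp add: a_def inner_sum_right mult.commute)
  qed
  show ?thesis
  proof (cases "a = 0")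
    case False
    have "norm a * norm a \<le> K * norm a" using K[of a] la[of a] by (simp add: dot_square_norm power2_eq_square)
    then have aK: "norm a \<le> K" using False by simp
    have p: "\<bar>l y\<bar> \<le> (l y)\<^sup>2 / (2 * norm a) + norm a / 2" for y
    proof -
      have "0 \<le> (\<bar>l y\<bar> - norm a)\<^sup>2" by simp
      then have "2 * norm a * \<bar>l y\<bar> \<le> (l y)\<^sup>2 + (norm a)\<^sup>2" by (simp add: power2_diff algebra_simps)
      then show ?thesis using False by (simp add: field_simps power2_eq_square)
    qed
    have i: "integrable std_gaussian (\<lambda>y. (l y)\<^sup>2 / (2 * norm a) + norm a / 2)"
      using integrable_std_gaussian_inner2[of a] by (auto simp: la)
    have "(\<integral>\<^sup>+ y. ennreal \<bar>l y\<bar> \<partial>std_gaussian) \<le> (\<integral>\<^sup>+ y. ennreal ((l y)\<^sup>2 / (2 * norm a) + norm a / 2) \<partial>std_gaussian)"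
      using p by (intro nn_integral_mono ennreal_leI) auto
    also have "\<dots> = ennreal (\<integral>y. (l y)\<^sup>2 / (2 * norm a) + norm a / 2 \<partial>std_gaussian)"
      using i by (intro nn_integral_eq_integral) auto
    also have "(\<integral>y. (l y)\<^sup>2 / (2 * norm a) + norm a / 2 \<partial>std_gaussian) = (\<integral>y. (y \<bullet> a)\<^sup>2 \<partial>std_gaussian) / (2 * norm a) + norm a / 2"
      using integrable_std_gaussian_inner2[of a]
      by (simp add: la std_gaussian.prob_space[simplified])
    also have "\<dots> \<le> (norm a)\<^sup>2 / (2 * norm a) + norm a / 2"
      using integral_std_gaussian_inner2_le[of a] by (intro add_right_mono divide_right_mono) auto
    also have "\<dots> = norm a" using False by (simp add: power2_eq_square field_simps)
    finally show ?thesis using aK by (auto intro: order_trans ennreal_leI simp: ennreal_leI)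
  qed (simp add: la)
qed

section \<open>Rotation invariance and an L^1 bound for odd functions\<close>

lemma nn_integral_lborel_swap:
  assumes [measurable]: "case_prod F \<in> borel_measurable (borel \<Otimes>\<^sub>M borel)"
  shows "(\<integral>\<^sup>+ x. (\<integral>\<^sup>+ y. F x y \<partial>lborel) \<partial>(lborel :: 'a::euclidean_space measure)) =
    (\<integral>\<^sup>+ y. (\<integral>\<^sup>+ x. F x y \<partial>lborel) \<partial>(lborel :: 'b::euclidean_space measure))"
  by (rule lborel_pair.Fubini'[symmetric]) simp

text \<open>A rotation is a composition of three shears, with parameters \<open>tan (\<theta> / 2)\<close>, \<open>- sin \<theta>\<close> and
  \<open>tan (\<theta> / 2)\<close>, each of which preserves Lebesgue measure by translation invariance.\<close>

lemma nn_integral_rotate_std_gaussian: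
  fixes F :: "'a::euclidean_space \<Rightarrow> 'a \<Rightarrow> ennreal"
  assumes [measurable]: "case_prod F \<in> borel_measurable (borel \<Otimes>\<^sub>M borel)" and \<theta>: "\<bar>\<theta>\<bar> < pi"
  shows "(\<integral>\<^sup>+ x. (\<integral>\<^sup>+ y. F (cos \<theta> *\<^sub>R x + sin \<theta> *\<^sub>R y) (cos \<theta> *\<^sub>R y - sin \<theta> *\<^sub>R x) \<partial>std_gaussian) \<partial>std_gaussian) =
    (\<integral>\<^sup>+ x. (\<integral>\<^sup>+ y. F x y \<partial>std_gaussian) \<partial>std_gaussian)"
proof -
  define t where "t = tan (\<theta> / 2)"
  define s where "s = sin \<theta>"
  \<comment> \<open>The shear parameter tan (\<theta> / 2) is finite because the angle pi is
    excluded.\<close>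
  have c2: "cos (\<theta> / 2) \<noteq> 0" using cos_gt_zero_pi[of "\<theta> / 2"] \<theta> by (simp add: abs_less_iff)
  have ts: "1 - t * s = cos \<theta>" "t * (1 + cos \<theta>) = sin \<theta>"
  proof -
    have "s = 2 * sin (\<theta> / 2) * cos (\<theta> / 2)" "cos \<theta> = 1 - 2 * (sin (\<theta> / 2))\<^sup>2" "cos \<theta> = 2 * (cos (\<theta> / 2))\<^sup>2 - 1"
      unfolding s_def using sin_double[of "\<theta> / 2"] cos_double_sin[of "\<theta> / 2"] cos_double_cos[of "\<theta> / 2"] by auto
    then show "1 - t * s = cos \<theta>" "t * (1 + cos \<theta>) = sin \<theta>" using c2
      unfolding s_def[symmetric] t_def tan_def by (auto simp: power2_eq_square field_simps)
  qed
  define K where "K = (\<lambda>x y. ennreal (gauss_density x) * (ennreal (gauss_density y) * F x y))"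
  have [measurable]: "case_prod K \<in> borel_measurable (borel \<Otimes>\<^sub>M borel)" unfolding K_def by measurable
  define K1 where "K1 = (\<lambda>x y. K (x + t *\<^sub>R y) y)"
  have [measurable]: "case_prod K1 \<in> borel_measurable (borel \<Otimes>\<^sub>M borel)" unfolding K1_def by measurable
  define K2 where "K2 = (\<lambda>x y. K1 x (y + (- s) *\<^sub>R x))"
  have [measurable]: "case_prod K2 \<in> borel_measurable (borel \<Otimes>\<^sub>M borel)" unfolding K2_def by measurable
  define K3 where "K3 = (\<lambda>x y. K2 (x + t *\<^sub>R y) y)"
  have [measurable]: "case_prod K3 \<in> borel_measurable (borel \<Otimes>\<^sub>M borel)" unfolding K3_def by measurable
  have R: "K3 x y = K (cos \<theta> *\<^sub>R x + sin \<theta> *\<^sub>R y) (cos \<theta> *\<^sub>R y - sin \<theta> *\<^sub>R x)" for x y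
  proof -
    have 1: "y - s *\<^sub>R (x + t *\<^sub>R y) = cos \<theta> *\<^sub>R y - sin \<theta> *\<^sub>R x"
      unfolding ts(1)[symmetric] s_def by (simp add: algebra_simps)
    have 2: "x + t *\<^sub>R y + t *\<^sub>R (cos \<theta> *\<^sub>R y - sin \<theta> *\<^sub>R x) = (1 - t * s) *\<^sub>R x + (t * (1 + cos \<theta>)) *\<^sub>R y"
      by (simp add: algebra_simps s_def)
    show ?thesis unfolding K3_def K2_def K1_def using 1 2 unfolding ts by (simp add: scaleR_minus_left)
  qed
  \<comment> \<open>The product density depends only on |x|^2 + |y|^2, which the rotation
    preserves.\<close>
  have inv: "gauss_density (cos \<theta> *\<^sub>R x + sin \<theta> *\<^sub>R y) * gauss_density (cos \<theta> *\<^sub>R y - sin \<theta> *\<^sub>R x) =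
      gauss_density x * gauss_density y" for x y :: 'a
  proof -
    have "(norm (cos \<theta> *\<^sub>R x + sin \<theta> *\<^sub>R y))\<^sup>2 + (norm (cos \<theta> *\<^sub>R y - sin \<theta> *\<^sub>R x))\<^sup>2 =
        ((cos \<theta>)\<^sup>2 + (sin \<theta>)\<^sup>2) * ((norm x)\<^sup>2 + (norm y)\<^sup>2)"
      unfolding power2_norm_eq_inner inner_simps inner_commute[of y x] by algebra
    then have "- (norm (cos \<theta> *\<^sub>R x + sin \<theta> *\<^sub>R y))\<^sup>2 / 2 + - (norm (cos \<theta> *\<^sub>R y - sin \<theta> *\<^sub>R x))\<^sup>2 / 2 =
        - (norm x)\<^sup>2 / 2 + - (norm y)\<^sup>2 / 2" by (simp add: field_simps)
    then show ?thesis unfolding gauss_density_eq by (simp add: exp_add[symmetric] mult_ac)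
  qed
  have "(\<integral>\<^sup>+ x. (\<integral>\<^sup>+ y. F (cos \<theta> *\<^sub>R x + sin \<theta> *\<^sub>R y) (cos \<theta> *\<^sub>R y - sin \<theta> *\<^sub>R x) \<partial>std_gaussian) \<partial>std_gaussian) =
     (\<integral>\<^sup>+ x. (\<integral>\<^sup>+ y. K3 x y \<partial>lborel) \<partial>lborel)"
    unfolding R unfolding K_def mult.assoc[symmetric] ennreal_mult[symmetric, OF gauss_density_nonneg gauss_density_nonneg] inv
    by (simp add: nn_integral_std_gaussian nn_integral_cmult[symmetric] ennreal_mult mult.assoc)
  also have "\<dots> = (\<integral>\<^sup>+ y. (\<integral>\<^sup>+ x. K3 x y \<partial>lborel) \<partial>lborel)"
    by (rule nn_integral_lborel_swap) measurable
  also have "\<dots> = (\<integral>\<^sup>+ y. (\<integral>\<^sup>+ x. K2 x y \<partial>lborel) \<partial>lborel)"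
    unfolding K3_def by (intro nn_integral_cong nn_integral_lborel_translate) measurable
  also have "\<dots> = (\<integral>\<^sup>+ x. (\<integral>\<^sup>+ y. K2 x y \<partial>lborel) \<partial>lborel)"
    by (rule nn_integral_lborel_swap[symmetric]) measurable
  also have "\<dots> = (\<integral>\<^sup>+ x. (\<integral>\<^sup>+ y. K1 x y \<partial>lborel) \<partial>lborel)"
    unfolding K2_def by (intro nn_integral_cong nn_integral_lborel_translate) measurable
  also have "\<dots> = (\<integral>\<^sup>+ y. (\<integral>\<^sup>+ x. K1 x y \<partial>lborel) \<partial>lborel)"
    by (rule nn_integral_lborel_swap) measurable
  also have "\<dots> = (\<integral>\<^sup>+ y. (\<integral>\<^sup>+ x. K x y \<partial>lborel) \<partial>lborel)"
    unfolding K1_def by (intro nn_integral_cong nn_integral_lborel_translate) measurable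
  also have "\<dots> = (\<integral>\<^sup>+ x. (\<integral>\<^sup>+ y. K x y \<partial>lborel) \<partial>lborel)"
    by (rule nn_integral_lborel_swap[symmetric]) measurable
  also have "\<dots> = (\<integral>\<^sup>+ x. (\<integral>\<^sup>+ y. F x y \<partial>std_gaussian) \<partial>std_gaussian)"
    unfolding K_def by (simp add: nn_integral_std_gaussian nn_integral_cmult[symmetric])
  finally show ?thesis .
qed

text \<open>Rotating a pair \<open>(x, y)\<close> of independent Gaussian vectors by angles from \<open>0\<close> to \<open>\<pi>\<close> connects \<open>x\<close>
  to \<open>- x\<close> and leaves the joint law invariant.\<close>

lemma nn_integral_odd_le_derivative:
  fixes \<psi> :: "'a::euclidean_space \<Rightarrow> real"
  assumes der: "\<And>x. (\<psi> has_derivative \<psi>' x) (at x)"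
    and cont: "continuous_on UNIV (\<lambda>p. \<psi>' (fst p) (snd p))"
    and odd: "\<And>x. \<psi> (- x) = - \<psi> x"
  shows "(\<integral>\<^sup>+ x. ennreal \<bar>\<psi> x\<bar> \<partial>std_gaussian) \<le>
    ennreal (pi / 2) * (\<integral>\<^sup>+ x. (\<integral>\<^sup>+ y. ennreal \<bar>\<psi>' x y\<bar> \<partial>std_gaussian) \<partial>std_gaussian)"
proof -
  let ?G = "std_gaussian :: 'a measure"
  interpret P: pair_sigma_finite "lborel :: real measure" ?G ..
  define Z where "Z = (\<lambda>\<theta> x y :: 'a. cos \<theta> *\<^sub>R x + sin \<theta> *\<^sub>R y)"
  define Z' where "Z' = (\<lambda>\<theta> x y :: 'a. cos \<theta> *\<^sub>R y - sin \<theta> *\<^sub>R x)"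
  define k where "k = (\<lambda>\<theta> x y. \<psi>' (Z \<theta> x y) (Z' \<theta> x y))"
  define I where "I = (\<integral>\<^sup>+ x. (\<integral>\<^sup>+ y. ennreal \<bar>\<psi>' x y\<bar> \<partial>?G) \<partial>?G)"
  have m\<psi>': "(\<lambda>p. \<psi>' (fst p) (snd p)) \<in> borel_measurable (borel \<Otimes>\<^sub>M borel)"
    using borel_measurable_continuous_onI[OF cont] by (simp add: borel_prod)
  have "continuous_on UNIV \<psi>"
    using der by (meson has_derivative_continuous continuous_at_imp_continuous_on)
  then have [measurable]: "\<psi> \<in> borel_measurable borel" by (rule borel_measurable_continuous_onI)
  have mk: "(\<lambda>p. k (f p) (g p) (j p)) \<in> borel_measurable M"
    if [measurable]: "f \<in> borel_measurable M" "g \<in> borel_measurable M" "j \<in> borel_measurable M" for f g j and M :: "'z measure"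
    unfolding k_def Z_def Z'_def
    using measurable_compose[OF _ m\<psi>', of "\<lambda>p. (cos (f p) *\<^sub>R g p + sin (f p) *\<^sub>R j p, cos (f p) *\<^sub>R j p - sin (f p) *\<^sub>R g p)" M]
    by simp
  note mk[measurable]
  have one: "ennreal (2 * \<bar>\<psi> x\<bar>) \<le> (\<integral>\<^sup>+ \<theta>. indicator {0..pi} \<theta> * ennreal \<bar>k \<theta> x y\<bar> \<partial>lborel)" for x y
  proof -
    have d: "((\<lambda>\<theta>. \<psi> (Z \<theta> x y)) has_vector_derivative k \<theta> x y) (at \<theta> within {0..pi})" for \<theta>
    proof -
      have "((\<lambda>\<theta>. Z \<theta> x y) has_vector_derivative Z' \<theta> x y) (at \<theta> within {0..pi})"
        unfolding Z_def Z'_def has_vector_derivative_def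
        by (auto intro!: derivative_eq_intros simp: algebra_simps)
      from vector_derivative_diff_chain_within[OF this has_derivative_at_withinI[OF der]]
      show ?thesis by (simp add: k_def o_def)
    qed
    have c: "continuous_on {0..pi} (\<lambda>\<theta>. k \<theta> x y)"
    proof -
      have "continuous_on {0..pi} (\<lambda>\<theta>. (\<lambda>p. \<psi>' (fst p) (snd p)) (Z \<theta> x y, Z' \<theta> x y))"
        by (rule continuous_on_compose2[OF cont]) (auto simp: Z_def Z'_def intro!: continuous_intros)
      then show ?thesis by (simp add: k_def)
    qed
    have i: "integrable lborel (\<lambda>\<theta>. indicator {0..pi} \<theta> *\<^sub>R k \<theta> x y)"
      using borel_integrable_atLeastAtMost'[OF c] by (simp add: set_integrable_def)
    \<comment> \<open>The path leads from x to - x, so oddness turns the increment into -2 \<psi> x.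
      The constant pi / 2 of the lemma is the length pi of the angle interval divided by this
      2.\<close>
    have "(\<integral>\<theta>. indicator {0..pi} \<theta> *\<^sub>R k \<theta> x y \<partial>lborel) = \<psi> (Z pi x y) - \<psi> (Z 0 x y)"
      using d c by (intro integral_FTC_atLeastAtMost) auto
    also have "\<dots> = - 2 * \<psi> x" by (simp add: Z_def odd)
    finally have "ennreal (2 * \<bar>\<psi> x\<bar>) = ennreal (norm (\<integral>\<theta>. indicator {0..pi} \<theta> *\<^sub>R k \<theta> x y \<partial>lborel))"
      by (simp add: abs_mult)
    also have "\<dots> \<le> (\<integral>\<^sup>+ \<theta>. ennreal (norm (indicator {0..pi} \<theta> *\<^sub>R k \<theta> x y)) \<partial>lborel)"
      using i by (rule integral_norm_bound_ennreal)
    also have "\<dots> = (\<integral>\<^sup>+ \<theta>. indicator {0..pi} \<theta> * ennreal \<bar>k \<theta> x y\<bar> \<partial>lborel)"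
      by (intro nn_integral_cong) (auto split: split_indicator)
    finally show ?thesis .
  qed
  have "2 * (\<integral>\<^sup>+ x. ennreal \<bar>\<psi> x\<bar> \<partial>?G) = (\<integral>\<^sup>+ x. (\<integral>\<^sup>+ y. ennreal (2 * \<bar>\<psi> x\<bar>) \<partial>?G) \<partial>?G)"
    by (simp add: std_gaussian.emeasure_space_1[simplified] ennreal_mult nn_integral_cmult)
  also have "\<dots> \<le> (\<integral>\<^sup>+ x. (\<integral>\<^sup>+ y. (\<integral>\<^sup>+ \<theta>. indicator {0..pi} \<theta> * ennreal \<bar>k \<theta> x y\<bar> \<partial>lborel) \<partial>?G) \<partial>?G)"
    by (intro nn_integral_mono one)
  also have "\<dots> = (\<integral>\<^sup>+ x. (\<integral>\<^sup>+ \<theta>. (\<integral>\<^sup>+ y. indicator {0..pi} \<theta> * ennreal \<bar>k \<theta> x y\<bar> \<partial>?G) \<partial>lborel) \<partial>?G)"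
    by (intro nn_integral_cong P.Fubini') measurable
  also have "\<dots> = (\<integral>\<^sup>+ \<theta>. (\<integral>\<^sup>+ x. (\<integral>\<^sup>+ y. indicator {0..pi} \<theta> * ennreal \<bar>k \<theta> x y\<bar> \<partial>?G) \<partial>?G) \<partial>lborel)"
    by (intro P.Fubini') measurable
  also have "\<dots> = (\<integral>\<^sup>+ \<theta>. indicator {0..pi} \<theta> * (\<integral>\<^sup>+ x. (\<integral>\<^sup>+ y. ennreal \<bar>k \<theta> x y\<bar> \<partial>?G) \<partial>?G) \<partial>lborel)"
    by (simp add: nn_integral_cmult)
  also have "\<dots> = (\<integral>\<^sup>+ \<theta>. indicator {0..pi} \<theta> * I \<partial>lborel)"
  proof (rule nn_integral_cong_AE)
    \<comment> \<open>The angle pi, excluded in the rotation formula, is a null set.\<close>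
    show "AE \<theta> in lborel. indicator {0..pi} \<theta> * (\<integral>\<^sup>+ x. (\<integral>\<^sup>+ y. ennreal \<bar>k \<theta> x y\<bar> \<partial>?G) \<partial>?G) = indicator {0..pi} \<theta> * I"
      using AE_lborel_singleton[of pi]
    proof eventually_elim
      case (elim \<theta>)
      show ?case
      proof (cases "\<theta> \<in> {0..pi}")
        case True
        then have "\<bar>\<theta>\<bar> < pi" using elim by auto
        from nn_integral_rotate_std_gaussian[OF _ this, of "\<lambda>x y. ennreal \<bar>\<psi>' x y\<bar>"] m\<psi>'
        have "(\<integral>\<^sup>+ x. (\<integral>\<^sup>+ y. ennreal \<bar>k \<theta> x y\<bar> \<partial>?G) \<partial>?G) = I"
          unfolding I_def k_def Z_def Z'_def by (simp add: case_prod_beta')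
        then show ?thesis by simp
      qed simp
    qed
  qed
  also have "\<dots> = ennreal pi * I"
    by (simp add: nn_integral_multc)
  also have "ennreal pi * I = 2 * (ennreal (pi / 2) * I)"
    by (simp add: mult.assoc[symmetric] ennreal_mult[symmetric] flip: ennreal_numeral)
  finally show ?thesis by (simp add: I_def ennreal_mult_le_mult_iff)
qed

section \<open>Overlap of a Gaussian with its image under a near-identity map\<close>

text \<open>The change of variables formula of the library needs a well-ordered index type. Copying the index
  type and choosing a well-order on the copy removes this restriction.\<close>

typedef 'a wo = "UNIV :: 'a set" by auto

instance wo :: (finite) finite
proof
  have "range (Abs_wo :: 'a \<Rightarrow> 'a wo) = UNIV" by (metis Abs_wo_cases UNIV_eq_I rangeI)
  then show "finite (UNIV :: 'a wo set)" by (metis finite finite_imageI)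
qed

definition chosen_order :: "('a \<times> 'a) set" where "chosen_order = (SOME r. well_order_on UNIV r)"

instantiation wo :: (type) wellorder
begin
definition less_eq_wo :: "'a wo \<Rightarrow> 'a wo \<Rightarrow> bool" where
  "x \<le> y \<longleftrightarrow> (Rep_wo x, Rep_wo y) \<in> chosen_order"
definition less_wo :: "'a wo \<Rightarrow> 'a wo \<Rightarrow> bool" where
  "less_wo x y \<longleftrightarrow> x \<le> y \<and> \<not> y \<le> x"
instance
proof
  have W: "well_order_on UNIV (chosen_order :: ('a \<times> 'a) set)"
    unfolding chosen_order_def by (rule someI_ex) (rule well_order_on)
  define r where "r = (chosen_order :: ('a \<times> 'a) set)"
  have L: "refl r" "trans r" "antisym r" "total r" "wf (r - Id)"
    using W unfolding r_def[symmetric]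
    by (auto simp: well_order_on_def linear_order_on_def partial_order_on_def preorder_on_def)
  note less_eq_wo_def = less_eq_wo_def[folded r_def]
  fix x y z :: "'a wo"
  show "(x < y) = (x \<le> y \<and> \<not> y \<le> x)" by (simp add: less_wo_def)
  show "x \<le> x" using L by (auto simp: less_eq_wo_def refl_on_def)
  show "x \<le> y \<Longrightarrow> y \<le> z \<Longrightarrow> x \<le> z" using L unfolding less_eq_wo_def by (meson transD)
  show "x \<le> y \<Longrightarrow> y \<le> x \<Longrightarrow> x = y" using L unfolding less_eq_wo_def by (metis antisymD Rep_wo_inject)
  show "x \<le> y \<or> y \<le> x" using L unfolding less_eq_wo_def total_on_def refl_on_def by (metis UNIV_I)
  fix P :: "'a wo \<Rightarrow> bool" and a :: "'a wo"
  assume step: "\<And>x. (\<And>y. y < x \<Longrightarrow> P y) \<Longrightarrow> P x"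
  have "P (Abs_wo u)" for u
  proof (induction u rule: wf_induct_rule[OF L(5)])
    case (1 u)
    show ?case
    proof (rule step)
      fix y assume "y < Abs_wo u"
      then have "(Rep_wo y, u) \<in> r - Id"
        using Abs_wo_inverse less_wo_def less_eq_wo_def by (metis DiffI UNIV_I pair_in_Id_conv)
      from 1[OF this] show "P y" by (simp add: Rep_wo_inverse)
    qed
  qed
  then show "P a" by (metis Rep_wo_inverse)
qed
end

section \<open>Gaussian integration by parts\<close>

lemma abs_exp_minus_one_le: "\<bar>exp s - 1\<bar> \<le> \<bar>s\<bar> * exp \<bar>s::real\<bar>"
proof (cases "0 \<le> s")
  case True
  have "(1 - s) * exp s \<le> exp (- s) * exp s"
    using exp_ge_add_one_self[of "- s"] by (intro mult_right_mono) auto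
  then show ?thesis using True by (simp add: exp_minus algebra_simps)
next
  case False
  have "1 - exp s \<le> - s" using exp_ge_add_one_self[of s] by linarith
  also have "\<dots> \<le> - s * exp \<bar>s\<bar>" using False by simp
  finally show ?thesis using False by simp
qed

lemma integral_lborel_translate:
  fixes f :: "'a::euclidean_space \<Rightarrow> real"
  assumes [measurable]: "f \<in> borel_measurable borel"
  shows "(\<integral>x. f (x + c) \<partial>lborel) = (\<integral>x. f x \<partial>lborel)"
proof -
  have "(\<integral>x. f x \<partial>lborel) = (\<integral>x. f x \<partial>distr lborel borel ((+) c))"
    by (simp add: lborel_distr_plus)
  also have "\<dots> = (\<integral>x. f (c + x) \<partial>lborel)"
    by (subst integral_distr) auto
  finally show ?thesis by (simp add: add.commute)
qed

lemma integral_std_gaussian: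
  fixes f :: "'a::euclidean_space \<Rightarrow> real"
  assumes [measurable]: "f \<in> borel_measurable borel"
  shows "(\<integral>x. f x \<partial>std_gaussian) = (\<integral>x. gauss_density x * f x \<partial>lborel)"
  unfolding std_gaussian_eq by (subst integral_density) auto

lemma integrable_std_gaussian_iff:
  fixes f :: "'a::euclidean_space \<Rightarrow> real"
  assumes [measurable]: "f \<in> borel_measurable borel"
  shows "integrable std_gaussian f \<longleftrightarrow> integrable lborel (\<lambda>x. gauss_density x * f x)"
  unfolding std_gaussian_eq by (subst integrable_density) auto

lemma integral_std_gaussian_translate:
  fixes f :: "'a::euclidean_space \<Rightarrow> real"
  assumes [measurable]: "f \<in> borel_measurable borel"
  shows "(\<integral>x. f (x + c) \<partial>std_gaussian) = (\<integral>x. f x * exp (x \<bullet> c - (norm c)\<^sup>2 / 2) \<partial>std_gaussian)"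
proof -
  have "(\<integral>x. f (x + c) \<partial>std_gaussian) = (\<integral>x. gauss_density ((x + c) - c) * f (x + c) \<partial>lborel)"
    by (subst integral_std_gaussian) auto
  also have "\<dots> = (\<integral>x. gauss_density (x - c) * f x \<partial>lborel)"
    by (rule integral_lborel_translate) simp
  also have "\<dots> = (\<integral>x. f x * exp (x \<bullet> c - (norm c)\<^sup>2 / 2) \<partial>std_gaussian)"
    by (subst integral_std_gaussian) (auto simp: gauss_density_translate mult_ac)
  finally show ?thesis .
qed

text \<open>Apart from the limit itself, this yields Borel measurability of directional derivatives,
  as pointwise limits of measurable difference quotients.\<close>

lemma has_derivative_difference_quotient:
  fixes \<phi> :: "'a::euclidean_space \<Rightarrow> real"
  assumes "(\<phi> has_derivative D) (at x)"
  shows "(\<lambda>n. (\<phi> (x + (1 / real (Suc n)) *\<^sub>R e) - \<phi> x) / (1 / real (Suc n))) \<longlonglongrightarrow> D e"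
proof -
  have "((\<lambda>t. x + t *\<^sub>R e) has_derivative (\<lambda>t. t *\<^sub>R e)) (at 0)"
    by (auto intro!: derivative_eq_intros)
  moreover have "(\<phi> has_derivative D) (at (x + 0 *\<^sub>R e))" using assms by simp
  ultimately have "((\<lambda>t. \<phi> (x + t *\<^sub>R e)) has_derivative (\<lambda>t. D (t *\<^sub>R e))) (at 0)"
    by (rule has_derivative_compose)
  moreover have "(\<lambda>t. D (t *\<^sub>R e)) = (*) (D e)"
    using has_derivative_linear[OF assms] by (auto simp: linear_scale mult.commute)
  ultimately have "((\<lambda>t. \<phi> (x + t *\<^sub>R e)) has_field_derivative D e) (at 0)"
    by (simp add: has_field_derivative_def)
  then have lim: "((\<lambda>t. (\<phi> (x + t *\<^sub>R e) - \<phi> x) / t) \<longlongrightarrow> D e) (at 0)"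
    by (simp add: DERIV_def)
  have "filterlim (\<lambda>n. 1 / real (Suc n)) (at 0) sequentially"
    unfolding filterlim_at using LIMSEQ_inverse_real_of_nat by (auto simp: inverse_eq_divide)
  from filterlim_compose[OF lim this] show ?thesis .
qed

text \<open>The Cameron-Martin formula for the shift t e is differentiated at t = 0 along t = 1 / (n
  + 1). Dominated convergence applies on both sides: to difference quotients of \<phi>, which are
  bounded, and to difference quotients \<open>r\<close> of the Cameron-Martin density.\<close>

lemma std_gaussian_integration_by_parts:
  fixes \<phi> :: "'a::euclidean_space \<Rightarrow> real"
  assumes der: "\<And>x. (\<phi> has_derivative \<phi>' x) (at x)"
    and bound: "\<And>x. \<bar>\<phi> x\<bar> \<le> C" and bound': "\<And>x y. \<bar>\<phi>' x y\<bar> \<le> K * norm y"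
  shows "integrable std_gaussian (\<lambda>x. \<phi> x * (x \<bullet> e))" "integrable std_gaussian (\<lambda>x. \<phi>' x e)"
    "(\<integral>x. \<phi> x * (x \<bullet> e) \<partial>std_gaussian) = (\<integral>x. \<phi>' x e \<partial>std_gaussian)"
proof -
  define t where "t = (\<lambda>n. 1 / real (Suc n))"
  have t: "0 < t n" "t n \<le> 1" for n by (auto simp: t_def)
  have t0: "t \<longlonglongrightarrow> 0" unfolding t_def using LIMSEQ_inverse_real_of_nat by (simp add: inverse_eq_divide)
  have "continuous_on UNIV \<phi>"
    using der by (meson has_derivative_continuous continuous_at_imp_continuous_on)
  then have [measurable]: "\<phi> \<in> borel_measurable borel" by (rule borel_measurable_continuous_onI)
  have lim1: "(\<lambda>n. (\<phi> (x + t n *\<^sub>R e) - \<phi> x) / t n) \<longlonglongrightarrow> \<phi>' x e" for x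
    using has_derivative_difference_quotient[OF der] by (simp add: t_def)
  have [measurable]: "(\<lambda>x. \<phi>' x e) \<in> borel_measurable borel"
    by (rule borel_measurable_LIMSEQ_metric[OF _ lim1]) measurable
  show i2: "integrable std_gaussian (\<lambda>x. \<phi>' x e)"
    by (rule std_gaussian.integrable_const_bound[of _ "K * norm e"]) (auto simp: bound')
  have C: "0 \<le> C" using bound[of 0] by (smt (verit) abs_ge_zero)
  have K: "0 \<le> K" using bound'[of 0 "SOME b. b \<in> Basis"] by (metis abs_ge_zero mult.right_neutral norm_Basis order_trans some_in_eq nonempty_Basis)
  \<comment> \<open>An integrable function dominating every \<open>r n\<close>: since t <= 1, |r| <=
    |a| exp |a| <= exp (2 |a|) with |a| <= |x . e| + |e|^2 / 2.\<close>
  define W where "W = (\<lambda>x. exp ((norm e)\<^sup>2) * (exp (x \<bullet> (2 *\<^sub>R e)) + exp (x \<bullet> (- 2 *\<^sub>R e))))"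
  have W: "integrable std_gaussian W"
    unfolding W_def using integral_std_gaussian_exp[of "2 *\<^sub>R e"] integral_std_gaussian_exp[of "- 2 *\<^sub>R e"]
    by (intro integrable_mult_right Bochner_Integration.integrable_add) (auto simp: has_bochner_integral_iff)
  have expW: "exp (2 * (\<bar>x \<bullet> e\<bar> + (norm e)\<^sup>2 / 2)) \<le> W x" for x
  proof -
    have "exp (2 * \<bar>x \<bullet> e\<bar>) \<le> exp (x \<bullet> (2 *\<^sub>R e)) + exp (x \<bullet> (- 2 *\<^sub>R e))"
      by (cases "0 \<le> x \<bullet> e") auto
    then have "exp ((norm e)\<^sup>2) * exp (2 * \<bar>x \<bullet> e\<bar>) \<le> W x"
      unfolding W_def by (rule mult_left_mono) simp
    then show ?thesis by (simp add: exp_add[symmetric] algebra_simps)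
  qed
  define r where "r = (\<lambda>n x. (exp (t n * (x \<bullet> e) - (t n)\<^sup>2 * (norm e)\<^sup>2 / 2) - 1) / t n)"
  have rb: "\<bar>r n x\<bar> \<le> W x" for n x
  proof -
    define a where "a = x \<bullet> e - t n * (norm e)\<^sup>2 / 2"
    have r: "r n x = (exp (t n * a) - 1) / t n" by (simp add: r_def a_def power2_eq_square algebra_simps)
    have ab: "\<bar>a\<bar> \<le> \<bar>x \<bullet> e\<bar> + (norm e)\<^sup>2 / 2"
    proof -
      have "t n * (norm e)\<^sup>2 \<le> 1 * (norm e)\<^sup>2" using t[of n] by (intro mult_right_mono) auto
      moreover have "0 \<le> t n * (norm e)\<^sup>2" using t[of n] by simp
      ultimately show ?thesis unfolding a_def by linarith
    qed
    have "\<bar>r n x\<bar> \<le> (\<bar>t n * a\<bar> * exp \<bar>t n * a\<bar>) / t n"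
      unfolding r using t[of n] abs_exp_minus_one_le[of "t n * a"] by (simp add: divide_right_mono)
    also have "\<dots> = \<bar>a\<bar> * exp \<bar>t n * a\<bar>" using t[of n] by (simp add: abs_mult)
    also have "\<dots> \<le> exp \<bar>a\<bar> * exp \<bar>a\<bar>"
    proof (rule mult_mono)
      show "\<bar>a\<bar> \<le> exp \<bar>a\<bar>" using exp_ge_add_one_self[of "\<bar>a\<bar>"] by linarith
    qed (use t[of n] in \<open>auto simp: abs_mult mult_left_le_one_le\<close>)
    also have "\<dots> = exp (2 * \<bar>a\<bar>)" by (simp add: exp_add[symmetric])
    also have "\<dots> \<le> exp (2 * (\<bar>x \<bullet> e\<bar> + (norm e)\<^sup>2 / 2))" using ab by simp
    also have "\<dots> \<le> W x" by (rule expW)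
    finally show ?thesis .
  qed
  have rlim: "(\<lambda>n. r n x) \<longlonglongrightarrow> x \<bullet> e" for x
  proof -
    have "((\<lambda>s. exp (s * (x \<bullet> e) - s\<^sup>2 * (norm e)\<^sup>2 / 2)) has_real_derivative (x \<bullet> e)) (at 0)"
      by (auto intro!: derivative_eq_intros)
    then have "((\<lambda>s. (exp (s * (x \<bullet> e) - s\<^sup>2 * (norm e)\<^sup>2 / 2) - 1) / s) \<longlongrightarrow> x \<bullet> e) (at 0)"
      by (simp add: DERIV_def)
    moreover have "filterlim t (at 0) sequentially"
      unfolding filterlim_at using t0 t by (auto intro!: always_eventually simp: less_imp_neq[symmetric])
    ultimately show ?thesis unfolding r_def by (rule filterlim_compose)
  qed
  have CW: "integrable std_gaussian (\<lambda>x. C * W x)" using W by simp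
  have W0: "0 \<le> W x" for x by (simp add: W_def)
  have m1: "AE x in std_gaussian. (\<lambda>n. \<phi> x * r n x) \<longlonglongrightarrow> \<phi> x * (x \<bullet> e)"
    by (intro AE_I2 tendsto_mult tendsto_const rlim)
  have m2: "AE x in std_gaussian. norm (\<phi> x * r n x) \<le> C * W x" for n
    using bound rb C by (auto simp: abs_mult intro!: AE_I2 mult_mono)
  have [measurable]: "r n \<in> borel_measurable borel" for n unfolding r_def by measurable
  have dc: "integrable std_gaussian (\<lambda>x. \<phi> x * (x \<bullet> e))"
    by (rule integrable_dominated_convergence[OF _ _ CW m1 m2]) measurable
  have dc2: "(\<lambda>n. \<integral>x. \<phi> x * r n x \<partial>std_gaussian) \<longlonglongrightarrow> (\<integral>x. \<phi> x * (x \<bullet> e) \<partial>std_gaussian)"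
    by (rule integral_dominated_convergence[OF _ _ CW m1 m2]) measurable
  have dc3: "integrable std_gaussian (\<lambda>x. \<phi> x * r n x)" for n
    by (rule integrable_dominated_convergence2[OF _ _ CW m1 m2]) measurable
  show "integrable std_gaussian (\<lambda>x. \<phi> x * (x \<bullet> e))" by (rule dc)
  have i\<phi>: "integrable std_gaussian (\<lambda>x. \<phi> (x + c))" for c
    by (rule std_gaussian.integrable_const_bound[of _ C]) (auto simp: bound)
  have "(\<lambda>n. \<integral>x. (\<phi> (x + t n *\<^sub>R e) - \<phi> x) / t n \<partial>std_gaussian) \<longlonglongrightarrow> (\<integral>x. \<phi>' x e \<partial>std_gaussian)"
  proof (rule integral_dominated_convergence[where w="\<lambda>_. K * norm e"])
    show "AE x in std_gaussian. norm ((\<phi> (x + t n *\<^sub>R e) - \<phi> x) / t n) \<le> K * norm e" for n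
    proof (rule AE_I2)
      fix x
      have "norm (\<phi> (x + t n *\<^sub>R e) - \<phi> x) \<le> K * norm (x + t n *\<^sub>R e - x)"
        using der bound' K by (intro differentiable_bound[of UNIV]) (auto intro!: onorm_bound)
      then show "norm ((\<phi> (x + t n *\<^sub>R e) - \<phi> x) / t n) \<le> K * norm e"
        using t[of n] by (simp add: field_simps)
    qed
  qed (auto intro!: lim1)
  moreover have "(\<integral>x. (\<phi> (x + t n *\<^sub>R e) - \<phi> x) / t n \<partial>std_gaussian) = (\<integral>x. \<phi> x * r n x \<partial>std_gaussian)" for n
  proof -
    have eq: "\<phi> x * exp (x \<bullet> (t n *\<^sub>R e) - (norm (t n *\<^sub>R e))\<^sup>2 / 2) = t n * (\<phi> x * r n x) + \<phi> x" for x
      using t[of n] by (simp add: r_def power_mult_distrib field_simps)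
    have "(\<integral>x. \<phi> (x + t n *\<^sub>R e) \<partial>std_gaussian) = (\<integral>x. t n * (\<phi> x * r n x) + \<phi> x \<partial>std_gaussian)"
      by (subst integral_std_gaussian_translate) (simp_all only: eq, measurable)
    also have "\<dots> = t n * (\<integral>x. \<phi> x * r n x \<partial>std_gaussian) + (\<integral>x. \<phi> x \<partial>std_gaussian)"
      using dc3 i\<phi>[of 0] by (subst Bochner_Integration.integral_add) auto
    finally show ?thesis using i\<phi>[of "t n *\<^sub>R e"] i\<phi>[of 0] t[of n] by simp
  qed
  ultimately have "(\<lambda>n. \<integral>x. \<phi> x * r n x \<partial>std_gaussian) \<longlonglongrightarrow> (\<integral>x. \<phi>' x e \<partial>std_gaussian)" by simp
  from LIMSEQ_unique[OF dc2 this]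
  show "(\<integral>x. \<phi> x * (x \<bullet> e) \<partial>std_gaussian) = (\<integral>x. \<phi>' x e \<partial>std_gaussian)" .
qed

text \<open>The substitution is carried out for absolutely integrable functions with values in
  \<open>real^1\<close> with respect to \<open>lebesgue\<close>. Borel measurability of the
  Jacobian, a polynomial in limits of difference quotients, brings the result back to
  \<open>lborel\<close>.\<close>

lemma change_of_variables_lborel:
  fixes \<Phi> :: "real^'m::{finite,wellorder} \<Rightarrow> real^'m::_"
  assumes der: "\<And>v. (\<Phi> has_derivative D v) (at v)" and bij: "bij \<Phi>"
    and f: "integrable lborel f"
  shows "integrable lborel (\<lambda>v. \<bar>det (matrix (D v))\<bar> * f (\<Phi> v))"
    "(\<integral>v. \<bar>det (matrix (D v))\<bar> * f (\<Phi> v) \<partial>lborel) = (\<integral>v. f v \<partial>lborel)"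
proof -
  have [measurable]: "f \<in> borel_measurable borel" using f by auto
  have "continuous_on UNIV \<Phi>"
    using der by (meson has_derivative_continuous continuous_at_imp_continuous_on)
  then have [measurable]: "\<Phi> \<in> borel_measurable borel" by (rule borel_measurable_continuous_onI)
  have Dm: "(\<lambda>v. D v e $ i) \<in> borel_measurable borel" for e i
  proof -
    have "((\<lambda>v. \<Phi> v $ i) has_derivative (\<lambda>e. D v e $ i)) (at v)" for v
      using bounded_linear.has_derivative[OF bounded_linear_vec_nth der] .
    from has_derivative_difference_quotient[OF this]
    show ?thesis by (rule borel_measurable_LIMSEQ_metric[rotated]) (unfold cart_eq_inner_axis, measurable)
  qed
  have [measurable]: "(\<lambda>v. det (matrix (D v))) \<in> borel_measurable borel"
    unfolding det_def matrix_def
    by (intro borel_measurable_sum borel_measurable_times borel_measurable_const borel_measurable_prod) (simp add: Dm)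
  let ?g = "\<lambda>v. \<bar>det (matrix (D v))\<bar> * f (\<Phi> v)"
  have fl: "integrable lebesgue f" "integral\<^sup>L lebesgue f = integral\<^sup>L lborel f"
    using f by (auto simp: integrable_completion integral_completion)
  then have fa: "f absolutely_integrable_on UNIV" by (simp add: set_integrable_def)
  have fi: "integral UNIV f = integral\<^sup>L lborel f"
    using set_lebesgue_integral_eq_integral(2)[OF fa] fl by (simp add: set_lebesgue_integral_def)
  have Fa: "(\<lambda>v. vec (f v) :: real^1) absolutely_integrable_on UNIV"
    using fa by (simp add: absolutely_integrable_on_1_iff)
  have "(\<lambda>v. \<bar>det (matrix (D v))\<bar> *\<^sub>R (vec (f (\<Phi> v)) :: real^1)) absolutely_integrable_on UNIV \<and>
     integral UNIV (\<lambda>v. \<bar>det (matrix (D v))\<bar> *\<^sub>R (vec (f (\<Phi> v)) :: real^1)) = integral UNIV (\<lambda>v. vec (f v) :: real^1)"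
    using Fa der bij
    by (subst has_absolute_integral_change_of_variables[of UNIV \<Phi> D "\<lambda>v. vec (f v) :: real^1"])
       (auto simp: bij_is_surj bij_is_inj)
  then have "?g absolutely_integrable_on UNIV" "integral UNIV ?g = integral UNIV f"
    by (auto simp: absolutely_integrable_on_1_iff integral_on_1_eq)
  then have "integrable lebesgue ?g" "integral\<^sup>L lebesgue ?g = integral\<^sup>L lborel f"
    using set_lebesgue_integral_eq_integral(2)[of UNIV ?g] fi by (auto simp: set_integrable_def set_lebesgue_integral_def)
  then show "integrable lborel ?g" "(\<integral>v. ?g v \<partial>lborel) = (\<integral>v. f v \<partial>lborel)"
    by (auto simp: integrable_completion integral_completion)
qed

section \<open>Determinant bounds from Gaussian integrals\<close>

lemma Basis_vec_eq: "(Basis :: (real^'m) set) = range (\<lambda>i. axis i 1)"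
  by (auto simp: Basis_vec_def)

lemma inj_axis: "inj (\<lambda>i. axis i (1::real) :: real^'m)"
  by (auto simp: inj_on_def axis_eq_axis)

lemma sum_Basis_vec: "(\<Sum>b\<in>(Basis :: (real^'m) set). f b) = (\<Sum>i\<in>UNIV. f (axis i 1))"
  unfolding Basis_vec_eq by (subst sum.reindex[OF inj_axis]) simp

lemma prod_Basis_vec: "(\<Prod>b\<in>(Basis :: (real^'m) set). f b) = (\<Prod>i\<in>UNIV. f (axis i 1))"
  unfolding Basis_vec_eq by (subst prod.reindex[OF inj_axis]) simp

text \<open>Jensen's inequality for the Gaussian integral whose value is \<open>1 / \<bar>det M\<bar>\<close>.\<close>

lemma abs_det_le_exp_frobenius:
  fixes l :: "real^'m::{finite,wellorder} \<Rightarrow> real^'m::_"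
  assumes l: "linear l" and bij: "bij l"
  shows "\<bar>det (matrix l)\<bar> \<le> exp (((\<Sum>i\<in>UNIV. (norm (l (axis i 1)))\<^sup>2) - real CARD('m)) / 2)"
proof -
  let ?G = "std_gaussian :: ((real, 'm) vec) measure"
  define F where "F = (\<Sum>i\<in>UNIV. (norm (l (axis i 1)))\<^sup>2)"
  define s where "s = (real CARD('m) - F) / 2"
  define q where "q = (\<lambda>x. ((norm x)\<^sup>2 - (norm (l x))\<^sup>2) / 2)"
  have bl: "bounded_linear l" using l by (simp add: linear_conv_bounded_linear)
  then have [measurable]: "l \<in> borel_measurable borel" by (intro borel_measurable_continuous_onI linear_continuous_on)
  have [measurable]: "q \<in> borel_measurable borel" unfolding q_def by measurable
  have der: "(l has_derivative l) (at v)" for v using bl by (rule bounded_linear_imp_has_derivative)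
  have gd: "integrable lborel (gauss_density :: (real, 'm) vec \<Rightarrow> real)" "integral\<^sup>L lborel (gauss_density :: (real, 'm) vec \<Rightarrow> real) = 1"
    using integrable_std_gaussian_iff[of "\<lambda>_ :: (real, 'm) vec. 1"] integral_std_gaussian[of "\<lambda>_ :: (real, 'm) vec. 1"]
    by (auto simp: std_gaussian.prob_space[simplified])
  note cov = change_of_variables_lborel[OF der bij gd(1)]
  have eq: "\<bar>det (matrix l)\<bar> * gauss_density (l v) = gauss_density v * (\<bar>det (matrix l)\<bar> * exp (q v))" for v
  proof -
    have "gauss_density (l v) = gauss_density v * exp (q v)"
      unfolding gauss_density_eq q_def mult.assoc exp_add[symmetric] by (simp add: field_simps)
    then show ?thesis by simp
  qed
  have m: "(\<lambda>v. \<bar>det (matrix l)\<bar> * exp (q v)) \<in> borel_measurable borel" by measurable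
  have i1: "integrable ?G (\<lambda>v. \<bar>det (matrix l)\<bar> * exp (q v))"
    and e1: "(\<integral>v. \<bar>det (matrix l)\<bar> * exp (q v) \<partial>?G) = 1"
    using cov unfolding eq gd(2) integrable_std_gaussian_iff[OF m] integral_std_gaussian[OF m] by blast+
  \<comment> \<open>Row by row, |l x|^2 is a sum of squares of linear forms, with means at most the
    squared norms of the rows. Their sum is the squared Frobenius norm \<open>F\<close>.\<close>
  have row: "(norm (l x))\<^sup>2 = (\<Sum>i\<in>UNIV. (x \<bullet> row i (matrix l))\<^sup>2)" for x
  proof -
    have "(norm (l x))\<^sup>2 = (\<Sum>i\<in>UNIV. (l x $ i)\<^sup>2)"
      unfolding norm_power2_eq_sum sum_Basis_vec by (simp add: cart_eq_inner_axis)
    moreover have "l x $ i = x \<bullet> row i (matrix l)" for i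
    proof -
      have "l x = matrix l *v x" using fun_cong[OF matrix_vector_mul(2)[OF l], of x] by simp
      then show ?thesis by (simp add: matrix_vector_mult_def row_def inner_vec_def mult.commute)
    qed
    ultimately show ?thesis by simp
  qed
  have rows: "(\<Sum>i\<in>UNIV. (norm (row i (matrix l)))\<^sup>2) = F"
  proof -
    have "(\<Sum>i\<in>UNIV. (norm (row i (matrix l)))\<^sup>2) = (\<Sum>i\<in>UNIV. \<Sum>j\<in>UNIV. (l (axis j 1) $ i)\<^sup>2)"
      unfolding norm_power2_eq_sum sum_Basis_vec by (simp add: cart_eq_inner_axis[symmetric] row_def matrix_def)
    also have "\<dots> = (\<Sum>j\<in>UNIV. \<Sum>i\<in>UNIV. (l (axis j 1) $ i)\<^sup>2)" by (rule sum.swap)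
    also have "\<dots> = F"
      unfolding F_def norm_power2_eq_sum sum_Basis_vec by (simp add: cart_eq_inner_axis[symmetric])
    finally show ?thesis .
  qed
  have iq: "integrable ?G q"
    unfolding q_def row
    using integral_std_gaussian_norm2[where 'a="(real, 'm) vec"] integrable_std_gaussian_inner2[where 'a="(real, 'm) vec"]
    by (auto simp: has_bochner_integral_iff)
  have "(\<integral>x. (norm (l x))\<^sup>2 \<partial>?G) \<le> F"
    unfolding row rows[symmetric]
    by (subst Bochner_Integration.integral_sum)
       (auto intro!: sum_mono integral_std_gaussian_inner2_le integrable_std_gaussian_inner2)
  then have sq: "s \<le> (\<integral>x. q x \<partial>?G)"
    unfolding q_def s_def row
    using integral_std_gaussian_norm2[where 'a="(real, 'm) vec"] integrable_std_gaussian_inner2[where 'a="(real, 'm) vec"]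
    by (subst integral_divide_zero, subst Bochner_Integration.integral_diff) (auto simp: has_bochner_integral_iff)
  have "\<bar>det (matrix l)\<bar> * exp s = \<bar>det (matrix l)\<bar> * (exp s * 1)" by simp
  \<comment> \<open>Jensen's inequality in its elementary form: exp is minorized by its tangent at
    s, and s lies below the mean of q.\<close>
  also have "\<dots> \<le> \<bar>det (matrix l)\<bar> * (exp s * (\<integral>x. 1 + (q x - s) \<partial>?G))"
    using sq iq by (intro mult_left_mono) (auto simp: std_gaussian.prob_space[simplified])
  also have "\<dots> = (\<integral>x. \<bar>det (matrix l)\<bar> * (exp s * (1 + (q x - s))) \<partial>?G)" by simp
  also have "\<dots> \<le> (\<integral>x. \<bar>det (matrix l)\<bar> * exp (q x) \<partial>?G)"
  proof (rule integral_mono[OF _ i1])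
    show "integrable ?G (\<lambda>x. \<bar>det (matrix l)\<bar> * (exp s * (1 + (q x - s))))"
      using iq by auto
    fix x
    have "exp s * (1 + (q x - s)) \<le> exp s * exp (q x - s)"
      by (intro mult_left_mono exp_ge_add_one_self) auto
    then show "\<bar>det (matrix l)\<bar> * (exp s * (1 + (q x - s))) \<le> \<bar>det (matrix l)\<bar> * exp (q x)"
      by (intro mult_left_mono) (auto simp: exp_add[symmetric])
  qed
  also have "\<dots> = 1" by (rule e1)
  finally have "\<bar>det (matrix l)\<bar> \<le> 1 / exp s" by (simp add: field_simps)
  also have "\<dots> = exp ((F - real CARD('m)) / 2)" by (simp add: s_def exp_minus[symmetric] inverse_eq_divide[symmetric] diff_divide_distrib)
  finally show ?thesis by (simp add: F_def)
qed

text \<open>An upper bound for the determinant of the inverse \<open>E\<close> is a lower bound for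
  that of \<open>D\<close>. With A = D - id and B = E - id the relation D E = id reads A + B = - A
  B, so the trace of B is exchanged for minus that of A at a cost of at most d a b; the term b^2 / 2
  per coordinate comes from the squared Frobenius norm of B.\<close>

lemma abs_det_near_id_ge:
  fixes D :: "real^'m::{finite,wellorder} \<Rightarrow> real^'m::_"
  assumes D: "linear D" and E: "linear E" and DE: "\<And>e. D (E e) = e"
    and a: "\<And>e. norm (D e - e) \<le> a * norm e" and b: "\<And>e. norm (E e - e) \<le> b * norm e"
    and ab: "0 \<le> a" "0 \<le> b"
  shows "exp ((\<Sum>i\<in>UNIV. D (axis i 1) $ i - 1) - real CARD('m) * (a * b + b\<^sup>2 / 2)) \<le> \<bar>det (matrix D)\<bar>"
proof -
  let ?e = "\<lambda>i. axis i 1 :: (real, 'm) vec"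
  have ED: "E (D e) = e" for e
    using linear_inverse_left[OF D E] DE by (auto simp: fun_eq_iff)
  have bij: "bij E" by (rule bijI') (metis DE, metis ED)
  have "matrix D ** matrix E = matrix (D \<circ> E)" using D E by (simp add: matrix_compose)
  also have "D \<circ> E = id" using DE by auto
  finally have "det (matrix D) * det (matrix E) = 1" by (metis det_I det_mul matrix_id_mat_1)
  then have dd: "\<bar>det (matrix D)\<bar> * \<bar>det (matrix E)\<bar> = 1" by (metis abs_mult abs_one)
  have nE: "(norm (E (?e i)))\<^sup>2 \<le> 1 + 2 * (E (?e i) $ i - 1) + b\<^sup>2" for i
  proof -
    have "(norm (E (?e i)))\<^sup>2 = (norm (?e i + (E (?e i) - ?e i)))\<^sup>2" by simp
    also have "\<dots> = 1 + 2 * (?e i \<bullet> (E (?e i) - ?e i)) + (norm (E (?e i) - ?e i))\<^sup>2"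
      unfolding power2_norm_eq_inner inner_add by (simp add: inner_commute inner_axis_axis)
    also have "?e i \<bullet> (E (?e i) - ?e i) = E (?e i) $ i - 1"
      by (simp add: inner_axis' )
    also have "(norm (E (?e i) - ?e i))\<^sup>2 \<le> b\<^sup>2" using b[of "?e i"] by (intro power_mono) auto
    finally show ?thesis by simp
  qed
  \<comment> \<open>The diagonal entries of A + B = - A B.\<close>
  have tr: "(D (?e i) $ i - 1) + (E (?e i) $ i - 1) \<le> a * b" for i
  proof -
    define B where "B = E (?e i) - ?e i"
    have "?e i = D (?e i + B)" by (simp add: B_def DE)
    then have "D (?e i) + D B = ?e i" by (simp add: linear_add[OF D])
    then have "(D (?e i) - ?e i) + B = - (D B - B)" by (simp add: algebra_simps)
    then have "((D (?e i) - ?e i) + B) $ i = - (D B - B) $ i" by simp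
    then have "(D (?e i) $ i - 1) + (E (?e i) $ i - 1) = - (D B - B) $ i" by (simp add: B_def)
    also have "\<dots> \<le> norm (D B - B)" using component_le_norm_cart[of "D B - B" i] by simp
    also have "\<dots> \<le> a * norm B" by (rule a)
    also have "\<dots> \<le> a * b" using b[of "?e i"] ab by (intro mult_left_mono) (auto simp: B_def)
    finally show ?thesis .
  qed
  have "((\<Sum>i\<in>UNIV. (norm (E (?e i)))\<^sup>2) - real CARD('m)) / 2 \<le>
      ((\<Sum>i\<in>UNIV. 1 + 2 * (E (?e i) $ i - 1) + b\<^sup>2) - real CARD('m)) / 2"
    by (intro divide_right_mono diff_right_mono sum_mono nE) simp
  also have "\<dots> = (\<Sum>i\<in>UNIV. E (?e i) $ i - 1) + real CARD('m) * (b\<^sup>2 / 2)"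
    by (simp add: sum.distrib sum_distrib_left[symmetric] sum_subtractf field_simps)
  also have "(\<Sum>i\<in>UNIV. E (?e i) $ i - 1) \<le> (\<Sum>i\<in>UNIV. a * b - (D (?e i) $ i - 1))"
    using tr by (intro sum_mono) (smt (verit))
  finally have "((\<Sum>i\<in>UNIV. (norm (E (?e i)))\<^sup>2) - real CARD('m)) / 2 \<le>
     - ((\<Sum>i\<in>UNIV. D (?e i) $ i - 1) - real CARD('m) * (a * b + b\<^sup>2 / 2))"
    by (simp add: sum_subtractf algebra_simps)
  then have "\<bar>det (matrix E)\<bar> \<le> exp (- ((\<Sum>i\<in>UNIV. D (?e i) $ i - 1) - real CARD('m) * (a * b + b\<^sup>2 / 2)))"
    using abs_det_le_exp_frobenius[OF E bij] by (meson exp_le_cancel_iff order_trans)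
  then have "\<bar>det (matrix D)\<bar> * \<bar>det (matrix E)\<bar> \<le> \<bar>det (matrix D)\<bar> * exp (- ((\<Sum>i\<in>UNIV. D (?e i) $ i - 1) - real CARD('m) * (a * b + b\<^sup>2 / 2)))"
    by (intro mult_left_mono) auto
  then show ?thesis unfolding dd exp_minus by (simp add: field_simps)
qed


text \<open>Here \<open>r\<close> is the density for which \<Phi> maps r times the Gaussian to the
  Gaussian, so the difference of the two probabilities is the integral of 1 - r over the preimage of
  S. Integration by parts gives the minorant \<open>lr\<close> of log r the mean - \<kappa>^2; hence
  the affinity, the integral of sqrt r, is at least 1 - \<kappa>^2 / 2, and this controls the L^1
  norm of 1 - r.\<close>

lemma std_gaussian_overlap_wellorder:
  fixes \<Phi> :: "real^'m::{finite,wellorder} \<Rightarrow> real^'m::_"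
  assumes der: "\<And>v. (\<Phi> has_derivative D v) (at v)" and bij: "bij \<Phi>"
    and E: "\<And>v. linear (E v)" and DE: "\<And>v e. D v (E v e) = e"
    and c: "\<And>v. norm (\<Phi> v - v) \<le> c"
    and a: "\<And>v e. norm (D v e - e) \<le> a * norm e" and b: "\<And>v e. norm (E v e - e) \<le> b * norm e"
    and ab: "0 \<le> a" "0 \<le> b" and \<kappa>: "0 < \<kappa>" "c\<^sup>2 / 2 + real CARD('m) * (a * b + b\<^sup>2 / 2) \<le> \<kappa>\<^sup>2"
    and S[measurable]: "S \<in> sets borel"
  shows "\<bar>measure std_gaussian (\<Phi> -` S) - measure std_gaussian S\<bar> \<le> \<kappa>"
proof -
  let ?G = "std_gaussian :: ((real, 'm) vec) measure"
  define r where "r = (\<lambda>v. \<bar>det (matrix (D v))\<bar> * exp (((norm v)\<^sup>2 - (norm (\<Phi> v))\<^sup>2) / 2))"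
  have r0: "0 \<le> r v" for v by (simp add: r_def)
  have Dlin: "linear (D v)" for v using der by (rule has_derivative_linear)
  have "continuous_on UNIV \<Phi>"
    using der by (meson has_derivative_continuous continuous_at_imp_continuous_on)
  then have m\<Phi>[measurable]: "\<Phi> \<in> borel_measurable borel" by (rule borel_measurable_continuous_onI)
  have gd: "gauss_density v * r v = \<bar>det (matrix (D v))\<bar> * gauss_density (\<Phi> v)" for v
  proof -
    have "gauss_density (\<Phi> v) = gauss_density v * exp (((norm v)\<^sup>2 - (norm (\<Phi> v))\<^sup>2) / 2)"
      unfolding gauss_density_eq mult.assoc exp_add[symmetric] by (simp add: field_simps)
    then show ?thesis by (simp add: r_def)
  qed
  have int_gd: "integrable lborel (\<lambda>v. gauss_density v * indicator B v)" if [measurable]: "B \<in> sets borel" for B :: "((real, 'm) vec) set"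
    by (subst integrable_std_gaussian_iff[symmetric]) (auto intro!: std_gaussian.integrable_const_bound[of _ 1])
  have [measurable]: "r \<in> borel_measurable borel"
  proof -
    have "(\<lambda>v. \<bar>det (matrix (D v))\<bar> * (gauss_density (\<Phi> v) * indicator UNIV (\<Phi> v))) \<in> borel_measurable lborel"
      using change_of_variables_lborel(1)[OF der bij int_gd[of UNIV]] by (intro borel_measurable_integrable) simp
    then have "(\<lambda>v. (gauss_density v * r v) / gauss_density v) \<in> borel_measurable borel"
      unfolding gd by simp
    then show ?thesis using gauss_density_pos[where 'a="(real, 'm) vec"] by (simp add: less_imp_neq[symmetric])
  qed
  have rS: "integrable ?G (\<lambda>v. r v * indicator B (\<Phi> v))" "(\<integral>v. r v * indicator B (\<Phi> v) \<partial>?G) = measure ?G B"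
    if [measurable]: "B \<in> sets borel" for B
  proof -
    have eq: "\<bar>det (matrix (D v))\<bar> * (gauss_density (\<Phi> v) * indicator B (\<Phi> v)) = gauss_density v * (r v * indicator B (\<Phi> v))" for v
      using gd[of v] by (simp add: mult.assoc[symmetric])
    note cov = change_of_variables_lborel[OF der bij int_gd[OF that], unfolded eq]
    show "integrable ?G (\<lambda>v. r v * indicator B (\<Phi> v))"
      using cov(1) by (subst integrable_std_gaussian_iff) measurable
    have "(\<integral>v. r v * indicator B (\<Phi> v) \<partial>?G) = (\<integral>v. indicator B v \<partial>?G)"
    proof -
      have m1: "(\<lambda>v. r v * indicator B (\<Phi> v)) \<in> borel_measurable borel"
        and m2: "(indicator B :: (real, 'm) vec \<Rightarrow> real) \<in> borel_measurable borel" by measurable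
      show ?thesis using cov(2) unfolding integral_std_gaussian[OF m1] integral_std_gaussian[OF m2] .
    qed
    then show "(\<integral>v. r v * indicator B (\<Phi> v) \<partial>?G) = measure ?G B" by simp
  qed
  have ir: "integrable ?G r" and Er: "(\<integral>v. r v \<partial>?G) = 1"
    using rS[of UNIV] by (simp_all add: std_gaussian.prob_space[simplified])
  have isq: "integrable ?G (\<lambda>v. sqrt (r v))"
  proof (rule Bochner_Integration.integrable_bound[of _ "\<lambda>v. 1 + r v"])
    show "AE v in ?G. norm (sqrt (r v)) \<le> norm (1 + r v)"
    proof (rule AE_I2)
      fix v
      have "sqrt (r v) \<le> 1 + r v" using arith_geo_mean_sqrt[of 1 "r v"] r0[of v] by simp
      then show "norm (sqrt (r v)) \<le> norm (1 + r v)" using r0[of v] by simp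
    qed
  qed (use ir in auto)
  \<comment> \<open>A minorant of log r: the squared displacement and the second-order part of the
    determinant bound are replaced by their common bound \<kappa>^2. The two remaining sums have
    equal means.\<close>
  define lr where "lr = (\<lambda>v. - (\<Sum>i\<in>UNIV. (\<Phi> v - v) $ i * (v \<bullet> axis i 1)) + (\<Sum>i\<in>UNIV. D v (axis i 1) $ i - 1) - \<kappa>\<^sup>2)"
  have ibp: "integrable ?G (\<lambda>v. (\<Phi> v - v) $ i * (v \<bullet> axis i 1))" "integrable ?G (\<lambda>v. D v (axis i 1) $ i - 1)"
    "(\<integral>v. (\<Phi> v - v) $ i * (v \<bullet> axis i 1) \<partial>?G) = (\<integral>v. D v (axis i 1) $ i - 1 \<partial>?G)" for i
  proof -
    have d: "((\<lambda>v. (\<Phi> v - v) $ i) has_derivative (\<lambda>e. (D v e - e) $ i)) (at v)" for v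
      by (rule bounded_linear.has_derivative[OF bounded_linear_vec_nth]) (intro has_derivative_diff der has_derivative_ident)
    have b1: "\<bar>(\<Phi> v - v) $ i\<bar> \<le> c" for v using component_le_norm_cart[of "\<Phi> v - v" i] c[of v] by linarith
    have b2: "\<bar>(D v e - e) $ i\<bar> \<le> a * norm e" for v e using component_le_norm_cart[of "D v e - e" i] a[of v e] by linarith
    from std_gaussian_integration_by_parts[where e="axis i 1", OF d b1 b2]
    show "integrable ?G (\<lambda>v. (\<Phi> v - v) $ i * (v \<bullet> axis i 1))" "integrable ?G (\<lambda>v. D v (axis i 1) $ i - 1)"
      "(\<integral>v. (\<Phi> v - v) $ i * (v \<bullet> axis i 1) \<partial>?G) = (\<integral>v. D v (axis i 1) $ i - 1 \<partial>?G)" by simp_all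
  qed
  have ilr: "integrable ?G lr" unfolding lr_def
    by (intro Bochner_Integration.integrable_diff Bochner_Integration.integrable_add Bochner_Integration.integrable_minus
        Bochner_Integration.integrable_sum ibp) simp
  have Elr: "(\<integral>v. lr v \<partial>?G) = - \<kappa>\<^sup>2"
  proof -
    have "(\<integral>v. lr v \<partial>?G) = - (\<Sum>i\<in>UNIV. (\<integral>v. (\<Phi> v - v) $ i * (v \<bullet> axis i 1) \<partial>?G)) +
       (\<Sum>i\<in>UNIV. (\<integral>v. D v (axis i 1) $ i - 1 \<partial>?G)) - \<kappa>\<^sup>2"
      unfolding lr_def
      apply (subst Bochner_Integration.integral_diff)
        apply (intro Bochner_Integration.integrable_add Bochner_Integration.integrable_minus Bochner_Integration.integrable_sum ibp)
       apply simp
      apply (subst Bochner_Integration.integral_add)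
        apply (intro Bochner_Integration.integrable_minus Bochner_Integration.integrable_sum ibp)
       apply (intro Bochner_Integration.integrable_sum ibp)
      apply (subst Bochner_Integration.integral_minus)
      apply (subst (1 2) Bochner_Integration.integral_sum)
        apply (rule ibp)
       apply (rule ibp)
      apply (simp add: std_gaussian.prob_space[simplified])
      done
    then show ?thesis unfolding ibp(3) by simp
  qed
  \<comment> \<open>From lr <= log r and exp y >= 1 + y at y = lr / 2. Only a lower bound of r
    enters.\<close>
  have slr: "1 + lr v / 2 \<le> sqrt (r v)" for v
  proof -
    let ?tr = "\<Sum>i\<in>UNIV. D v (axis i 1) $ i - 1"
    have in_sum: "(\<Sum>i\<in>UNIV. (\<Phi> v - v) $ i * (v \<bullet> axis i 1)) = (\<Phi> v - v) \<bullet> v"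
      unfolding cart_eq_inner_axis[symmetric] by (simp add: inner_vec_def)
    have nn: "((norm v)\<^sup>2 - (norm (\<Phi> v))\<^sup>2) / 2 = - ((\<Phi> v - v) \<bullet> v) - (norm (\<Phi> v - v))\<^sup>2 / 2"
      unfolding power2_norm_eq_inner by (simp add: inner_diff inner_commute field_simps)
    have cc: "(norm (\<Phi> v - v))\<^sup>2 \<le> c\<^sup>2" using c[of v] by (intro power_mono) auto
    have "exp (lr v) \<le> exp (?tr - real CARD('m) * (a * b + b\<^sup>2 / 2)) * exp (((norm v)\<^sup>2 - (norm (\<Phi> v))\<^sup>2) / 2)"
      unfolding lr_def in_sum nn exp_add[symmetric] using \<kappa>(2) cc by simp
    also have "\<dots> \<le> r v"
      unfolding r_def by (intro mult_right_mono abs_det_near_id_ge[OF Dlin E DE a b ab]) simp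
    finally have "sqrt (exp (lr v)) \<le> sqrt (r v)" by simp
    moreover have "sqrt (exp (lr v)) = exp (lr v / 2)"
      by (rule real_sqrt_unique) (auto simp: power2_eq_square exp_add[symmetric])
    ultimately show ?thesis using exp_ge_add_one_self[of "lr v / 2"] by linarith
  qed
  have "(\<integral>v. 1 + lr v / 2 \<partial>?G) \<le> (\<integral>v. sqrt (r v) \<partial>?G)"
    by (rule integral_mono) (use ilr isq slr in auto)
  then have \<beta>: "1 - \<kappa>\<^sup>2 / 2 \<le> (\<integral>v. sqrt (r v) \<partial>?G)"
    using ilr Elr by (simp add: std_gaussian.prob_space[simplified])
  have \<beta>1: "(\<integral>v. sqrt (r v) \<partial>?G) \<le> 1"
  proof -
    have "sqrt (r v) \<le> (1 + r v) / 2" for v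
      using arith_geo_mean_sqrt[of 1 "r v"] r0[of v] by simp
    then have "(\<integral>v. sqrt (r v) \<partial>?G) \<le> (\<integral>v. (1 + r v) / 2 \<partial>?G)"
      using isq ir by (intro integral_mono) auto
    also have "\<dots> = 1" using ir Er by (simp add: std_gaussian.prob_space[simplified])
    finally show ?thesis .
  qed
  have half: "(\<integral>v. \<bar>1 - r v\<bar> \<partial>?G) \<le> 2 * \<kappa>"
  proof -
    \<comment> \<open>|1 - r| factors into |1 - sqrt r| and 1 + sqrt r. The weight \<kappa> in the
      arithmetic-geometric mean inequality balances the two squares, since the mean of (1 - sqrt
      r)^2 is at most \<kappa>^2 and that of (1 + sqrt r)^2 at most 4.\<close>
    have "\<bar>1 - r v\<bar> \<le> (1 / \<kappa>) * (1 - 2 * sqrt (r v) + r v) + (\<kappa> / 4) * (1 + 2 * sqrt (r v) + r v)" for v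
    proof -
      define s where "s = sqrt (r v)"
      have s: "0 \<le> s" "r v = s\<^sup>2" using r0[of v] by (auto simp: s_def)
      have "0 \<le> (\<bar>1 - s\<bar> / sqrt \<kappa> - sqrt \<kappa> / 2 * (1 + s))\<^sup>2" by simp
      also have "\<dots> = (\<bar>1 - s\<bar> / sqrt \<kappa>)\<^sup>2 + (sqrt \<kappa> / 2 * (1 + s))\<^sup>2 - \<bar>1 - s\<bar> * (1 + s)"
        using \<kappa>(1) by (simp add: power2_diff)
      also have "(\<bar>1 - s\<bar> / sqrt \<kappa>)\<^sup>2 = (1 / \<kappa>) * (1 - 2 * s + s\<^sup>2)"
        using \<kappa>(1) by (simp add: power_divide power2_diff)
      also have "(sqrt \<kappa> / 2 * (1 + s))\<^sup>2 = (\<kappa> / 4) * (1 + 2 * s + s\<^sup>2)"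
        using \<kappa>(1) by (simp add: power_mult_distrib power_divide power2_sum)
      also have "\<bar>1 - s\<bar> * (1 + s) = \<bar>1 - s\<^sup>2\<bar>"
        using s by (simp add: power2_eq_square abs_if algebra_simps) (smt (verit, ccfv_SIG) mult_le_one mult_less_cancel_left2 mult_less_cancel_right2)
      finally show ?thesis using s(1) by (simp add: s(2) s_def[symmetric])
    qed
    then have "(\<integral>v. \<bar>1 - r v\<bar> \<partial>?G) \<le> (\<integral>v. (1 / \<kappa>) * (1 - 2 * sqrt (r v) + r v) + (\<kappa> / 4) * (1 + 2 * sqrt (r v) + r v) \<partial>?G)"
      using isq ir by (intro integral_mono) auto
    also have "\<dots> = (1 / \<kappa>) * (2 - 2 * (\<integral>v. sqrt (r v) \<partial>?G)) + (\<kappa> / 4) * (2 + 2 * (\<integral>v. sqrt (r v) \<partial>?G))"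
      using isq ir Er by (simp add: std_gaussian.prob_space[simplified])
    also have "\<dots> \<le> (1 / \<kappa>) * \<kappa>\<^sup>2 + (\<kappa> / 4) * 4"
      using \<beta> \<beta>1 \<kappa>(1) by (intro add_mono mult_left_mono) auto
    also have "\<dots> = 2 * \<kappa>" using \<kappa>(1) by (simp add: power2_eq_square)
    finally show ?thesis .
  qed
  have [measurable]: "\<Phi> -` S \<in> sets borel" using measurable_sets[OF m\<Phi> S] by simp
  have iS: "integrable ?G (\<lambda>v. indicator (\<Phi> -` S) v :: real)"
    by (rule std_gaussian.integrable_const_bound[of _ 1]) auto
  have p: "measure ?G (\<Phi> -` S) - measure ?G S = (\<integral>v. indicator (\<Phi> -` S) v * (1 - r v) \<partial>?G)"
  proof -
    have "measure ?G (\<Phi> -` S) - measure ?G S = (\<integral>v. indicator (\<Phi> -` S) v \<partial>?G) - (\<integral>v. r v * indicator S (\<Phi> v) \<partial>?G)"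
      by (simp add: rS)
    also have "\<dots> = (\<integral>v. indicator (\<Phi> -` S) v - r v * indicator S (\<Phi> v) \<partial>?G)"
      by (rule Bochner_Integration.integral_diff[OF iS rS(1)[OF S], symmetric])
    also have "\<dots> = (\<integral>v. indicator (\<Phi> -` S) v * (1 - r v) \<partial>?G)"
      by (intro Bochner_Integration.integral_cong) (auto simp: indicator_def)
    finally show ?thesis .
  qed
  \<comment> \<open>As 1 - r has mean 0, the indicator may be shifted to take the values 1/2 and
    -1/2, which halves the bound.\<close>
  have "measure ?G (\<Phi> -` S) - measure ?G S = (\<integral>v. (indicator (\<Phi> -` S) v - 1 / 2) * (1 - r v) \<partial>?G)"
  proof -
    have i1: "integrable ?G (\<lambda>v. indicator (\<Phi> -` S) v * (1 - r v))"
      by (rule Bochner_Integration.integrable_bound[of _ "\<lambda>v. 1 - r v"]) (use ir in \<open>auto simp: indicator_def\<close>)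
    have "(\<integral>v. (indicator (\<Phi> -` S) v - 1 / 2) * (1 - r v) \<partial>?G) = (\<integral>v. indicator (\<Phi> -` S) v * (1 - r v) - (1 - r v) / 2 \<partial>?G)"
      by (simp add: algebra_simps)
    also have "\<dots> = (\<integral>v. indicator (\<Phi> -` S) v * (1 - r v) \<partial>?G) - (\<integral>v. (1 - r v) / 2 \<partial>?G)"
      using i1 ir by (intro Bochner_Integration.integral_diff) auto
    also have "(\<integral>v. (1 - r v) / 2 \<partial>?G) = 0" using ir Er by (simp add: std_gaussian.prob_space[simplified])
    finally show ?thesis using p by simp
  qed
  also have "\<bar>\<dots>\<bar> \<le> (\<integral>v. \<bar>(indicator (\<Phi> -` S) v - 1 / 2) * (1 - r v)\<bar> \<partial>?G)"
    by (rule integral_abs_bound)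
  also have "\<dots> = (\<integral>v. \<bar>1 - r v\<bar> / 2 \<partial>?G)"
    by (intro Bochner_Integration.integral_cong) (auto simp: abs_mult indicator_def)
  also have "\<dots> \<le> \<kappa>" using half by simp
  finally show ?thesis .
qed


section \<open>Transfer to an arbitrary finite index type\<close>

definition to_wo :: "real^'n \<Rightarrow> real^('n wo)" where "to_wo x = (\<chi> i. x $ Rep_wo i)"

definition of_wo :: "real^('n wo) \<Rightarrow> real^'n" where "of_wo y = (\<chi> j. y $ Abs_wo j)"

lemma of_to_wo [simp]: "of_wo (to_wo x) = x" and to_of_wo [simp]: "to_wo (of_wo y) = y"
  by (simp_all add: to_wo_def of_wo_def vec_eq_iff Abs_wo_inverse Rep_wo_inverse)

lemma bij_Rep_wo: "bij (Rep_wo :: 'n wo \<Rightarrow> 'n)"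
  by (rule bijI') (auto simp: Rep_wo_inject, metis Abs_wo_inverse UNIV_I)

lemma sum_wo: "(\<Sum>i\<in>(UNIV :: 'n wo set). f (Rep_wo i)) = (\<Sum>j\<in>(UNIV :: 'n::finite set). f j)"
  using sum.reindex_bij_betw[OF bij_Rep_wo, of f] by simp

lemma prod_wo: "(\<Prod>i\<in>(UNIV :: 'n wo set). f (Rep_wo i)) = (\<Prod>j\<in>(UNIV :: 'n::finite set). f j)"
  using prod.reindex_bij_betw[OF bij_Rep_wo, of f] by simp

lemma card_wo: "CARD('n wo) = CARD('n::finite)"
  using bij_betw_same_card[OF bij_Rep_wo] by simp

lemma linear_to_wo: "linear to_wo" and linear_of_wo: "linear of_wo"
  by (auto simp: to_wo_def of_wo_def vec_eq_iff intro!: linearI)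

lemma norm_to_wo [simp]: "norm (to_wo x) = norm x"
proof -
  have "(norm (to_wo x))\<^sup>2 = (norm x)\<^sup>2"
    unfolding power2_norm_eq_inner inner_vec_def using sum_wo[of "\<lambda>i. x $ i \<bullet> x $ i"] by (simp add: to_wo_def)
  then show ?thesis by (simp add: power2_eq_iff_nonneg)
qed

lemma norm_of_wo [simp]: "norm (of_wo y) = norm y"
  by (metis norm_to_wo to_of_wo)

lemma bounded_linear_to_wo: "bounded_linear to_wo" and bounded_linear_of_wo: "bounded_linear of_wo"
  using linear_to_wo linear_of_wo by (simp_all add: linear_conv_bounded_linear)

lemma measurable_to_wo [measurable]: "to_wo \<in> borel_measurable borel"
  and measurable_of_wo [measurable]: "of_wo \<in> borel_measurable borel"
  by (intro borel_measurable_continuous_onI linear_continuous_on bounded_linear_to_wo bounded_linear_of_wo)+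

text \<open>Relabelling coordinates maps boxes to boxes with the same side lengths, and boxes
  determine Lebesgue measure.\<close>

lemma distr_lborel_to_wo: "distr lborel borel (to_wo :: real^'n \<Rightarrow> real^('n wo)) = lborel"
proof (rule lborel_eqI[symmetric])
  fix l u :: "real^('n wo)"
  assume "\<And>b. b \<in> Basis \<Longrightarrow> l \<bullet> b \<le> u \<bullet> b"
  then have le: "l $ i \<le> u $ i" for i by (simp add: Basis_vec_eq cart_eq_inner_axis)
  have vim: "to_wo -` box l u = box (of_wo l) (of_wo u)"
  proof (rule set_eqI)
    fix x
    have "(\<forall>i. l $ i < x $ Rep_wo i \<and> x $ Rep_wo i < u $ i) \<longleftrightarrow> (\<forall>j. l $ Abs_wo j < x $ j \<and> x $ j < u $ Abs_wo j)"
      by (metis Abs_wo_inverse Rep_wo_inverse UNIV_I)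
    then show "x \<in> to_wo -` box l u \<longleftrightarrow> x \<in> box (of_wo l) (of_wo u)"
      by (simp add: mem_box_cart to_wo_def of_wo_def)
  qed
  have le': "of_wo l \<bullet> b \<le> of_wo u \<bullet> b" if "b \<in> Basis" for b
    using that le by (auto simp: Basis_vec_eq cart_eq_inner_axis[symmetric] of_wo_def)
  have "emeasure (distr lborel borel to_wo) (box l u) = emeasure lborel (box (of_wo l) (of_wo u))"
    by (subst emeasure_distr) (auto simp: vim)
  also have "\<dots> = ennreal (\<Prod>b\<in>Basis. (of_wo u - of_wo l) \<bullet> b)"
    using le' by (rule emeasure_lborel_box)
  also have "(\<Prod>b\<in>Basis. (of_wo u - of_wo l) \<bullet> b) = (\<Prod>j\<in>UNIV. u $ Abs_wo j - l $ Abs_wo j)"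
    unfolding prod_Basis_vec cart_eq_inner_axis[symmetric] by (simp add: of_wo_def)
  also have "\<dots> = (\<Prod>i\<in>UNIV. u $ i - l $ i)"
    using prod_wo[of "\<lambda>j. u $ Abs_wo j - l $ Abs_wo j"] by (simp add: Rep_wo_inverse)
  also have "\<dots> = (\<Prod>b\<in>Basis. (u - l) \<bullet> b)"
    unfolding prod_Basis_vec cart_eq_inner_axis[symmetric] by simp
  finally show "emeasure (distr lborel borel to_wo) (box l u) = ennreal (\<Prod>b\<in>Basis. (u - l) \<bullet> b)" .
qed simp

lemma measure_std_gaussian_to_wo:
  assumes [measurable]: "B \<in> sets borel"
  shows "measure std_gaussian (to_wo -` B) = measure std_gaussian B"
proof -
  have gd: "gauss_density (to_wo x) = gauss_density x" for x :: "real^'n"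
    by (simp add: gauss_density_eq card_wo)
  have [measurable]: "to_wo -` B \<in> sets borel" using measurable_sets[OF measurable_to_wo assms] by simp
  have "emeasure std_gaussian B = (\<integral>\<^sup>+ y. ennreal (gauss_density y) * indicator B y \<partial>distr lborel borel to_wo)"
    unfolding distr_lborel_to_wo std_gaussian_eq by (rule emeasure_density) auto
  also have "\<dots> = (\<integral>\<^sup>+ x. ennreal (gauss_density x) * indicator (to_wo -` B) x \<partial>lborel)"
    by (subst nn_integral_distr) (auto simp: gd indicator_def)
  also have "\<dots> = emeasure std_gaussian (to_wo -` B)"
    unfolding std_gaussian_eq by (rule emeasure_density[symmetric]) auto
  finally show ?thesis by (simp add: measure_def)
qed

lemma std_gaussian_overlap:
  fixes \<Phi> :: "real^'n \<Rightarrow> real^'n"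
  assumes der: "\<And>v. (\<Phi> has_derivative D v) (at v)" and bij: "bij \<Phi>"
    and E: "\<And>v. linear (E v)" and DE: "\<And>v e. D v (E v e) = e"
    and c: "\<And>v. norm (\<Phi> v - v) \<le> c"
    and a: "\<And>v e. norm (D v e - e) \<le> a * norm e" and b: "\<And>v e. norm (E v e - e) \<le> b * norm e"
    and ab: "0 \<le> a" "0 \<le> b" and \<kappa>: "0 < \<kappa>" "c\<^sup>2 / 2 + real CARD('n) * (a * b + b\<^sup>2 / 2) \<le> \<kappa>\<^sup>2"
    and S[measurable]: "S \<in> sets borel"
  shows "\<bar>measure std_gaussian (\<Phi> -` S) - measure std_gaussian S\<bar> \<le> \<kappa>"
proof -
  define \<Psi> where "\<Psi> = (\<lambda>y. to_wo (\<Phi> (of_wo y)))"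
  note sub = linear_diff[OF linear_to_wo]
  have \<Psi>: "\<bar>measure std_gaussian (\<Psi> -` (of_wo -` S)) - measure std_gaussian (of_wo -` S)\<bar> \<le> \<kappa>"
  proof (rule std_gaussian_overlap_wellorder[where D="\<lambda>y e. to_wo (D (of_wo y) (of_wo e))"
        and E="\<lambda>y e. to_wo (E (of_wo y) (of_wo e))" and a=a and b=b and c=c])
    fix y e :: "real^('n wo)"
    show "(\<Psi> has_derivative (\<lambda>e. to_wo (D (of_wo y) (of_wo e)))) (at y)"
      unfolding \<Psi>_def
      by (intro bounded_linear.has_derivative[OF bounded_linear_to_wo] has_derivative_compose[OF _ der]
          bounded_linear_imp_has_derivative bounded_linear_of_wo)
    have "bij (to_wo :: real^'n \<Rightarrow> _)" "bij (of_wo :: _ \<Rightarrow> real^'n)"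
      by (rule bijI'; metis of_to_wo to_of_wo)+
    moreover have "\<Psi> = to_wo \<circ> (\<Phi> \<circ> of_wo)" by (auto simp: \<Psi>_def)
    ultimately show "bij \<Psi>" using bij by (simp add: bij_comp)
    show "linear (\<lambda>e. to_wo (E (of_wo y) (of_wo e)))"
      using linear_compose[OF linear_compose[OF linear_of_wo E] linear_to_wo] by (simp add: o_def)
    show "norm (\<Psi> y - y) \<le> c"
      using c[of "of_wo y"] sub[of "\<Phi> (of_wo y)" "of_wo y"] unfolding \<Psi>_def by (metis norm_to_wo to_of_wo)
    show "norm (to_wo (D (of_wo y) (of_wo e)) - e) \<le> a * norm e"
      using a[of "of_wo y" "of_wo e"] sub[of "D (of_wo y) (of_wo e)" "of_wo e"] by (metis norm_to_wo norm_of_wo to_of_wo)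
    show "norm (to_wo (E (of_wo y) (of_wo e)) - e) \<le> b * norm e"
      using b[of "of_wo y" "of_wo e"] sub[of "E (of_wo y) (of_wo e)" "of_wo e"] by (metis norm_to_wo norm_of_wo to_of_wo)
    show "of_wo -` S \<in> sets borel" using measurable_sets[OF measurable_of_wo S] by simp
  qed (use DE ab \<kappa> card_wo[where 'n='n] in auto)
  have "continuous_on UNIV \<Phi>"
    using der by (meson has_derivative_continuous continuous_at_imp_continuous_on)
  then have m\<Phi>[measurable]: "\<Phi> \<in> borel_measurable borel" by (rule borel_measurable_continuous_onI)
  have wo: "measure std_gaussian (of_wo -` B) = measure std_gaussian B" if "B \<in> sets borel" for B :: "(real^'n) set"
  proof -
    have "of_wo -` B \<in> sets borel" using measurable_sets[OF measurable_of_wo that] by simp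
    moreover have "to_wo -` (of_wo -` B) = B" by auto
    ultimately show ?thesis using measure_std_gaussian_to_wo[of "of_wo -` B"] by simp
  qed
  have "\<Psi> -` (of_wo -` S) = of_wo -` (\<Phi> -` S)" by (auto simp: \<Psi>_def)
  moreover have "\<Phi> -` S \<in> sets borel" using measurable_sets[OF m\<Phi> S] by simp
  ultimately show ?thesis using \<Psi> wo[of S] wo[of "\<Phi> -` S"] by simp
qed

section \<open>The Verlet flow and its derivative\<close>

text \<open>Common form of three sequences: differences of two trajectories, derivatives of a
  trajectory in the initial velocity, and differences of such derivatives. The force sequence
  \<open>a\<close> is left abstract so that one stability estimate serves all of them.\<close>

locale verlet_recurrence =
  fixes h :: real and z u a :: "nat \<Rightarrow> 'v::real_normed_vector"
  assumes h0: "0 < h"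
    and z_Suc: "\<And>k. z (Suc k) = z k + h *\<^sub>R u k - (h\<^sup>2 / 2) *\<^sub>R a k"
    and u_Suc: "\<And>k. u (Suc k) = u k - (h / 2) *\<^sub>R (a k + a (Suc k))"
begin

text \<open>The velocity in the middle of a step changes by exactly one full force h a from step to
  step. Starting half a step in accounts for the summand 1/2.\<close>

lemma half_velocity_bound:
  assumes "\<And>i. i \<le> k \<Longrightarrow> norm (a i) \<le> \<alpha>"
  shows "norm (u k - (h / 2) *\<^sub>R a k - u 0) \<le> (real k + 1/2) * h * \<alpha>"
  using assms
proof (induction k)
  case 0
  then show ?case using h0 by simp
next
  case (Suc k)
  have "u (Suc k) - (h / 2) *\<^sub>R a (Suc k) - u 0 = (u k - (h / 2) *\<^sub>R a k - u 0) - h *\<^sub>R a (Suc k)"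
    by (simp add: u_Suc algebra_simps flip: scaleR_add_left)
  also have "norm \<dots> \<le> norm (u k - (h / 2) *\<^sub>R a k - u 0) + norm (h *\<^sub>R a (Suc k))"
    by (rule norm_triangle_ineq4)
  also have "\<dots> \<le> (real k + 1/2) * h * \<alpha> + h * \<alpha>"
    using Suc h0 by (intro add_mono) auto
  finally show ?case by (simp add: algebra_simps)
qed

text \<open>Summing h^2 (j + 1/2) over j < k gives exactly (k h)^2 / 2, the constant of continuous
  time.\<close>

lemma position_bound:
  assumes "\<And>i. i < k \<Longrightarrow> norm (a i) \<le> \<alpha>"
  shows "norm (z k - z 0 - (real k * h) *\<^sub>R u 0) \<le> (real k * h)\<^sup>2 / 2 * \<alpha>"
  using assms
proof (induction k)
  case (Suc k)
  have "z (Suc k) - z 0 - (real (Suc k) * h) *\<^sub>R u 0 =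
      (z k - z 0 - (real k * h) *\<^sub>R u 0) + h *\<^sub>R (u k - (h / 2) *\<^sub>R a k - u 0)"
    by (simp add: z_Suc algebra_simps power2_eq_square)
  also have "norm \<dots> \<le> norm (z k - z 0 - (real k * h) *\<^sub>R u 0) + norm (h *\<^sub>R (u k - (h / 2) *\<^sub>R a k - u 0))"
    by (rule norm_triangle_ineq)
  also have "\<dots> \<le> (real k * h)\<^sup>2 / 2 * \<alpha> + h * ((real k + 1/2) * h * \<alpha>)"
    using Suc h0 half_velocity_bound[of k \<alpha>] by (intro add_mono) auto
  also have "\<dots> = (real (Suc k) * h)\<^sup>2 / 2 * \<alpha>"
    by (simp add: power2_eq_square field_simps)
  finally show ?case .
qed simp

lemma position_bound_le:
  assumes "\<And>i. i < n \<Longrightarrow> norm (a i) \<le> \<alpha>" "k \<le> n" "0 \<le> \<alpha>"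
  shows "norm (z k - z 0 - (real k * h) *\<^sub>R u 0) \<le> (real n * h)\<^sup>2 / 2 * \<alpha>"
proof -
  have "(real k * h)\<^sup>2 / 2 * \<alpha> \<le> (real n * h)\<^sup>2 / 2 * \<alpha>"
    using assms h0 by (intro mult_right_mono divide_right_mono power_mono) auto
  then show ?thesis using position_bound[of k \<alpha>] assms by (meson le_trans less_le_trans order_trans)
qed

text \<open>M is the largest |z k|. The force feeds M back with factor L T^2 / 2 <= 1/12, where T =
  n h, so absorption replaces an exponential bound. The inequality for M is left unsolved because
  its users combine it with further linear relations.\<close>

lemma gronwall:
  assumes a: "\<And>i. i < n \<Longrightarrow> norm (a i) \<le> L * norm (z i) + \<beta>"
    and L: "0 \<le> L" and \<beta>: "0 \<le> \<beta>" and LT: "L * (real n * h)\<^sup>2 \<le> 1 / 6"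
  shows "\<exists>M. (\<forall>k\<le>n. norm (z k) \<le> M) \<and>
    M \<le> norm (z 0) + real n * h * norm (u 0) + M / 12 + (real n * h)\<^sup>2 / 2 * \<beta> \<and>
    norm (z n - z 0 - (real n * h) *\<^sub>R u 0) \<le> M / 12 + (real n * h)\<^sup>2 / 2 * \<beta>"
proof -
  define M where "M = Max ((\<lambda>k. norm (z k)) ` {..n})"
  have M: "norm (z k) \<le> M" if "k \<le> n" for k
    unfolding M_def using that by (intro Max_ge) auto
  have M0: "0 \<le> M" using M[of 0] norm_ge_zero[of "z 0"] by linarith
  obtain k where k: "k \<le> n" "M = norm (z k)"
  proof -
    have "M \<in> (\<lambda>k. norm (z k)) ` {..n}" unfolding M_def by (rule Max_in) auto
    then show ?thesis using that by auto
  qed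
  have b: "norm (a i) \<le> L * M + \<beta>" if "i < n" for i
    using a[OF that] M[of i] that L by (smt (verit) mult_left_mono less_imp_le)
  have p: "norm (z k - z 0 - (real k * h) *\<^sub>R u 0) \<le> M / 12 + (real n * h)\<^sup>2 / 2 * \<beta>" if "k \<le> n" for k
  proof -
    have "norm (z k - z 0 - (real k * h) *\<^sub>R u 0) \<le> (real n * h)\<^sup>2 / 2 * (L * M + \<beta>)"
      using L M0 \<beta> b that by (intro position_bound_le) auto
    also have "\<dots> = (L * (real n * h)\<^sup>2) * M / 2 + (real n * h)\<^sup>2 / 2 * \<beta>"
      by (simp add: field_simps)
    also have "\<dots> \<le> (1 / 6) * M / 2 + (real n * h)\<^sup>2 / 2 * \<beta>"
      using LT M0 by (intro add_right_mono divide_right_mono mult_right_mono) auto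
    finally show ?thesis by simp
  qed
  have "M \<le> norm (z k - z 0 - (real k * h) *\<^sub>R u 0) + norm (z 0 + (real k * h) *\<^sub>R u 0)"
    using norm_triangle_ineq[of "z k - z 0 - (real k * h) *\<^sub>R u 0" "z 0 + (real k * h) *\<^sub>R u 0"] k by simp
  also have "norm (z 0 + (real k * h) *\<^sub>R u 0) \<le> norm (z 0) + real k * h * norm (u 0)"
    using norm_triangle_ineq[of "z 0" "(real k * h) *\<^sub>R u 0"] h0 by simp
  also have "real k * h * norm (u 0) \<le> real n * h * norm (u 0)"
    using k h0 by (intro mult_right_mono) auto
  finally have "M \<le> norm (z 0) + real n * h * norm (u 0) + M / 12 + (real n * h)\<^sup>2 / 2 * \<beta>"
    using p[OF k(1)] by linarith
  then show ?thesis using M p[of n] by blast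
qed

lemma gronwall_homogeneous:
  assumes "\<And>i. norm (a i) \<le> L * norm (z i)" and "0 \<le> L" and "L * (real n * h)\<^sup>2 \<le> 1 / 6"
  obtains M where "\<And>k. k \<le> n \<Longrightarrow> norm (z k) \<le> M"
    and "M \<le> norm (z 0) + real n * h * norm (u 0) + M / 12"
    and "norm (z n - z 0 - (real n * h) *\<^sub>R u 0) \<le> M / 12"
proof -
  have "\<exists>M. (\<forall>k\<le>n. norm (z k) \<le> M) \<and>
    M \<le> norm (z 0) + real n * h * norm (u 0) + M / 12 + (real n * h)\<^sup>2 / 2 * 0 \<and>
    norm (z n - z 0 - (real n * h) *\<^sub>R u 0) \<le> M / 12 + (real n * h)\<^sup>2 / 2 * 0"
    using assms by (intro gronwall) auto
  then show ?thesis using that by (metis add.right_neutral mult_zero_right)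
qed

end

text \<open>The derivatives are represented by a gradient vector and a Hessian map, so that inner
  products with velocities make sense. The bound on the third derivative appears as a Lipschitz
  constant of the Hessian.\<close>

locale potential =
  fixes U :: "'a::euclidean_space \<Rightarrow> real" and G :: "'a \<Rightarrow> 'a" and Hs :: "'a \<Rightarrow> 'a \<Rightarrow> 'a"
    and L LH :: real
  assumes U_der: "\<And>x. (U has_derivative (\<lambda>e. G x \<bullet> e)) (at x)"
    and G_der: "\<And>x. (G has_derivative Hs x) (at x)"
    and Hs_bound: "\<And>x e. norm (Hs x e) \<le> L * norm e"
    and Hs_lipschitz: "\<And>x y e. norm (Hs x e - Hs y e) \<le> LH * norm (x - y) * norm e"
    and L_nonneg: "0 \<le> L" and LH_nonneg: "0 \<le> LH"
begin

lemma G_lipschitz: "norm (G x - G y) \<le> L * norm (x - y)"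
  using differentiable_bound[of UNIV G Hs L x y]
  by (auto simp: G_der intro!: onorm_bound Hs_bound L_nonneg)

lemma Hs_linear: "linear (Hs x)"
  using G_der has_derivative_linear by blast

lemma grad_eq: "grad U x = G x"
proof -
  have "GDERIV U x :> G x" using U_der by (simp add: gderiv_def inner_commute)
  moreover have "g = G x" if "GDERIV U x :> g" for g
  proof -
    have "(\<lambda>e. e \<bullet> g) = (\<lambda>e. G x \<bullet> e)"
      using that U_der unfolding gderiv_def by (rule has_derivative_unique)
    then have "(g - G x) \<bullet> g = G x \<bullet> (g - G x)" by meson
    then have "(g - G x) \<bullet> (g - G x) = 0" by (simp add: inner_diff inner_commute)
    then show ?thesis by simp
  qed
  ultimately show ?thesis unfolding grad_def by (rule the_equality)
qed

lemma continuous_G: "continuous_on S G"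
  using G_der has_derivative_continuous continuous_at_imp_continuous_on by blast

lemma measurable_G [measurable]: "G \<in> borel_measurable borel"
  by (rule borel_measurable_continuous_onI) (rule continuous_G)

lemma continuous_U: "continuous_on S U"
  using U_der has_derivative_continuous continuous_at_imp_continuous_on by blast

lemma measurable_U [measurable]: "U \<in> borel_measurable borel"
  by (rule borel_measurable_continuous_onI) (rule continuous_U)

abbreviation flow :: "real \<Rightarrow> nat \<Rightarrow> 'a \<times> 'a \<Rightarrow> 'a \<times> 'a" where
  "flow h k s \<equiv> (verlet_step U h ^^ k) s"

lemma fst_verlet_step: "fst (verlet_step U h s) = fst s + h *\<^sub>R snd s - (h\<^sup>2 / 2) *\<^sub>R G (fst s)"
  and snd_verlet_step: "snd (verlet_step U h s) =
    snd s - (h / 2) *\<^sub>R (G (fst s) + G (fst (verlet_step U h s)))"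
  by (simp_all add: verlet_step_def Let_def grad_eq case_prod_beta)

text \<open>The variational equation: the derivative of the flow in the initial velocity in
  direction e. The initial position is held fixed, hence the starting value (0, e).\<close>

primrec tangent :: "real \<Rightarrow> 'a \<times> 'a \<Rightarrow> nat \<Rightarrow> 'a \<Rightarrow> 'a \<times> 'a" where
  "tangent h s 0 e = (0, e)"
| "tangent h s (Suc k) e =
    (let q = fst (flow h k s); q' = fst (flow h (Suc k) s);
         z = fst (tangent h s k e); u = snd (tangent h s k e);
         z' = z + h *\<^sub>R u - (h\<^sup>2 / 2) *\<^sub>R Hs q z
     in (z', u - (h / 2) *\<^sub>R (Hs q z + Hs q' z')))"

lemma tangent_derivative:
  "((\<lambda>v. fst (flow h k (x, v))) has_derivative (\<lambda>e. fst (tangent h (x, v) k e))) (at v) \<and>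
   ((\<lambda>v. snd (flow h k (x, v))) has_derivative (\<lambda>e. snd (tangent h (x, v) k e))) (at v)"
proof (induction k)
  case 0
  show ?case by (auto intro!: derivative_eq_intros)
next
  case (Suc k)
  note q = Suc[THEN conjunct1] and p = Suc[THEN conjunct2]
  have Gq: "((\<lambda>v. G (fst (flow h k (x, v)))) has_derivative (\<lambda>e. Hs (fst (flow h k (x, v))) (fst (tangent h (x, v) k e)))) (at v)"
    by (rule has_derivative_compose[OF q G_der])
  have q': "((\<lambda>v. fst (flow h (Suc k) (x, v))) has_derivative (\<lambda>e. fst (tangent h (x, v) (Suc k) e))) (at v)"
    unfolding funpow.simps o_def fst_verlet_step tangent.simps Let_def fst_conv
    by (intro has_derivative_diff has_derivative_add has_derivative_scaleR_right q p Gq)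
  have Gq': "((\<lambda>v. G (fst (flow h (Suc k) (x, v)))) has_derivative
      (\<lambda>e. Hs (fst (flow h (Suc k) (x, v))) (fst (tangent h (x, v) (Suc k) e)))) (at v)"
    by (rule has_derivative_compose[OF q' G_der])
  have "((\<lambda>v. snd (flow h (Suc k) (x, v))) has_derivative (\<lambda>e. snd (tangent h (x, v) k e) -
     (h / 2) *\<^sub>R (Hs (fst (flow h k (x, v))) (fst (tangent h (x, v) k e)) +
       Hs (fst (flow h (Suc k) (x, v))) (fst (tangent h (x, v) (Suc k) e))))) (at v)"
  proof -
    have eq: "snd (flow h (Suc k) (x, v)) = snd (flow h k (x, v)) -
       (h / 2) *\<^sub>R (G (fst (flow h k (x, v))) + G (fst (flow h (Suc k) (x, v))))" for v
      using snd_verlet_step[of h "flow h k (x, v)"] by simp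
    show ?thesis unfolding eq
      by (intro has_derivative_diff has_derivative_add has_derivative_scaleR_right p Gq Gq')
  qed
  then show ?case using q' by (simp add: Let_def)
qed

section \<open>Stability of trajectories and of their derivatives\<close>

lemma flow_difference_recurrence:
  assumes "0 < h"
  shows "verlet_recurrence h (\<lambda>k. fst (flow h k s) - fst (flow h k s'))
    (\<lambda>k. snd (flow h k s) - snd (flow h k s')) (\<lambda>k. G (fst (flow h k s)) - G (fst (flow h k s')))"
proof
  fix k
  show "fst (flow h (Suc k) s) - fst (flow h (Suc k) s') = fst (flow h k s) - fst (flow h k s') +
      h *\<^sub>R (snd (flow h k s) - snd (flow h k s')) - (h\<^sup>2 / 2) *\<^sub>R (G (fst (flow h k s)) - G (fst (flow h k s')))"
    by (simp add: fst_verlet_step algebra_simps)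
  have eq: "snd (flow h (Suc k) s) = snd (flow h k s) -
       (h / 2) *\<^sub>R (G (fst (flow h k s)) + G (fst (flow h (Suc k) s)))" for s
    using snd_verlet_step[of h "flow h k s"] by simp
  show "snd (flow h (Suc k) s) - snd (flow h (Suc k) s') = snd (flow h k s) - snd (flow h k s') -
      (h / 2) *\<^sub>R (G (fst (flow h k s)) - G (fst (flow h k s')) + (G (fst (flow h (Suc k) s)) - G (fst (flow h (Suc k) s'))))"
    unfolding eq by (simp add: algebra_simps)
qed (rule assms)

lemma tangent_recurrence:
  assumes "0 < h"
  shows "verlet_recurrence h (\<lambda>k. fst (tangent h s k e)) (\<lambda>k. snd (tangent h s k e))
     (\<lambda>k. Hs (fst (flow h k s)) (fst (tangent h s k e)))"
  using assms by unfold_locales (simp_all add: Let_def)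

lemma tangent_difference_recurrence:
  assumes "0 < h"
  shows "verlet_recurrence h (\<lambda>k. fst (tangent h s k e) - fst (tangent h s' k e))
     (\<lambda>k. snd (tangent h s k e) - snd (tangent h s' k e))
     (\<lambda>k. Hs (fst (flow h k s)) (fst (tangent h s k e)) - Hs (fst (flow h k s')) (fst (tangent h s' k e)))"
  using assms by unfold_locales (simp_all add: Let_def algebra_simps)

text \<open>For equal initial positions M <= (12/11) T |v - v'|, and one twelfth of it remains. Thus
  the endpoint divided by T is, as a function of the velocity, the identity plus a map with
  Lipschitz constant 1/11.\<close>

lemma flow_velocity_lipschitz:
  assumes h: "0 < h" and LT: "L * (real n * h)\<^sup>2 \<le> 1 / 6"
  shows "norm (fst (flow h n (x, v)) - fst (flow h n (x, v')) - (real n * h) *\<^sub>R (v - v')) \<le>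
    real n * h * norm (v - v') / 11"
proof -
  interpret verlet_recurrence h "\<lambda>k. fst (flow h k (x, v)) - fst (flow h k (x, v'))"
    "\<lambda>k. snd (flow h k (x, v)) - snd (flow h k (x, v'))" "\<lambda>k. G (fst (flow h k (x, v))) - G (fst (flow h k (x, v')))"
    by (rule flow_difference_recurrence[OF h])
  obtain M where "M \<le> real n * h * norm (v - v') + M / 12"
    "norm (fst (flow h n (x, v)) - fst (flow h n (x, v')) - (real n * h) *\<^sub>R (v - v')) \<le> M / 12"
    by (rule gronwall_homogeneous[OF G_lipschitz L_nonneg LT]) simp
  then show ?thesis by linarith
qed

lemma tangent_bounds:
  assumes h: "0 < h" and LT: "L * (real n * h)\<^sup>2 \<le> 1 / 6"
  shows "norm (fst (tangent h s n e) - (real n * h) *\<^sub>R e) \<le> real n * h * norm e / 11"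
    and "k \<le> n \<Longrightarrow> norm (fst (tangent h s k e)) \<le> 12 / 11 * (real n * h * norm e)"
proof -
  interpret verlet_recurrence h "\<lambda>k. fst (tangent h s k e)" "\<lambda>k. snd (tangent h s k e)"
     "\<lambda>k. Hs (fst (flow h k s)) (fst (tangent h s k e))"
    by (rule tangent_recurrence[OF h])
  obtain M where "M \<le> real n * h * norm e + M / 12" "\<And>k. k \<le> n \<Longrightarrow> norm (fst (tangent h s k e)) \<le> M"
    "norm (fst (tangent h s n e) - (real n * h) *\<^sub>R e) \<le> M / 12"
    by (rule gronwall_homogeneous[OF Hs_bound L_nonneg LT]) simp
  note M = this
  show "norm (fst (tangent h s n e) - (real n * h) *\<^sub>R e) \<le> real n * h * norm e / 11"
    using M by linarith
  show "norm (fst (tangent h s k e)) \<le> 12 / 11 * (real n * h * norm e)" if "k \<le> n"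
    using M(1) M(2)[OF that] by linarith
qed

text \<open>The common endpoint supplies a second inequality, T |v - w| <= M / 12 + |x - y|.
  Together with M <= |x - y| + T |v - w| + M / 12 it yields M <= 2.4 |x - y| and the factor
  1.2.\<close>

lemma flow_shooting:
  assumes h: "0 < h" and LT: "L * (real n * h)\<^sup>2 \<le> 1 / 6"
    and hit: "fst (flow h n (x, v)) = fst (flow h n (y, w))"
  shows "real n * h * norm (v - w) \<le> 12 / 10 * norm (x - y)"
    and "k \<le> n \<Longrightarrow> norm (fst (flow h k (x, v)) - fst (flow h k (y, w))) \<le> 24 / 10 * norm (x - y)"
proof -
  interpret verlet_recurrence h "\<lambda>k. fst (flow h k (x, v)) - fst (flow h k (y, w))"
    "\<lambda>k. snd (flow h k (x, v)) - snd (flow h k (y, w))" "\<lambda>k. G (fst (flow h k (x, v))) - G (fst (flow h k (y, w)))"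
    by (rule flow_difference_recurrence[OF h])
  obtain M where M: "M \<le> norm (x - y) + real n * h * norm (v - w) + M / 12"
    "\<And>k. k \<le> n \<Longrightarrow> norm (fst (flow h k (x, v)) - fst (flow h k (y, w))) \<le> M"
    "norm (- (x - y) - (real n * h) *\<^sub>R (v - w)) \<le> M / 12"
    by (rule gronwall_homogeneous[OF G_lipschitz L_nonneg LT]) (simp add: hit)
  have "real n * h * norm (v - w) = norm ((real n * h) *\<^sub>R (v - w))" using h by simp
  also have "\<dots> \<le> norm (- (x - y) - (real n * h) *\<^sub>R (v - w)) + norm (x - y)"
    using norm_triangle_ineq4[of "- (x - y)" "- (x - y) - (real n * h) *\<^sub>R (v - w)"]
    by (simp add: norm_minus_commute)
  finally have 1: "real n * h * norm (v - w) \<le> M / 12 + norm (x - y)" using M(3) by linarith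
  show "real n * h * norm (v - w) \<le> 12 / 10 * norm (x - y)" using 1 M(1) by linarith
  show "norm (fst (flow h k (x, v)) - fst (flow h k (y, w))) \<le> 24 / 10 * norm (x - y)" if "k \<le> n"
    using 1 M(1) M(2)[OF that] by linarith
qed

text \<open>The two derivatives solve variational equations along different trajectories. The
  mismatch of the Hessians is an inhomogeneity \<open>\<beta>\<close>, the product of the distance
  of the trajectories and the size of the derivative.\<close>

lemma tangent_shooting:
  assumes h: "0 < h" and LT: "L * (real n * h)\<^sup>2 \<le> 1 / 6"
    and hit: "fst (flow h n (x, v)) = fst (flow h n (y, w))"
  shows "norm (fst (tangent h (x, v) n e) - fst (tangent h (y, w) n e)) \<le>
    3 / 2 * LH * (real n * h) ^ 3 * norm (x - y) * norm e"
proof -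
  interpret verlet_recurrence h "\<lambda>k. fst (tangent h (x, v) k e) - fst (tangent h (y, w) k e)"
     "\<lambda>k. snd (tangent h (x, v) k e) - snd (tangent h (y, w) k e)"
     "\<lambda>k. Hs (fst (flow h k (x, v))) (fst (tangent h (x, v) k e)) - Hs (fst (flow h k (y, w))) (fst (tangent h (y, w) k e))"
    by (rule tangent_difference_recurrence[OF h])
  define \<beta> where "\<beta> = LH * (24 / 10 * norm (x - y)) * (12 / 11 * (real n * h * norm e))"
  have \<beta>: "0 \<le> \<beta>" using h LH_nonneg by (simp add: \<beta>_def)
  have a: "norm (Hs (fst (flow h k (x, v))) (fst (tangent h (x, v) k e)) - Hs (fst (flow h k (y, w))) (fst (tangent h (y, w) k e)))
    \<le> L * norm (fst (tangent h (x, v) k e) - fst (tangent h (y, w) k e)) + \<beta>" if k: "k < n" for k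
  proof -
    let ?q = "fst (flow h k (x, v))" and ?q' = "fst (flow h k (y, w))"
    let ?z = "fst (tangent h (x, v) k e)" and ?z' = "fst (tangent h (y, w) k e)"
    have eq: "Hs ?q ?z - Hs ?q' ?z' = Hs ?q (?z - ?z') + (Hs ?q ?z' - Hs ?q' ?z')"
      by (simp add: linear_diff[OF Hs_linear])
    have 1: "norm (Hs ?q (?z - ?z')) \<le> L * norm (?z - ?z')" by (rule Hs_bound)
    have 2: "norm (Hs ?q ?z' - Hs ?q' ?z') \<le> LH * norm (?q - ?q') * norm ?z'" by (rule Hs_lipschitz)
    have 3: "norm (?q - ?q') \<le> 24 / 10 * norm (x - y)"
      by (rule flow_shooting(2)[OF h LT hit less_imp_le[OF k]])
    have 4: "norm ?z' \<le> 12 / 11 * (real n * h * norm e)"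
      by (rule tangent_bounds(2)[OF h LT less_imp_le[OF k]])
    have "LH * norm (?q - ?q') * norm ?z' \<le> \<beta>"
      unfolding \<beta>_def by (rule mult_mono[OF mult_left_mono[OF 3 LH_nonneg] 4]) (use LH_nonneg in auto)
    then show ?thesis
      unfolding eq using norm_triangle_ineq[of "Hs ?q (?z - ?z')" "Hs ?q ?z' - Hs ?q' ?z'"] 1 2 by linarith
  qed
  obtain M where M: "M \<le> M / 12 + (real n * h)\<^sup>2 / 2 * \<beta>"
    "\<And>k. k \<le> n \<Longrightarrow> norm (fst (tangent h (x, v) k e) - fst (tangent h (y, w) k e)) \<le> M"
    using gronwall[OF a L_nonneg \<beta> LT] by auto
  have "norm (fst (tangent h (x, v) n e) - fst (tangent h (y, w) n e)) \<le> 12 / 11 * ((real n * h)\<^sup>2 / 2 * \<beta>)"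
    using M(1) M(2)[of n] by linarith
  \<comment> \<open>The factor is 12/11 from absorption, 1/2 from the position bound, 24/10 and
    12/11 from \<open>\<beta>\<close>; it is about 1.43.\<close>
  also have "\<dots> = 1728 / 1210 * (LH * (real n * h) ^ 3 * norm (x - y) * norm e)"
    by (simp add: \<beta>_def power2_eq_square power3_eq_cube)
  also have "\<dots> \<le> 3 / 2 * (LH * (real n * h) ^ 3 * norm (x - y) * norm e)"
    using h LH_nonneg by (intro mult_right_mono) auto
  finally show ?thesis by (simp add: mult.assoc)
qed

lemma flow_continuous:
  "continuous_on UNIV (\<lambda>s. fst (flow h k s)) \<and> continuous_on UNIV (\<lambda>s. snd (flow h k s))"
proof (induction k)
  case (Suc k)
  have G: "continuous_on UNIV (\<lambda>s. G (f s))" if "continuous_on UNIV f" for f :: "'a \<times> 'a \<Rightarrow> 'a"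
    by (rule continuous_on_compose2[OF continuous_G that]) auto
  have q: "continuous_on UNIV (\<lambda>s. fst (flow h (Suc k) s))"
    unfolding funpow.simps o_def fst_verlet_step
    by (intro continuous_on_diff continuous_on_add continuous_on_scaleR continuous_on_const G Suc[THEN conjunct1] Suc[THEN conjunct2])
  have eq: "snd (flow h (Suc k) s) = snd (flow h k s) -
       (h / 2) *\<^sub>R (G (fst (flow h k s)) + G (fst (flow h (Suc k) s)))" for s
    using snd_verlet_step[of h "flow h k s"] by simp
  have "continuous_on UNIV (\<lambda>s. snd (flow h (Suc k) s))"
    unfolding eq
    by (intro continuous_on_diff continuous_on_add continuous_on_scaleR continuous_on_const G q Suc[THEN conjunct1] Suc[THEN conjunct2])
  then show ?case using q by simp
qed (auto intro!: continuous_intros)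

text \<open>The equation F v = p says that v is a fixed point of v - (F v - p) / T, a contraction
  with factor 1/11.\<close>

lemma flow_velocity_bij:
  assumes h: "0 < h" and n: "0 < n" and LT: "L * (real n * h)\<^sup>2 \<le> 1 / 6"
  shows "bij (\<lambda>v. fst (flow h n (x, v)))"
proof -
  let ?F = "\<lambda>v. fst (flow h n (x, v))" and ?T = "real n * h"
  have T: "0 < ?T" using h n by simp
  have "\<exists>!v. v - (1 / ?T) *\<^sub>R (?F v - p) = v" for p
  proof (rule banach_fix_type[of "1 / 11"]; (intro allI)?)
    fix v v' :: 'a
    have "v - (1 / ?T) *\<^sub>R (?F v - p) - (v' - (1 / ?T) *\<^sub>R (?F v' - p)) =
        - (1 / ?T) *\<^sub>R (?F v - ?F v' - ?T *\<^sub>R (v - v'))"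
      using h n by (simp add: algebra_simps)
    then have "dist (v - (1 / ?T) *\<^sub>R (?F v - p)) (v' - (1 / ?T) *\<^sub>R (?F v' - p)) =
        (1 / ?T) * norm (?F v - ?F v' - ?T *\<^sub>R (v - v'))"
      using T by (simp add: dist_norm)
    also have "\<dots> \<le> (1 / ?T) * (?T * norm (v - v') / 11)"
      using flow_velocity_lipschitz[OF h LT] T by (intro mult_left_mono) auto
    also have "\<dots> = dist v v' / 11" using h n by (simp add: dist_norm)
    finally show "dist (v - (1 / ?T) *\<^sub>R (?F v - p)) (v' - (1 / ?T) *\<^sub>R (?F v' - p)) \<le> 1 / 11 * dist v v'"
      by simp
  qed auto
  moreover have "v - (1 / ?T) *\<^sub>R (?F v - p) = v \<longleftrightarrow> ?F v = p" for v p using h n by simp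
  ultimately have "\<exists>!v. ?F v = p" for p by simp
  then show ?thesis by (simp add: bij_iff)
qed

lemma tangent_linear: "linear (\<lambda>e. fst (tangent h (x, v) n e))"
  using tangent_derivative has_derivative_linear by blast

text \<open>The derivative J stays within T / 11 of T times the identity, so |J e| >= (10/11) T |e|.
  In finite dimension J is therefore invertible, with inverse of norm at most 11 / (10 T).\<close>

lemma tangent_inverse:
  assumes h: "0 < h" and n: "0 < n" and LT: "L * (real n * h)\<^sup>2 \<le> 1 / 6"
  obtains J' where "linear J'" "\<And>e. J' (fst (tangent h (x, v) n e)) = e" "\<And>e. fst (tangent h (x, v) n (J' e)) = e"
    "\<And>e. norm (J' e) \<le> 11 / 10 / (real n * h) * norm e"
proof -
  let ?J = "\<lambda>e. fst (tangent h (x, v) n e)" and ?T = "real n * h"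
  have T: "0 < ?T" using h n by simp
  have lower: "10 / 11 * ?T * norm e \<le> norm (?J e)" for e
  proof -
    have "norm (?T *\<^sub>R e) \<le> norm (?J e) + norm (?J e - ?T *\<^sub>R e)"
      by (metis norm_minus_commute norm_triangle_sub)
    then show ?thesis using tangent_bounds(1)[OF h LT, of "(x, v)" e] T by simp
  qed
  have "inj ?J"
  proof (rule linear_injective_0[OF tangent_linear, THEN iffD2], safe)
    fix e assume "?J e = 0"
    then have "10 / 11 * ?T * norm e \<le> 0" using lower[of e] by simp
    then show "e = 0" using T by (simp add: mult_le_0_iff zero_less_mult_iff)
  qed
  then obtain J' where J': "linear J'" "\<And>e. J' (?J e) = e" "\<And>e. ?J (J' e) = e"
    using linear_injective_isomorphism[OF tangent_linear] by blast
  moreover have "norm (J' e) \<le> 11 / 10 / ?T * norm e" for e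
    using lower[of "J' e"] J'(3)[of e] T by (simp add: field_simps)
  ultimately show ?thesis using that by blast
qed

text \<open>\<Phi> is the endpoint map from x followed by the inverse of the endpoint map from y.
  With J_x and J_y the derivatives of these maps, D = J_y^-1 J_x and E = J_x^-1 J_y, so that D - id
  and E - id are inverses applied to J_x - J_y up to sign.\<close>

lemma shooting_map:
  assumes h: "0 < h" and n: "0 < n" and LT: "L * (real n * h)\<^sup>2 \<le> 1 / 6"
  obtains \<Phi> D E where
    "\<And>v. fst (flow h n (y, \<Phi> v)) = fst (flow h n (x, v))" "bij \<Phi>"
    "\<And>v. (\<Phi> has_derivative D v) (at v)"
    "\<And>v. linear (E v)" "\<And>v e. D v (E v e) = e"
    "\<And>v. norm (\<Phi> v - v) \<le> 12 / 10 * norm (x - y) / (real n * h)"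
    "\<And>v e. norm (D v e - e) \<le> 165 / 100 * LH * (real n * h)\<^sup>2 * norm (x - y) * norm e"
    "\<And>v e. norm (E v e - e) \<le> 165 / 100 * LH * (real n * h)\<^sup>2 * norm (x - y) * norm e"
proof -
  let ?F = "\<lambda>x v. fst (flow h n (x, v))" and ?T = "real n * h"
  let ?J = "\<lambda>x v e. fst (tangent h (x, v) n e)"
  have T: "0 < ?T" using h n by simp
  note bijF = flow_velocity_bij[OF h n LT]
  define \<Phi> where "\<Phi> = (\<lambda>v. inv (?F y) (?F x v))"
  have hit: "?F y (\<Phi> v) = ?F x v" for v
    unfolding \<Phi>_def by (rule surj_f_inv_f[OF bij_is_surj[OF bijF]])
  have "\<forall>x v. \<exists>J'. linear J' \<and> (\<forall>e. J' (?J x v e) = e) \<and> (\<forall>e. ?J x v (J' e) = e) \<and>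
      (\<forall>e. norm (J' e) \<le> 11 / 10 / ?T * norm e)"
    using tangent_inverse[OF h n LT] by metis
  then obtain J' where J': "\<And>x v. linear (J' x v)" "\<And>x v e. J' x v (?J x v e) = e"
    "\<And>x v e. ?J x v (J' x v e) = e" "\<And>x v e. norm (J' x v e) \<le> 11 / 10 / ?T * norm e" by metis
  define D where "D = (\<lambda>v e. J' y (\<Phi> v) (?J x v e))"
  define E where "E = (\<lambda>v e. J' x v (?J y (\<Phi> v) e))"
  \<comment> \<open>Continuity of the inverse is a premise of the inverse function rule used
    next.\<close>
  have inv_cont: "continuous_on UNIV (inv (?F y))"
  proof (rule lipschitz_on_continuous_on[of "11 / 10 / ?T"], rule lipschitz_onI)
    fix p p'
    define v where "v = inv (?F y) p"
    define v' where "v' = inv (?F y) p'"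
    have vp: "?F y v = p" "?F y v' = p'" unfolding v_def v'_def by (rule surj_f_inv_f[OF bij_is_surj[OF bijF]])+
    have "norm (?T *\<^sub>R (v - v')) \<le> norm (p - p') + norm (p - p' - ?T *\<^sub>R (v - v'))"
      by (metis norm_minus_commute norm_triangle_sub)
    also have "\<dots> \<le> norm (p - p') + ?T * norm (v - v') / 11"
      using flow_velocity_lipschitz[OF h LT, of y v v'] vp by simp
    finally have "10 / 11 * (?T * norm (v - v')) \<le> norm (p - p')" using T by simp
    then show "dist (inv (?F y) p) (inv (?F y) p') \<le> 11 / 10 / ?T * dist p p'"
      using T unfolding v_def v'_def dist_norm by (simp add: field_simps)
  qed (use T in auto)
  have inv_der: "(inv (?F y) has_derivative J' y (inv (?F y) p)) (at p)" for p
  proof (rule has_derivative_inverse_basic[of "?F y" "?J y (inv (?F y) p)" _ _ _ UNIV])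
    show "(?F y has_derivative ?J y (inv (?F y) p)) (at (inv (?F y) p))"
      using tangent_derivative by blast
    show "bounded_linear (J' y (inv (?F y) p))" using J'(1) by (simp add: linear_conv_bounded_linear)
    show "J' y (inv (?F y) p) \<circ> ?J y (inv (?F y) p) = id" using J'(2) by auto
    show "continuous (at p) (inv (?F y))" using inv_cont by (simp add: continuous_on_eq_continuous_at)
    show "\<And>z. z \<in> UNIV \<Longrightarrow> ?F y (inv (?F y) z) = z" by (rule surj_f_inv_f[OF bij_is_surj[OF bijF]])
  qed auto
  have diff: "norm (?J x v e - ?J y (\<Phi> v) e) \<le> 3 / 2 * LH * ?T ^ 3 * norm (x - y) * norm e" for v e
    using tangent_shooting[OF h LT hit[symmetric]] .
  have J'diff: "norm (J' x' v' (?J x v e - ?J y (\<Phi> v) e)) \<le> 165 / 100 * LH * ?T\<^sup>2 * norm (x - y) * norm e" for x' v' v e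
  proof -
    \<comment> \<open>165/100 is 11/10 from the inverse times 3/2 from the difference of the
      derivatives.\<close>
    have "norm (J' x' v' (?J x v e - ?J y (\<Phi> v) e)) \<le> 11 / 10 / ?T * (3 / 2 * LH * ?T ^ 3 * norm (x - y) * norm e)"
      by (rule order_trans[OF J'(4)], rule mult_left_mono[OF diff]) (use T in simp)
    also have "\<dots> = 165 / 100 * LH * ?T\<^sup>2 * norm (x - y) * norm e"
      using T by (simp add: power2_eq_square power3_eq_cube)
    finally show ?thesis .
  qed
  show ?thesis
  proof (rule that[of \<Phi> D E])
    show "fst (flow h n (y, \<Phi> v)) = fst (flow h n (x, v))" for v by (rule hit)
    have "\<Phi> = inv (?F y) \<circ> ?F x" by (auto simp: \<Phi>_def)
    then show "bij \<Phi>" using bijF by (simp add: bij_comp bij_imp_bij_inv)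
    show "(\<Phi> has_derivative D v) (at v)" for v
      unfolding \<Phi>_def D_def
      by (rule has_derivative_compose[OF tangent_derivative[THEN conjunct1] inv_der])
    show "linear (E v)" for v
      unfolding E_def using linear_compose[OF tangent_linear J'(1)] by (simp add: o_def)
    show "D v (E v e) = e" for v e by (simp add: D_def E_def J')
    show "norm (\<Phi> v - v) \<le> 12 / 10 * norm (x - y) / ?T" for v
      using flow_shooting(1)[OF h LT hit[symmetric], of v] T by (simp add: field_simps norm_minus_commute)
    show "norm (D v e - e) \<le> 165 / 100 * LH * ?T\<^sup>2 * norm (x - y) * norm e" for v e
    proof -
      have "D v e - e = J' y (\<Phi> v) (?J x v e - ?J y (\<Phi> v) e)"
        by (simp add: D_def linear_diff[OF J'(1)] J')
      then show ?thesis using J'diff by simp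
    qed
    show "norm (E v e - e) \<le> 165 / 100 * LH * ?T\<^sup>2 * norm (x - y) * norm e" for v e
    proof -
      have "E v e - e = - J' x v (?J x v e - ?J y (\<Phi> v) e)"
        by (simp add: E_def linear_diff[OF J'(1)] J')
      then show ?thesis using J'diff by simp
    qed
  qed
qed

end

section \<open>One Verlet step started from the Gibbs measure\<close>

context potential
begin

lemma descent: "U (x - c) \<le> U x - c \<bullet> G x + L * (norm c)\<^sup>2 / 2"
proof -
  define \<phi> where "\<phi> = (\<lambda>t. U (x - t *\<^sub>R c) + t * (c \<bullet> G x) - L * (norm c)\<^sup>2 * t\<^sup>2 / 2)"
  have d: "(\<phi> has_real_derivative (- (c \<bullet> G (x - t *\<^sub>R c)) + c \<bullet> G x - L * (norm c)\<^sup>2 * t)) (at t)" for t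
  proof -
    have "((\<lambda>t. x - t *\<^sub>R c) has_derivative (\<lambda>s. - s *\<^sub>R c)) (at t)"
      by (auto intro!: derivative_eq_intros)
    from has_derivative_compose[OF this U_der]
    have "((\<lambda>t. U (x - t *\<^sub>R c)) has_real_derivative - (c \<bullet> G (x - t *\<^sub>R c))) (at t)"
      by (rule has_derivative_imp_has_field_derivative) (simp add: inner_commute)
    then show ?thesis unfolding \<phi>_def by (auto intro!: derivative_eq_intros)
  qed
  have "\<phi> 1 \<le> \<phi> 0"
  proof (rule DERIV_nonpos_imp_nonincreasing[of 0 1 \<phi>])
    fix t :: real assume t: "0 \<le> t" "t \<le> 1"
    have "c \<bullet> G x - c \<bullet> G (x - t *\<^sub>R c) = c \<bullet> (G x - G (x - t *\<^sub>R c))" by (simp add: inner_diff)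
    also have "\<dots> \<le> norm c * norm (G x - G (x - t *\<^sub>R c))" by (rule norm_cauchy_schwarz)
    also have "\<dots> \<le> norm c * (L * norm (x - (x - t *\<^sub>R c)))" by (intro mult_left_mono G_lipschitz) auto
    also have "\<dots> = L * (norm c)\<^sup>2 * t" using t by (simp add: power2_eq_square)
    finally show "\<exists>y. DERIV \<phi> t :> y \<and> y \<le> 0" using d[of t] by (intro exI conjI) auto
  qed simp
  then show ?thesis by (simp add: \<phi>_def)
qed

text \<open>The trapezoidal error along the segment vanishes at t = 0 and its derivative is t / 2
  times a difference of Hessian values at two points of the segment. Two applications of the mean
  value theorem replace the integral remainder.\<close>

lemma trapezoid: "\<bar>U (q + \<delta>) - U q - (1/2) * (\<delta> \<bullet> (G q + G (q + \<delta>)))\<bar> \<le> LH * norm \<delta> ^ 3 / 2"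
proof -
  have line: "((\<lambda>t. q + t *\<^sub>R \<delta>) has_derivative (\<lambda>s. s *\<^sub>R \<delta>)) (at t)" for t
    by (auto intro!: derivative_eq_intros)
  have dU: "((\<lambda>t. U (q + t *\<^sub>R \<delta>)) has_real_derivative (\<delta> \<bullet> G (q + t *\<^sub>R \<delta>))) (at t)" for t
    by (rule has_derivative_imp_has_field_derivative[OF has_derivative_compose[OF line U_der]]) (simp add: inner_commute)
  have dG: "((\<lambda>t. \<delta> \<bullet> G (q + t *\<^sub>R \<delta>)) has_real_derivative (\<delta> \<bullet> Hs (q + t *\<^sub>R \<delta>) \<delta>)) (at t)" for t
    by (rule has_derivative_imp_has_field_derivative[OF has_derivative_inner_right[OF has_derivative_compose[OF line G_der]]])
       (simp add: linear_scale[OF Hs_linear])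
  define r where "r = (\<lambda>t. U (q + t *\<^sub>R \<delta>) - U q - (t / 2) * (\<delta> \<bullet> G q + \<delta> \<bullet> G (q + t *\<^sub>R \<delta>)))"
  define r' where "r' = (\<lambda>t. (1/2) * (\<delta> \<bullet> G (q + t *\<^sub>R \<delta>) - \<delta> \<bullet> G q - t * (\<delta> \<bullet> Hs (q + t *\<^sub>R \<delta>) \<delta>)))"
  have dr: "(r has_real_derivative r' t) (at t)" for t
    unfolding r_def r'_def by (auto intro!: derivative_eq_intros dU dG simp: field_simps)
  have "\<exists>t. 0 < t \<and> t < 1 \<and> r 1 - r 0 = (1 - 0) * r' t"
    by (rule MVT2) (auto intro: dr)
  then obtain t where t: "0 < t" "t < 1" "r 1 = r' t" by (auto simp: r_def)
  have "\<exists>s. 0 < s \<and> s < t \<and> \<delta> \<bullet> G (q + t *\<^sub>R \<delta>) - \<delta> \<bullet> G (q + 0 *\<^sub>R \<delta>) = (t - 0) * (\<delta> \<bullet> Hs (q + s *\<^sub>R \<delta>) \<delta>)"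
    by (rule MVT2) (auto intro: dG t)
  then obtain s where s: "0 < s" "s < t" "\<delta> \<bullet> G (q + t *\<^sub>R \<delta>) - \<delta> \<bullet> G q = t * (\<delta> \<bullet> Hs (q + s *\<^sub>R \<delta>) \<delta>)" by auto
  have "r' t = (t / 2) * (\<delta> \<bullet> (Hs (q + s *\<^sub>R \<delta>) \<delta> - Hs (q + t *\<^sub>R \<delta>) \<delta>))"
    unfolding r'_def s(3) by (simp add: inner_diff algebra_simps)
  then have "\<bar>r' t\<bar> = (t / 2) * \<bar>\<delta> \<bullet> (Hs (q + s *\<^sub>R \<delta>) \<delta> - Hs (q + t *\<^sub>R \<delta>) \<delta>)\<bar>" using t by (simp only: abs_mult)
  also have "\<dots> \<le> (1 / 2) * (norm \<delta> * (LH * norm ((q + s *\<^sub>R \<delta>) - (q + t *\<^sub>R \<delta>)) * norm \<delta>))"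
  proof (rule mult_mono)
    have "\<bar>\<delta> \<bullet> (Hs (q + s *\<^sub>R \<delta>) \<delta> - Hs (q + t *\<^sub>R \<delta>) \<delta>)\<bar> \<le> norm \<delta> * norm (Hs (q + s *\<^sub>R \<delta>) \<delta> - Hs (q + t *\<^sub>R \<delta>) \<delta>)"
      by (rule Cauchy_Schwarz_ineq2)
    also have "\<dots> \<le> norm \<delta> * (LH * norm ((q + s *\<^sub>R \<delta>) - (q + t *\<^sub>R \<delta>)) * norm \<delta>)"
      by (intro mult_left_mono Hs_lipschitz) auto
    finally show "\<bar>\<delta> \<bullet> (Hs (q + s *\<^sub>R \<delta>) \<delta> - Hs (q + t *\<^sub>R \<delta>) \<delta>)\<bar> \<le> norm \<delta> * (LH * norm ((q + s *\<^sub>R \<delta>) - (q + t *\<^sub>R \<delta>)) * norm \<delta>)" .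
  qed (use t in auto)
  also have "norm ((q + s *\<^sub>R \<delta>) - (q + t *\<^sub>R \<delta>)) = (t - s) * norm \<delta>"
    using s(2) by (simp add: scaleR_left_diff_distrib[symmetric])
  also have "(1 / 2) * (norm \<delta> * (LH * ((t - s) * norm \<delta>) * norm \<delta>)) = (t - s) * (LH * norm \<delta> ^ 3 / 2)"
    by (simp add: power3_eq_cube)
  also have "\<dots> \<le> 1 * (LH * norm \<delta> ^ 3 / 2)"
    using s t LH_nonneg by (intro mult_right_mono) auto
  finally have "\<bar>r 1\<bar> \<le> LH * norm \<delta> ^ 3 / 2" using t by simp
  then show ?thesis by (simp add: r_def inner_add)
qed

definition energy :: "'a \<times> 'a \<Rightarrow> real" where
  "energy s = U (fst s) + (norm (snd s))\<^sup>2 / 2"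

text \<open>With the half-step velocity w and the gradients g and g' at both ends, the kinetic
  energy changes by - (h / 2) w . (g + g') + (h^2 / 8) (|g'|^2 - |g|^2). The first term is the
  trapezoidal rule for the negative change of U; in the second the difference of squares gains a
  power of h.\<close>

lemma energy_error:
  fixes q v :: 'a
  assumes h: "0 < h"
  defines "w \<equiv> v - (h / 2) *\<^sub>R G q"
  shows "\<bar>energy (verlet_step U h (q, v)) - energy (q, v)\<bar> \<le>
    LH * (h * norm w) ^ 3 / 2 + h ^ 3 * L / 8 * norm w * (2 * norm (G q) + L * h * norm w)"
proof -
  define q' where "q' = q + h *\<^sub>R w"
  define g where "g = G q"
  define g' where "g' = G q'"
  have v: "v = w + (h / 2) *\<^sub>R g" by (simp add: w_def g_def)
  have step: "verlet_step U h (q, v) = (q', w - (h / 2) *\<^sub>R g')"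
  proof (rule prod_eqI)
    show 1: "fst (verlet_step U h (q, v)) = fst (q', w - (h / 2) *\<^sub>R g')"
      by (simp add: fst_verlet_step q'_def v g_def algebra_simps power2_eq_square)
    show "snd (verlet_step U h (q, v)) = snd (q', w - (h / 2) *\<^sub>R g')"
      unfolding snd_verlet_step 1 by (simp add: v g_def g'_def algebra_simps)
  qed
  have "energy (verlet_step U h (q, v)) - energy (q, v) = (U q' - U q - (1/2) * ((h *\<^sub>R w) \<bullet> (g + g'))) +
      h\<^sup>2 / 8 * ((norm g')\<^sup>2 - (norm g)\<^sup>2)"
    unfolding step energy_def fst_conv snd_conv
    unfolding v power2_norm_eq_inner
    by (simp add: inner_simps inner_commute[of g w] inner_commute[of g' w] power2_eq_square field_simps)
  also have "\<bar>\<dots>\<bar> \<le> \<bar>U q' - U q - (1/2) * ((h *\<^sub>R w) \<bullet> (g + g'))\<bar> + \<bar>h\<^sup>2 / 8 * ((norm g')\<^sup>2 - (norm g)\<^sup>2)\<bar>"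
    by (rule abs_triangle_ineq)
  also have "\<dots> \<le> LH * (h * norm w) ^ 3 / 2 + h ^ 3 * L / 8 * norm w * (2 * norm g + L * h * norm w)"
  proof (rule add_mono)
    show "\<bar>U q' - U q - (1/2) * ((h *\<^sub>R w) \<bullet> (g + g'))\<bar> \<le> LH * (h * norm w) ^ 3 / 2"
      using trapezoid[of q "h *\<^sub>R w"] h by (simp add: q'_def g_def g'_def)
    have gg: "norm (g' - g) \<le> L * (h * norm w)"
      using G_lipschitz[of q' q] h by (simp add: q'_def g_def g'_def)
    have n: "norm g' \<le> norm g + L * (h * norm w)" using gg norm_triangle_sub[of g' g] by linarith
    have "\<bar>(norm g')\<^sup>2 - (norm g)\<^sup>2\<bar> = \<bar>norm g' - norm g\<bar> * (norm g' + norm g)"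
      by (simp add: power2_eq_square square_diff_square_factored abs_mult mult.commute)
    also have "\<dots> \<le> (L * (h * norm w)) * (2 * norm g + L * h * norm w)"
      using gg n norm_triangle_ineq3[of g' g] h L_nonneg by (intro mult_mono) auto
    finally have "h\<^sup>2 / 8 * \<bar>(norm g')\<^sup>2 - (norm g)\<^sup>2\<bar> \<le> h\<^sup>2 / 8 * ((L * (h * norm w)) * (2 * norm g + L * h * norm w))"
      by (intro mult_left_mono) auto
    then show "\<bar>h\<^sup>2 / 8 * ((norm g')\<^sup>2 - (norm g)\<^sup>2)\<bar> \<le> h ^ 3 * L / 8 * norm w * (2 * norm g + L * h * norm w)"
      by (simp add: abs_mult power2_eq_square power3_eq_cube mult_ac)
  qed
  finally show ?thesis by (simp add: g_def)
qed

lemma continuous_Hs: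
  assumes "continuous_on S f" "continuous_on S g"
  shows "continuous_on S (\<lambda>p. Hs (f p) (g p))"
proof -
  have "isCont (\<lambda>p. Hs (fst p) (snd p)) p0" for p0
  proof -
    have "((\<lambda>p. Hs (fst p) (snd p) - Hs (fst p0) (snd p0)) \<longlongrightarrow> 0) (at p0)"
    proof (rule Lim_null_comparison)
      show "\<forall>\<^sub>F p in at p0. norm (Hs (fst p) (snd p) - Hs (fst p0) (snd p0)) \<le>
          LH * norm (fst p - fst p0) * norm (snd p) + L * norm (snd p - snd p0)"
      proof (rule always_eventually, rule allI)
        fix p
        have "Hs (fst p) (snd p) - Hs (fst p0) (snd p0) =
            (Hs (fst p) (snd p) - Hs (fst p0) (snd p)) + Hs (fst p0) (snd p - snd p0)"
          by (simp add: linear_diff[OF Hs_linear])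
        then have "norm (Hs (fst p) (snd p) - Hs (fst p0) (snd p0)) =
            norm ((Hs (fst p) (snd p) - Hs (fst p0) (snd p)) + Hs (fst p0) (snd p - snd p0))" by (rule arg_cong)
        then show "norm (Hs (fst p) (snd p) - Hs (fst p0) (snd p0)) \<le>
          LH * norm (fst p - fst p0) * norm (snd p) + L * norm (snd p - snd p0)"
          using Hs_lipschitz[of "fst p" "snd p" "fst p0"] Hs_bound[of "fst p0" "snd p - snd p0"]
            norm_triangle_ineq[of "Hs (fst p) (snd p) - Hs (fst p0) (snd p)" "Hs (fst p0) (snd p - snd p0)"]
          by linarith
      qed
      have "((\<lambda>p. LH * norm (fst p - fst p0) * norm (snd p) + L * norm (snd p - snd p0)) \<longlongrightarrow>
          LH * norm (fst p0 - fst p0) * norm (snd p0) + L * norm (snd p0 - snd p0)) (at p0)"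
        by (intro tendsto_intros)
      then show "((\<lambda>p. LH * norm (fst p - fst p0) * norm (snd p) + L * norm (snd p - snd p0)) \<longlongrightarrow> 0) (at p0)"
        by simp
    qed
    then show ?thesis unfolding isCont_def using LIM_zero_iff by blast
  qed
  then have "continuous_on UNIV (\<lambda>p. Hs (fst p) (snd p))"
    by (simp add: continuous_at_imp_continuous_on)
  from continuous_on_compose2[OF this continuous_on_Pair[OF assms]] show ?thesis by simp
qed

end

section \<open>Reflections, the Gibbs measure and moments of the gradient\<close>

lemma nn_integral_lborel_uminus:
  fixes f :: "'a::euclidean_space \<Rightarrow> ennreal"
  assumes [measurable]: "f \<in> borel_measurable borel"
  shows "(\<integral>\<^sup>+ x. f (- x) \<partial>lborel) = (\<integral>\<^sup>+ x. f x \<partial>lborel)"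
proof -
  have eq: "lborel = distr lborel borel (\<lambda>x::'a. - x)"
    using lborel_affine[of "-1" "0::'a"] by (simp add: density_1)
  show ?thesis by (subst (2) eq, subst nn_integral_distr) auto
qed

lemma nn_integral_std_gaussian_uminus:
  fixes f :: "'a::euclidean_space \<Rightarrow> ennreal"
  assumes [measurable]: "f \<in> borel_measurable borel"
  shows "(\<integral>\<^sup>+ x. f (- x) \<partial>std_gaussian) = (\<integral>\<^sup>+ x. f x \<partial>std_gaussian)"
proof -
  have "(\<integral>\<^sup>+ x. f (- x) \<partial>std_gaussian) = (\<integral>\<^sup>+ x. ennreal (gauss_density (- x)) * f (- x) \<partial>lborel)"
    by (subst nn_integral_std_gaussian) (auto simp: gauss_density_eq)
  also have "\<dots> = (\<integral>\<^sup>+ x. ennreal (gauss_density x) * f x \<partial>lborel)"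
    by (rule nn_integral_lborel_uminus) simp
  finally show ?thesis by (simp add: nn_integral_std_gaussian)
qed

locale gibbs_potential = potential +
  assumes int_exp: "integrable lborel (\<lambda>x. exp (- U x))" and L_pos: "0 < L"
begin

definition Z :: real where "Z = (\<integral>x. exp (- U x) \<partial>lborel)"

definition dens :: "'a \<Rightarrow> real" where "dens x = exp (- U x) / Z"

lemma nn_integral_exp_U: "(\<integral>\<^sup>+ x. ennreal (exp (- U x)) \<partial>lborel) = ennreal Z"
  unfolding Z_def using int_exp by (rule nn_integral_eq_integral) auto

lemma Z_pos: "0 < Z"
proof -
  have "0 \<le> Z" unfolding Z_def by simp
  moreover have "Z \<noteq> 0"
  proof
    assume "Z = 0"
    then have "AE x in lborel. exp (- U x) = 0"
      unfolding Z_def using int_exp by (subst (asm) integral_nonneg_eq_0_iff_AE) auto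
    then have "AE x in (lborel :: 'a measure). False" by simp
    then show False by (simp add: AE_iff_measurable[of UNIV] emeasure_lborel_UNIV)
  qed
  ultimately show ?thesis by simp
qed

lemma dens_nonneg [simp]: "0 \<le> dens x" using Z_pos by (simp add: dens_def)

lemma measurable_dens [measurable]: "dens \<in> borel_measurable borel" unfolding dens_def by measurable

lemma gibbs_eq: "gibbs U = density lborel (\<lambda>x. ennreal (dens x))"
  by (simp add: gibbs_def dens_def Z_def)

lemma sets_gibbs [simp, measurable_cong]: "sets (gibbs U) = sets borel" by (simp add: gibbs_eq)

lemma space_gibbs [simp]: "space (gibbs U) = UNIV" by (simp add: gibbs_eq)

lemma nn_integral_gibbs:
  "f \<in> borel_measurable borel \<Longrightarrow> (\<integral>\<^sup>+ x. f x \<partial>gibbs U) = (\<integral>\<^sup>+ x. ennreal (dens x) * f x \<partial>lborel)"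
  unfolding gibbs_eq by (rule nn_integral_density) auto

lemma nn_integral_dens: "(\<integral>\<^sup>+ x. ennreal (dens x) \<partial>lborel) = 1"
proof -
  have "(\<integral>\<^sup>+ x. ennreal (dens x) \<partial>lborel) = (\<integral>\<^sup>+ x. ennreal (1 / Z) * ennreal (exp (- U x)) \<partial>lborel)"
    using Z_pos by (simp add: dens_def ennreal_mult[symmetric])
  also have "\<dots> = ennreal (1 / Z) * ennreal Z" by (simp add: nn_integral_cmult nn_integral_exp_U)
  also have "\<dots> = 1" using Z_pos by (simp add: ennreal_mult[symmetric])
  finally show ?thesis .
qed

lemma prob_space_gibbs: "prob_space (gibbs U)"
  by (rule prob_spaceI) (simp add: gibbs_eq emeasure_density nn_integral_dens)

sublocale gibbs: prob_space "gibbs U" by (rule prob_space_gibbs)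

text \<open>Translating \<open>exp (- U)\<close> by \<open>c\<close> and using the descent lemma shows that the gradient is
  sub-Gaussian under the Gibbs measure.\<close>

lemma gradient_subgaussian:
  "(\<integral>\<^sup>+ x. ennreal (exp (c \<bullet> G x)) \<partial>gibbs U) \<le> ennreal (exp (L * (norm c)\<^sup>2 / 2))"
proof -
  have "(\<integral>\<^sup>+ x. ennreal (exp (c \<bullet> G x)) \<partial>gibbs U) = (\<integral>\<^sup>+ x. ennreal (dens x * exp (c \<bullet> G x)) \<partial>lborel)"
    by (simp add: nn_integral_gibbs ennreal_mult)
  also have "\<dots> \<le> (\<integral>\<^sup>+ x. ennreal (exp (L * (norm c)\<^sup>2 / 2)) * ennreal (dens (x + (- c))) \<partial>lborel)"
  proof (intro nn_integral_mono)
    fix x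
    have "exp (- U x) * exp (c \<bullet> G x) \<le> exp (L * (norm c)\<^sup>2 / 2) * exp (- U (x - c))"
      unfolding exp_add[symmetric] using descent[of x c] by simp
    then have "dens x * exp (c \<bullet> G x) \<le> exp (L * (norm c)\<^sup>2 / 2) * dens (x + (- c))"
      using Z_pos unfolding dens_def by (simp add: divide_right_mono)
    then show "ennreal (dens x * exp (c \<bullet> G x)) \<le> ennreal (exp (L * (norm c)\<^sup>2 / 2)) * ennreal (dens (x + (- c)))"
      by (simp add: ennreal_mult[symmetric] ennreal_leI)
  qed
  also have "\<dots> = ennreal (exp (L * (norm c)\<^sup>2 / 2)) * (\<integral>\<^sup>+ x. ennreal (dens (x + (- c))) \<partial>lborel)"
    by (rule nn_integral_cmult) measurable
  also have "(\<integral>\<^sup>+ x. ennreal (dens (x + (- c))) \<partial>lborel) = 1"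
    by (subst nn_integral_lborel_translate) (auto simp: nn_integral_dens)
  finally show ?thesis by simp
qed

lemma gradient_component_moment:
  assumes b: "b \<in> Basis" and k: "0 < k"
  shows "(\<integral>\<^sup>+ x. ennreal ((G x \<bullet> b) ^ (2 * k)) \<partial>gibbs U) \<le> ennreal (fact (2 * k) * (L * exp 1 / (2 * real k)) ^ k)"
proof -
  \<comment> \<open>The minimizer of exp (L \<eta>^2 / 2) / \<eta>^(2k). At this value the
    exponential moment is bounded by exp k.\<close>
  define \<eta> where "\<eta> = sqrt (2 * real k / L)"
  have \<eta>2: "\<eta>\<^sup>2 = 2 * real k / L" using L_pos by (simp add: \<eta>_def)
  define A where "A = fact (2 * k) * (L / (2 * real k)) ^ k"
  have A: "0 \<le> A" using L_pos by (simp add: A_def)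
  have le: "y ^ (2 * k) \<le> A * (exp (\<eta> * y) / 2 + exp (- \<eta> * y) / 2)" for y
  proof -
    have "(\<eta> * y) ^ (2 * k) / fact (2 * k) \<le> cosh (\<eta> * y)" by (rule cosh_ge_monomial)
    moreover have "(\<eta> * y) ^ (2 * k) = (2 * real k / L) ^ k * y ^ (2 * k)"
      by (simp only: power_mult_distrib power_mult \<eta>2)
    moreover have "A * ((2 * real k / L) ^ k * y ^ (2 * k) / fact (2 * k)) = y ^ (2 * k)"
      using L_pos k by (simp add: A_def power_divide power_mult_distrib)
    ultimately have "y ^ (2 * k) \<le> A * cosh (\<eta> * y)" using A by (metis mult_left_mono)
    then show ?thesis by (simp add: cosh_field_def add_divide_distrib)
  qed
  have e: "(\<integral>\<^sup>+ x. ennreal (exp ((s * \<eta>) * (G x \<bullet> b))) \<partial>gibbs U) \<le> ennreal (exp (real k))" if s: "s\<^sup>2 = 1" for s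
  proof -
    have "(norm ((s * \<eta>) *\<^sub>R b))\<^sup>2 = \<eta>\<^sup>2" using b s by (simp add: power_mult_distrib)
    then have "L * (norm ((s * \<eta>) *\<^sub>R b))\<^sup>2 / 2 = real k" using L_pos \<eta>2 by simp
    then show ?thesis using gradient_subgaussian[of "(s * \<eta>) *\<^sub>R b"] by (simp add: inner_commute)
  qed
  have "(\<integral>\<^sup>+ x. ennreal ((G x \<bullet> b) ^ (2 * k)) \<partial>gibbs U) \<le>
     (\<integral>\<^sup>+ x. ennreal (A / 2) * (ennreal (exp ((1 * \<eta>) * (G x \<bullet> b))) + ennreal (exp (((- 1) * \<eta>) * (G x \<bullet> b)))) \<partial>gibbs U)"
  proof (intro nn_integral_mono)
    fix x
    have "ennreal ((G x \<bullet> b) ^ (2 * k)) \<le> ennreal ((A / 2) * (exp ((1 * \<eta>) * (G x \<bullet> b)) + exp (((- 1) * \<eta>) * (G x \<bullet> b))))"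
      using le[of "G x \<bullet> b"] by (intro ennreal_leI) (simp add: field_simps)
    then show "ennreal ((G x \<bullet> b) ^ (2 * k)) \<le> ennreal (A / 2) * (ennreal (exp ((1 * \<eta>) * (G x \<bullet> b))) + ennreal (exp (((- 1) * \<eta>) * (G x \<bullet> b))))"
      using A by (simp only: ennreal_mult ennreal_plus exp_ge_zero add_nonneg_nonneg divide_nonneg_nonneg zero_le_numeral)
  qed
  also have "\<dots> = ennreal (A / 2) * ((\<integral>\<^sup>+ x. ennreal (exp ((1 * \<eta>) * (G x \<bullet> b))) \<partial>gibbs U) + (\<integral>\<^sup>+ x. ennreal (exp (((- 1) * \<eta>) * (G x \<bullet> b))) \<partial>gibbs U))"
    by (subst nn_integral_cmult, measurable, subst nn_integral_add, measurable)
  also have "\<dots> \<le> ennreal (A / 2) * (ennreal (exp (real k)) + ennreal (exp (real k)))"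
    by (intro mult_left_mono add_mono e) auto
  also have "\<dots> = ennreal (A * exp (real k))"
    using A by (simp add: ennreal_mult[symmetric] ennreal_plus[symmetric] del: ennreal_plus)
  also have "A * exp (real k) = fact (2 * k) * (L * exp 1 / (2 * real k)) ^ k"
    by (simp add: A_def power_divide power_mult_distrib exp_of_nat_mult[symmetric])
  finally show ?thesis .
qed

text \<open>\<open>A\<close> stands for a rational majorant of (2j)! (e / (2j))^j with j = k + 1, so
  that later estimates deal with plain numbers.\<close>

lemma gradient_moment:
  assumes A: "fact (2 * Suc k) * (exp 1 / (2 * real (Suc k))) ^ Suc k \<le> A"
  shows "integrable (gibbs U) (\<lambda>x. norm (G x) ^ (2 * Suc k))"
    "(\<integral>x. norm (G x) ^ (2 * Suc k) \<partial>gibbs U) \<le> A * real DIM('a) ^ Suc k * L ^ Suc k"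
proof -
  have "0 \<le> fact (2 * Suc k) * (exp 1 / (2 * real (Suc k))) ^ Suc k"
    by (intro mult_nonneg_nonneg zero_le_power divide_nonneg_nonneg) auto
  then have A0: "0 \<le> A" using A by linarith
  have "(\<integral>\<^sup>+ x. ennreal (norm (G x) ^ (2 * Suc k)) \<partial>gibbs U) \<le>
      (\<integral>\<^sup>+ x. ennreal (real DIM('a) ^ k) * (\<Sum>b\<in>(Basis::'a set). ennreal ((G x \<bullet> b) ^ (2 * Suc k))) \<partial>gibbs U)"
  proof (intro nn_integral_mono)
    fix x
    have "ennreal (norm (G x) ^ (2 * Suc k)) \<le> ennreal (real DIM('a) ^ k * (\<Sum>b\<in>Basis. (G x \<bullet> b) ^ (2 * Suc k)))"
      by (rule ennreal_leI[OF norm_even_power_le])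
    then show "ennreal (norm (G x) ^ (2 * Suc k)) \<le> ennreal (real DIM('a) ^ k) * (\<Sum>b\<in>(Basis::'a set). ennreal ((G x \<bullet> b) ^ (2 * Suc k)))"
      by (simp add: sum_ennreal ennreal_mult sum_nonneg zero_le_even_power del: power_Suc)
  qed
  also have "\<dots> = ennreal (real DIM('a) ^ k) * (\<Sum>b\<in>(Basis::'a set). \<integral>\<^sup>+ x. ennreal ((G x \<bullet> b) ^ (2 * Suc k)) \<partial>gibbs U)"
    by (subst nn_integral_cmult, measurable, subst nn_integral_sum, measurable)
  also have "\<dots> \<le> ennreal (real DIM('a) ^ k) * (\<Sum>b\<in>(Basis::'a set). ennreal (A * L ^ Suc k))"
  proof (intro mult_left_mono sum_mono)
    fix b :: 'a assume b: "b \<in> Basis"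
    have "fact (2 * Suc k) * (L * exp 1 / (2 * real (Suc k))) ^ Suc k = fact (2 * Suc k) * (exp 1 / (2 * real (Suc k))) ^ Suc k * L ^ Suc k"
      by (simp add: power_divide power_mult_distrib)
    also have "\<dots> \<le> A * L ^ Suc k" using L_pos by (intro mult_right_mono A) auto
    finally have "fact (2 * Suc k) * (L * exp 1 / (2 * real (Suc k))) ^ Suc k \<le> A * L ^ Suc k" .
    then show "(\<integral>\<^sup>+ x. ennreal ((G x \<bullet> b) ^ (2 * Suc k)) \<partial>gibbs U) \<le> ennreal (A * L ^ Suc k)"
      using gradient_component_moment[OF b, of "Suc k"] by (meson ennreal_leI order_trans zero_less_Suc)
  qed auto
  also have "\<dots> = ennreal (A * real DIM('a) ^ Suc k * L ^ Suc k)"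
    using A0 L_pos by (simp add: sum_ennreal ennreal_mult[symmetric] ennreal_of_nat_eq_real_of_nat mult_ac)
  finally have *: "(\<integral>\<^sup>+ x. ennreal (norm (G x) ^ (2 * Suc k)) \<partial>gibbs U) \<le> ennreal (A * real DIM('a) ^ Suc k * L ^ Suc k)" .
  show i: "integrable (gibbs U) (\<lambda>x. norm (G x) ^ (2 * Suc k))"
    using * by (intro integrableI_bounded) (auto intro: le_less_trans simp: zero_le_even_power simp del: power_Suc)
  then show "(\<integral>x. norm (G x) ^ (2 * Suc k) \<partial>gibbs U) \<le> A * real DIM('a) ^ Suc k * L ^ Suc k"
    using * A0 L_pos by (subst (asm) nn_integral_eq_integral) (auto simp: ennreal_le_iff simp del: power_Suc)
qed

end

section \<open>Midpoint coordinates\<close>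

context potential
begin

definition half_velocity :: "real \<Rightarrow> 'a \<Rightarrow> 'a \<Rightarrow> 'a" where
  "half_velocity h q v = v - (h / 2) *\<^sub>R G q"

definition next_q :: "real \<Rightarrow> 'a \<Rightarrow> 'a \<Rightarrow> 'a" where
  "next_q h q v = q + h *\<^sub>R half_velocity h q v"

definition next_v :: "real \<Rightarrow> 'a \<Rightarrow> 'a \<Rightarrow> 'a" where
  "next_v h q v = half_velocity h q v - (h / 2) *\<^sub>R G (next_q h q v)"

lemma verlet_step_eq: "verlet_step U h (q, v) = (next_q h q v, next_v h q v)"
proof (rule prod_eqI)
  show 1: "fst (verlet_step U h (q, v)) = fst (next_q h q v, next_v h q v)"
    by (simp add: fst_verlet_step next_q_def half_velocity_def algebra_simps power2_eq_square)
  show "snd (verlet_step U h (q, v)) = snd (next_q h q v, next_v h q v)"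
    unfolding snd_verlet_step 1 by (simp add: next_v_def half_velocity_def algebra_simps)
qed

lemma measurable_verlet [measurable]:
  "case_prod (half_velocity h) \<in> borel \<Otimes>\<^sub>M borel \<rightarrow>\<^sub>M borel"
  "case_prod (next_q h) \<in> borel \<Otimes>\<^sub>M borel \<rightarrow>\<^sub>M borel"
  "case_prod (next_v h) \<in> borel \<Otimes>\<^sub>M borel \<rightarrow>\<^sub>M borel"
  unfolding half_velocity_def next_q_def next_v_def by measurable

text \<open>In the coordinates \<open>(m, w)\<close>, midpoint and half-step velocity, a Verlet step is the
  reflection \<open>w \<mapsto> - w\<close> followed by a change of sign of the velocity.\<close>

definition mid_q :: "real \<Rightarrow> 'a \<Rightarrow> 'a \<Rightarrow> 'a" where
  "mid_q h m w = m - (h / 2) *\<^sub>R w"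

definition mid_v :: "real \<Rightarrow> 'a \<Rightarrow> 'a \<Rightarrow> 'a" where
  "mid_v h m w = w + (h / 2) *\<^sub>R G (mid_q h m w)"

lemma next_mid:
  "next_q h (mid_q h m w) (mid_v h m w) = mid_q h m (- w)"
  "next_v h (mid_q h m w) (mid_v h m w) = - mid_v h m (- w)"
proof -
  have 1: "half_velocity h (mid_q h m w) (mid_v h m w) = w" by (simp add: half_velocity_def mid_v_def)
  have "(h / 2) *\<^sub>R w + (h / 2) *\<^sub>R w = h *\<^sub>R w" by (simp flip: scaleR_add_left)
  then show 2: "next_q h (mid_q h m w) (mid_v h m w) = mid_q h m (- w)"
    unfolding next_q_def 1 by (simp add: mid_q_def algebra_simps)
  show "next_v h (mid_q h m w) (mid_v h m w) = - mid_v h m (- w)"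
    unfolding next_v_def 1 2 by (simp add: mid_v_def)
qed

end

context gibbs_potential
begin

text \<open>The joint density of position and velocity at the phase point with coordinates (m, w).
  The factor exp (|w|^2 / 2) compensates for the Gaussian reference measure in w.\<close>

definition mid_dens :: "real \<Rightarrow> 'a \<Rightarrow> 'a \<Rightarrow> real" where
  "mid_dens h m w = exp ((norm w)\<^sup>2 / 2 - U (mid_q h m w) - (norm (mid_v h m w))\<^sup>2 / 2) / Z"

lemma mid_dens_pos: "0 < mid_dens h m w" using Z_pos by (simp add: mid_dens_def)

lemma mid_dens_nonneg [simp]: "0 \<le> mid_dens h m w" using mid_dens_pos less_imp_le by blast

lemma measurable_mid [measurable]:
  "case_prod (mid_q h) \<in> borel \<Otimes>\<^sub>M borel \<rightarrow>\<^sub>M borel"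
  "case_prod (mid_v h) \<in> borel \<Otimes>\<^sub>M borel \<rightarrow>\<^sub>M borel"
  "case_prod (mid_dens h) \<in> borel \<Otimes>\<^sub>M borel \<rightarrow>\<^sub>M borel"
  unfolding mid_q_def mid_v_def mid_dens_def by measurable

text \<open>The coordinate change is a composition of two shears, a translation of the velocity at
  fixed position and a translation of the position at fixed w. No Jacobian appears.\<close>

lemma midpoint_transform:
  assumes [measurable]: "case_prod F \<in> borel_measurable (borel \<Otimes>\<^sub>M borel)"
  shows "(\<integral>\<^sup>+ m. (\<integral>\<^sup>+ w. ennreal (mid_dens h m w) * F (mid_q h m w) (mid_v h m w) \<partial>std_gaussian) \<partial>lborel) =
    (\<integral>\<^sup>+ q. (\<integral>\<^sup>+ v. F q v \<partial>std_gaussian) \<partial>gibbs U)"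
proof -
  define K where "K = (\<lambda>q v. ennreal (dens q) * (ennreal (gauss_density v) * F q v))"
  have [measurable]: "case_prod K \<in> borel_measurable (borel \<Otimes>\<^sub>M borel)" unfolding K_def by measurable
  define K1 where "K1 = (\<lambda>q w. K q (w + (h / 2) *\<^sub>R G q))"
  have [measurable]: "case_prod K1 \<in> borel_measurable (borel \<Otimes>\<^sub>M borel)" unfolding K1_def by measurable
  define K2 where "K2 = (\<lambda>m w. K1 (m + (- (h / 2) *\<^sub>R w)) w)"
  have [measurable]: "case_prod K2 \<in> borel_measurable (borel \<Otimes>\<^sub>M borel)" unfolding K2_def by measurable
  have gd: "gauss_density w * mid_dens h m w = dens (mid_q h m w) * gauss_density (mid_v h m w)" for m w
  proof -
    have "- (norm w)\<^sup>2 / 2 + ((norm w)\<^sup>2 / 2 - U (mid_q h m w) - (norm (mid_v h m w))\<^sup>2 / 2) =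
      - U (mid_q h m w) + - (norm (mid_v h m w))\<^sup>2 / 2" by simp
    then show ?thesis unfolding gauss_density_eq mid_dens_def dens_def
      by (simp add: exp_add[symmetric] del: exp_add)
  qed
  have "(\<integral>\<^sup>+ m. (\<integral>\<^sup>+ w. ennreal (mid_dens h m w) * F (mid_q h m w) (mid_v h m w) \<partial>std_gaussian) \<partial>lborel) =
      (\<integral>\<^sup>+ m. (\<integral>\<^sup>+ w. K2 m w \<partial>lborel) \<partial>lborel)"
  proof (intro nn_integral_cong)
    fix m
    have "ennreal (gauss_density w) * (ennreal (mid_dens h m w) * F (mid_q h m w) (mid_v h m w)) = K2 m w" for w
    proof -
      have "ennreal (gauss_density w) * (ennreal (mid_dens h m w) * F (mid_q h m w) (mid_v h m w)) =
        ennreal (gauss_density w * mid_dens h m w) * F (mid_q h m w) (mid_v h m w)"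
        by (simp add: ennreal_mult mult.assoc)
      also have "\<dots> = K2 m w"
        unfolding gd K2_def K1_def K_def by (simp add: ennreal_mult mult.assoc mid_q_def mid_v_def)
      finally show ?thesis .
    qed
    then show "(\<integral>\<^sup>+ w. ennreal (mid_dens h m w) * F (mid_q h m w) (mid_v h m w) \<partial>std_gaussian) = (\<integral>\<^sup>+ w. K2 m w \<partial>lborel)"
      by (subst nn_integral_std_gaussian) measurable
  qed
  also have "\<dots> = (\<integral>\<^sup>+ w. (\<integral>\<^sup>+ m. K2 m w \<partial>lborel) \<partial>lborel)"
    by (rule nn_integral_lborel_swap) measurable
  also have "\<dots> = (\<integral>\<^sup>+ w. (\<integral>\<^sup>+ q. K1 q w \<partial>lborel) \<partial>lborel)"
    unfolding K2_def by (intro nn_integral_cong nn_integral_lborel_translate) measurable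
  also have "\<dots> = (\<integral>\<^sup>+ q. (\<integral>\<^sup>+ w. K1 q w \<partial>lborel) \<partial>lborel)"
    by (rule nn_integral_lborel_swap[symmetric]) measurable
  also have "\<dots> = (\<integral>\<^sup>+ q. (\<integral>\<^sup>+ v. K q v \<partial>lborel) \<partial>lborel)"
    unfolding K1_def by (intro nn_integral_cong nn_integral_lborel_translate) measurable
  also have "\<dots> = (\<integral>\<^sup>+ q. (\<integral>\<^sup>+ v. F q v \<partial>std_gaussian) \<partial>gibbs U)"
    unfolding K_def by (simp add: nn_integral_gibbs nn_integral_std_gaussian nn_integral_cmult)
  finally show ?thesis .
qed

lemma midpoint_transform_neg:
  assumes [measurable]: "case_prod F \<in> borel_measurable (borel \<Otimes>\<^sub>M borel)"
  shows "(\<integral>\<^sup>+ m. (\<integral>\<^sup>+ w. ennreal (mid_dens h m (- w)) * F (mid_q h m (- w)) (mid_v h m (- w)) \<partial>std_gaussian) \<partial>lborel) =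
    (\<integral>\<^sup>+ q. (\<integral>\<^sup>+ v. F q v \<partial>std_gaussian) \<partial>gibbs U)"
  unfolding midpoint_transform[OF assms, of h, symmetric]
proof (rule nn_integral_cong)
  fix m
  show "(\<integral>\<^sup>+ w. ennreal (mid_dens h m (- w)) * F (mid_q h m (- w)) (mid_v h m (- w)) \<partial>std_gaussian) =
     (\<integral>\<^sup>+ w. ennreal (mid_dens h m w) * F (mid_q h m w) (mid_v h m w) \<partial>std_gaussian)"
    by (rule nn_integral_std_gaussian_uminus[of "\<lambda>w. ennreal (mid_dens h m w) * F (mid_q h m w) (mid_v h m w)"]) measurable
qed

text \<open>The L^1 distance of the phase space law from its image under one Verlet step, written in
  midpoint coordinates.\<close>

definition mid_asym :: "real \<Rightarrow> ennreal" where
  "mid_asym h = (\<integral>\<^sup>+ m. (\<integral>\<^sup>+ w. ennreal \<bar>mid_dens h m w - mid_dens h m (- w)\<bar> \<partial>std_gaussian) \<partial>lborel)"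

text \<open>A finite a priori bound is what permits absorbing \<open>mid_asym\<close> from the
  right-hand side of its own estimate.\<close>

lemma mid_asym_le_2: "mid_asym h \<le> 2"
proof -
  have "mid_asym h \<le> (\<integral>\<^sup>+ m. (\<integral>\<^sup>+ w. ennreal (mid_dens h m w) * 1 + ennreal (mid_dens h m (- w)) * 1 \<partial>std_gaussian) \<partial>lborel)"
    unfolding mid_asym_def
    by (intro nn_integral_mono) (auto simp: abs_le_iff intro!: ennreal_leI simp flip: ennreal_plus)
  also have "\<dots> = 2"
    using midpoint_transform[of "\<lambda>_ _. 1" h] midpoint_transform_neg[of "\<lambda>_ _. 1" h]
    by (simp add: nn_integral_add std_gaussian.emeasure_space_1[simplified] gibbs.emeasure_space_1[simplified])
  finally show ?thesis .
qed

text \<open>The symmetry of the Gaussian velocity allows \<open>B\<close> to be computed with v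
  reversed. Then \<open>A\<close> and \<open>B\<close> integrate the same function \<open>R\<close>,
  with weights f (m, w) and f (m, - w).\<close>

lemma one_step:
  fixes J :: "'a \<Rightarrow> 'a \<Rightarrow> ennreal" and h :: real
  assumes [measurable]: "case_prod J \<in> borel_measurable (borel \<Otimes>\<^sub>M borel)" and J: "\<And>q v. J q v \<le> 1"
  defines "A \<equiv> (\<integral>\<^sup>+ q. (\<integral>\<^sup>+ v. J (next_q h q v) (next_v h q v) \<partial>std_gaussian) \<partial>gibbs U)"
    and "B \<equiv> (\<integral>\<^sup>+ q. (\<integral>\<^sup>+ v. J q v \<partial>std_gaussian) \<partial>gibbs U)"
  shows "A \<le> B + mid_asym h" "B \<le> A + mid_asym h"
proof -
  define R where "R = (\<lambda>m w. J (mid_q h m (- w)) (- mid_v h m (- w)))"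
  have [measurable]: "case_prod R \<in> borel_measurable (borel \<Otimes>\<^sub>M borel)" unfolding R_def by measurable
  have A: "A = (\<integral>\<^sup>+ m. (\<integral>\<^sup>+ w. ennreal (mid_dens h m w) * R m w \<partial>std_gaussian) \<partial>lborel)"
    unfolding A_def by (subst midpoint_transform[of _ h, symmetric]) (measurable, simp add: next_mid R_def)
  have "B = (\<integral>\<^sup>+ q. (\<integral>\<^sup>+ v. J q (- v) \<partial>std_gaussian) \<partial>gibbs U)"
    unfolding B_def by (intro nn_integral_cong nn_integral_std_gaussian_uminus[symmetric]) measurable
  then have B: "B = (\<integral>\<^sup>+ m. (\<integral>\<^sup>+ w. ennreal (mid_dens h m (- w)) * R m w \<partial>std_gaussian) \<partial>lborel)"
    by (subst (asm) midpoint_transform_neg[of _ h, symmetric]) (measurable, simp add: R_def)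
  have le: "x * R m w \<le> y * R m w + z" if "x \<le> y + z" for x y z m w
  proof -
    have "x * R m w \<le> (y + z) * R m w" using that by (rule mult_right_mono) simp
    also have "\<dots> \<le> y * R m w + z * 1" unfolding distrib_right
      using J by (intro add_left_mono mult_left_mono) (auto simp: R_def)
    finally show ?thesis by simp
  qed
  show "A \<le> B + mid_asym h"
    unfolding A B mid_asym_def
    by (subst nn_integral_add[symmetric], measurable, intro nn_integral_mono, subst nn_integral_add[symmetric], measurable, intro nn_integral_mono le)
       (auto simp flip: ennreal_plus intro!: ennreal_leI)
  show "B \<le> A + mid_asym h"
    unfolding A B mid_asym_def
    by (subst nn_integral_add[symmetric], measurable, intro nn_integral_mono, subst nn_integral_add[symmetric], measurable, intro nn_integral_mono le)
       (auto simp flip: ennreal_plus intro!: ennreal_leI)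
qed

section \<open>Gradient bound for the odd part of the density\<close>

definition defect :: "real \<Rightarrow> 'a \<Rightarrow> 'a \<Rightarrow> real" where
  "defect h q v = \<bar>energy (next_q h q v, next_v h q v) - energy (q, v)\<bar>"

text \<open>The relative fluctuation of |v|^2 about its mean d. It enters through |v| <= sqrt d (1 +
  spread / 2).\<close>

definition spread :: "'a \<Rightarrow> real" where
  "spread v = \<bar>(norm v)\<^sup>2 / real DIM('a) - 1\<bar>"

definition step_diff :: "real \<Rightarrow> 'a \<Rightarrow> 'a \<Rightarrow> real" where
  "step_diff h q v = L * norm (v - next_v h q v) + LH * norm (q - next_q h q v) * norm v"

text \<open>What remains of the derivative bound once the difference of the densities, weighted with
  L sqrt d, has been split off. The first summand pairs the relative difference of the densities
  with the excess of |v| over sqrt d; the second measures how much velocity and Hessian change in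
  one step.\<close>

definition mid_asym_bound :: "real \<Rightarrow> 'a \<Rightarrow> 'a \<Rightarrow> real" where
  "mid_asym_bound h q v = L * sqrt DIM('a) * defect h q v * spread v + step_diff h q v"

lemma measurable_asym_bound [measurable]:
  "case_prod (mid_asym_bound h) \<in> borel_measurable (borel \<Otimes>\<^sub>M borel)"
  unfolding mid_asym_bound_def defect_def spread_def step_diff_def energy_def by measurable

lemma mid_asym_bound_nonneg: "0 \<le> mid_asym_bound h q v"
  unfolding mid_asym_bound_def defect_def spread_def step_diff_def
  using L_nonneg LH_nonneg by (intro add_nonneg_nonneg mult_nonneg_nonneg) auto

text \<open>The compensating factor is even in w and cancels, so the logarithm of the ratio is the
  energy error of one step.\<close>

lemma mid_dens_ratio:
  "mid_dens h m w = mid_dens h m (- w) * exp (energy (mid_q h m (- w), - mid_v h m (- w)) - energy (mid_q h m w, mid_v h m w))"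
  unfolding mid_dens_def energy_def by (simp add: exp_add[symmetric] exp_diff field_simps)

text \<open>The difference of the two densities is paired with the velocity belonging to the larger
  one, because only that density controls it.\<close>

lemma derivative_bound_aux:
  assumes F: "0 \<le> F'" "F' \<le> F" "F - F' \<le> F * \<delta>" "0 \<le> \<delta>"
  shows "\<bar>F * (v \<bullet> Hs q y) + F' * (u \<bullet> Hs r y)\<bar> \<le>
    (L * sqrt DIM('a) * (F - F') +
     (F * (L * sqrt DIM('a) * \<delta> * spread v + (L * norm (v + u) + LH * norm (q - r) * norm v)) +
      F' * (L * norm (u + v) + LH * norm (r - q) * norm u)) / 2) * norm y"
proof -
  let ?D = "sqrt DIM('a)"
  have D: "0 < ?D" by simp
  \<comment> \<open>From (|v| - sqrt d)^2 >= 0.\<close>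
  have v: "norm v \<le> ?D * (1 + spread v / 2)"
  proof -
    have "0 \<le> (norm v - ?D)\<^sup>2" by simp
    then have "2 * ?D * norm v \<le> (norm v)\<^sup>2 + ?D\<^sup>2" by (simp add: power2_diff algebra_simps)
    also have "(norm v)\<^sup>2 + ?D\<^sup>2 = ?D\<^sup>2 * ((norm v)\<^sup>2 / real DIM('a) - 1 + 2)" by (simp add: distrib_left right_diff_distrib)
    also have "\<dots> \<le> ?D\<^sup>2 * (spread v + 2)" by (intro mult_left_mono) (auto simp: spread_def)
    finally have "(2 * ?D) * norm v \<le> (2 * ?D) * (?D * (1 + spread v / 2))" by (simp add: power2_eq_square algebra_simps)
    then show ?thesis using D by (simp only: mult_le_cancel_left_pos)
  qed
  have in1: "\<bar>v \<bullet> Hs q y\<bar> \<le> L * norm v * norm y"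
    using Cauchy_Schwarz_ineq2[of v "Hs q y"] mult_left_mono[OF Hs_bound[of q y], of "norm v"] by (simp add: mult_ac)
  have cross: "\<bar>v \<bullet> Hs q y + u \<bullet> Hs r y\<bar> \<le> (L * norm (v + u) + LH * norm (q - r) * norm v) * norm y"
    for v u q r
  proof -
    have "v \<bullet> Hs q y + u \<bullet> Hs r y = (v + u) \<bullet> Hs r y + v \<bullet> (Hs q y - Hs r y)" by (simp add: inner_simps)
    moreover have "\<bar>(v + u) \<bullet> Hs r y\<bar> \<le> L * norm (v + u) * norm y"
      using Cauchy_Schwarz_ineq2[of "v + u" "Hs r y"] mult_left_mono[OF Hs_bound[of r y], of "norm (v + u)"] by (simp add: mult_ac)
    moreover have "\<bar>v \<bullet> (Hs q y - Hs r y)\<bar> \<le> LH * norm (q - r) * norm v * norm y"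
      using Cauchy_Schwarz_ineq2[of v "Hs q y - Hs r y"] mult_left_mono[OF Hs_lipschitz[of q y r], of "norm v"] by (simp add: mult_ac)
    ultimately show ?thesis unfolding distrib_right by linarith
  qed
  define c1 where "c1 = (L * norm (v + u) + LH * norm (q - r) * norm v) * norm y"
  define c2 where "c2 = (L * norm (u + v) + LH * norm (r - q) * norm u) * norm y"
  have c: "0 \<le> c1" "0 \<le> c2" unfolding c1_def c2_def using L_nonneg LH_nonneg by auto
  have s0: "0 \<le> spread v" by (simp add: spread_def)
  \<comment> \<open>The excess F - F' of the larger density keeps v alone. The common part F'
    multiplies the whole sum, which is small because u is close to - v in the application.\<close>
  have "F * (v \<bullet> Hs q y) + F' * (u \<bullet> Hs r y) = (F - F') * (v \<bullet> Hs q y) + F' * (v \<bullet> Hs q y + u \<bullet> Hs r y)"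
    by (simp add: algebra_simps)
  also have "\<bar>\<dots>\<bar> \<le> (F - F') * \<bar>v \<bullet> Hs q y\<bar> + F' * \<bar>v \<bullet> Hs q y + u \<bullet> Hs r y\<bar>"
    using F by (intro order_trans[OF abs_triangle_ineq]) (simp add: abs_mult)
  also have "\<dots> \<le> (F - F') * (L * norm v * norm y) + (F * c1 + F' * c2) / 2"
  proof (rule add_mono)
    show "(F - F') * \<bar>v \<bullet> Hs q y\<bar> \<le> (F - F') * (L * norm v * norm y)"
      using F in1 by (intro mult_left_mono) auto
    \<comment> \<open>Two estimates of the same quantity, one charged to F and one to F'. Their
      average gives each density half the weight, so that the two coordinate transforms later add up
      to a single integral.\<close>
    have "F' * \<bar>v \<bullet> Hs q y + u \<bullet> Hs r y\<bar> \<le> F' * c1" using F cross[of v q u r] by (intro mult_left_mono) (auto simp: c1_def)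
    also have "\<dots> \<le> F * c1" using F c by (intro mult_right_mono) auto
    finally have 1: "F' * \<bar>v \<bullet> Hs q y + u \<bullet> Hs r y\<bar> \<le> F * c1" .
    have 2: "F' * \<bar>v \<bullet> Hs q y + u \<bullet> Hs r y\<bar> \<le> F' * c2"
      using F cross[of u r v q] by (intro mult_left_mono) (auto simp: c2_def add.commute)
    show "F' * \<bar>v \<bullet> Hs q y + u \<bullet> Hs r y\<bar> \<le> (F * c1 + F' * c2) / 2"
      using add_mono[OF 1 2] by (simp add: field_simps)
  qed
  also have "(F - F') * (L * norm v * norm y) \<le> (F - F') * (L * (?D * (1 + spread v / 2)) * norm y)"
    using F v L_nonneg by (intro mult_left_mono mult_right_mono) auto
  also have "\<dots> = L * ?D * (F - F') * norm y + (F - F') * (L * ?D * (spread v / 2) * norm y)"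
    by (simp add: algebra_simps)
  also have "(F - F') * (L * ?D * (spread v / 2) * norm y) \<le> (F * \<delta>) * (L * ?D * (spread v / 2) * norm y)"
    using F L_nonneg s0 by (intro mult_right_mono) auto
  finally show ?thesis unfolding c1_def c2_def by (simp add: field_simps)
qed

text \<open>The exponent has derivative w . y + (h / 2) G . y - v . y + (h^2 / 4) v . Hs y, and v =
  w + (h / 2) G makes the first three terms cancel exactly. The factor h^2 / 4 is thus no
  approximation.\<close>

lemma mid_dens_derivative:
  "(mid_dens h m has_derivative (\<lambda>y. h\<^sup>2 / 4 * (mid_dens h m w * (mid_v h m w \<bullet> Hs (mid_q h m w) y)))) (at w)"
proof -
  let ?q = "mid_q h m w" and ?v = "mid_v h m w"
  have dq: "(mid_q h m has_derivative (\<lambda>y. - (h / 2) *\<^sub>R y)) (at w)"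
    unfolding mid_q_def by (auto intro!: derivative_eq_intros)
  have dv: "(mid_v h m has_derivative (\<lambda>y. y + (h / 2) *\<^sub>R Hs ?q (- (h / 2) *\<^sub>R y))) (at w)"
    unfolding mid_v_def
    by (intro has_derivative_add has_derivative_ident has_derivative_scaleR_right has_derivative_compose[OF dq G_der])
  have dU: "((\<lambda>w. U (mid_q h m w)) has_derivative (\<lambda>y. G ?q \<bullet> (- (h / 2) *\<^sub>R y))) (at w)"
    by (rule has_derivative_compose[OF dq U_der])
  define X where "X = (\<lambda>w. (w \<bullet> w) / 2 - U (mid_q h m w) - (mid_v h m w \<bullet> mid_v h m w) / 2)"
  have "(X has_derivative (\<lambda>y. (w \<bullet> y + y \<bullet> w) / 2 - G ?q \<bullet> (- (h / 2) *\<^sub>R y) -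
      (?v \<bullet> (y + (h / 2) *\<^sub>R Hs ?q (- (h / 2) *\<^sub>R y)) + (y + (h / 2) *\<^sub>R Hs ?q (- (h / 2) *\<^sub>R y)) \<bullet> ?v) / 2)) (at w)"
    unfolding X_def
    by (intro has_derivative_diff bounded_linear.has_derivative[OF bounded_linear_divide] has_derivative_inner has_derivative_ident dU dv) 
  moreover have "(w \<bullet> y + y \<bullet> w) / 2 - G ?q \<bullet> (- (h / 2) *\<^sub>R y) -
      (?v \<bullet> (y + (h / 2) *\<^sub>R Hs ?q (- (h / 2) *\<^sub>R y)) + (y + (h / 2) *\<^sub>R Hs ?q (- (h / 2) *\<^sub>R y)) \<bullet> ?v) / 2 =
      h\<^sup>2 / 4 * (?v \<bullet> Hs ?q y)" for y
  proof -
    have v: "?v \<bullet> y = w \<bullet> y + (h / 2) * (G ?q \<bullet> y)" by (simp add: mid_v_def inner_simps)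
    have "(h / 2) *\<^sub>R Hs ?q (- (h / 2) *\<^sub>R y) = - (h\<^sup>2 / 4) *\<^sub>R Hs ?q y"
      by (simp add: linear_scale[OF Hs_linear] linear_neg[OF Hs_linear] power2_eq_square)
    then show ?thesis
      by (simp only: inner_simps inner_commute[of y] inner_commute[of "Hs ?q y"] v) (simp add: field_simps)
  qed
  ultimately have dX: "(X has_derivative (\<lambda>y. h\<^sup>2 / 4 * (?v \<bullet> Hs ?q y))) (at w)" by (simp only:)
  have "((\<lambda>w. exp (X w) / Z) has_derivative (\<lambda>y. (exp (X w) * (h\<^sup>2 / 4 * (?v \<bullet> Hs ?q y))) / Z)) (at w)"
    by (intro bounded_linear.has_derivative[OF bounded_linear_divide]
        has_derivative_compose[OF dX DERIV_exp[unfolded has_field_derivative_def]])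
  moreover have "mid_dens h m = (\<lambda>w. exp (X w) / Z)"
    by (auto simp: mid_dens_def X_def power2_norm_eq_inner)
  ultimately show ?thesis by (simp add: mult_ac)
qed

text \<open>For each midpoint m the bound for odd functions is applied in w. The resulting majorant
  \<open>K\<close> is integrated by the midpoint transform and its reflection; the difference of the
  densities inside \<open>K\<close> reproduces \<open>mid_asym\<close> itself.\<close>

lemma mid_asym_inequality:
  "mid_asym h \<le> ennreal (pi / 2 * (h\<^sup>2 / 4)) *
    (ennreal (L * sqrt DIM('a)) * mid_asym h + (\<integral>\<^sup>+ q. (\<integral>\<^sup>+ v. ennreal (mid_asym_bound h q v) \<partial>std_gaussian) \<partial>gibbs U))"
proof -
  let ?D = "sqrt DIM('a)"
  define f where "f = mid_dens h"
  define q where "q = mid_q h"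
  define v where "v = mid_v h"
  define K where "K = (\<lambda>m w. L * ?D * \<bar>f m w - f m (- w)\<bar> +
     (f m w * mid_asym_bound h (q m w) (v m w) + f m (- w) * mid_asym_bound h (q m (- w)) (v m (- w))) / 2)"
  define \<psi>' where "\<psi>' = (\<lambda>m w y. h\<^sup>2 / 4 * (f m w * (v m w \<bullet> Hs (q m w) y) + f m (- w) * (v m (- w) \<bullet> Hs (q m (- w)) y)))"
  have f0: "0 < f m w" for m w by (simp add: f_def mid_dens_pos)
  have K0: "0 \<le> K m w" for m w
    unfolding K_def using f0[of m w] f0[of m "- w"] mid_asym_bound_nonneg L_nonneg
    by (intro add_nonneg_nonneg divide_nonneg_nonneg mult_nonneg_nonneg) auto
  have [measurable]: "case_prod f \<in> borel_measurable (borel \<Otimes>\<^sub>M borel)" "case_prod q \<in> borel_measurable (borel \<Otimes>\<^sub>M borel)"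
    "case_prod v \<in> borel_measurable (borel \<Otimes>\<^sub>M borel)"
    unfolding f_def q_def v_def by measurable
  have bound: "\<bar>f m w * (v m w \<bullet> Hs (q m w) y) + f m (- w) * (v m (- w) \<bullet> Hs (q m (- w)) y)\<bar> \<le> K m w * norm y" for m w y
  proof -
    have one: "\<bar>f m w * (v m w \<bullet> Hs (q m w) y) + f m (- w) * (v m (- w) \<bullet> Hs (q m (- w)) y)\<bar> \<le> K m w * norm y"
      if le: "f m (- w) \<le> f m w" for w
    proof -
      define e where "e = energy (q m (- w), - v m (- w)) - energy (q m w, v m w)"
      have d: "defect h (q m w) (v m w) = \<bar>e\<bar>"
        unfolding defect_def e_def q_def v_def next_mid by simp
      have r: "f m w = f m (- w) * exp e" unfolding f_def e_def q_def v_def by (rule mid_dens_ratio)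
      \<comment> \<open>Since 1 - exp (- e) <= |e|, the relative excess of the larger density is at
        most the energy error.\<close>
      have "f m w - f m (- w) = f m w * (1 - exp (- e))" using r by (simp add: exp_minus field_simps)
      also have "\<dots> \<le> f m w * \<bar>e\<bar>"
        using f0[of m w] exp_ge_add_one_self[of "- e"] by (intro mult_left_mono) linarith+
      finally have fe: "f m w - f m (- w) \<le> f m w * defect h (q m w) (v m w)" unfolding d .
      have sd: "step_diff h (q m w) (v m w) = L * norm (v m w + v m (- w)) + LH * norm (q m w - q m (- w)) * norm (v m w)"
        for w unfolding step_diff_def q_def v_def next_mid by simp
      have dd: "0 \<le> L * ?D * defect h a b * spread b" for a b
        using L_nonneg by (simp add: defect_def spread_def)
      have "\<bar>f m w * (v m w \<bullet> Hs (q m w) y) + f m (- w) * (v m (- w) \<bullet> Hs (q m (- w)) y)\<bar> \<le>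
       (L * ?D * (f m w - f m (- w)) +
         (f m w * mid_asym_bound h (q m w) (v m w) + f m (- w) * step_diff h (q m (- w)) (v m (- w))) / 2) * norm y"
        using derivative_bound_aux[OF less_imp_le[OF f0] le fe, of "v m w" "q m w" y "v m (- w)" "q m (- w)"]
        unfolding mid_asym_bound_def sd[of w] sd[of "- w"] by (simp add: defect_def)
      also have "\<dots> \<le> K m w * norm y"
      proof -
        have ab: "\<bar>f m w - f m (- w)\<bar> = f m w - f m (- w)" using le by simp
        have "f m (- w) * step_diff h (q m (- w)) (v m (- w)) \<le> f m (- w) * mid_asym_bound h (q m (- w)) (v m (- w))"
          using f0[of m "- w"] dd by (intro mult_left_mono) (auto simp: mid_asym_bound_def)
        then show ?thesis unfolding K_def ab by (intro mult_right_mono add_left_mono divide_right_mono) auto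
      qed
      finally show ?thesis .
    qed
    show ?thesis
    proof (cases "f m (- w) \<le> f m w")
      case True then show ?thesis by (rule one)
    next
      \<comment> \<open>\<open>K\<close> is even in w, so the other case follows by exchanging w and
        - w.\<close>
      case False
      then have "f m (- (- w)) \<le> f m (- w)" by simp
      from one[OF this] have "\<bar>f m (- w) * (v m (- w) \<bullet> Hs (q m (- w)) y) + f m w * (v m w \<bullet> Hs (q m w) y)\<bar> \<le> K m (- w) * norm y" by simp
      moreover have "K m (- w) = K m w" by (simp add: K_def abs_minus_commute add.commute)
      ultimately show ?thesis by (simp add: add.commute)
    qed
  qed
  have inner: "(\<integral>\<^sup>+ w. ennreal \<bar>f m w - f m (- w)\<bar> \<partial>std_gaussian) \<le>
     ennreal (pi / 2) * (\<integral>\<^sup>+ w. ennreal (h\<^sup>2 / 4 * K m w) \<partial>std_gaussian)" for m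
  proof -
    have df: "(f m has_derivative (\<lambda>y. h\<^sup>2 / 4 * (f m w * (v m w \<bullet> Hs (q m w) y)))) (at w)" for w
      unfolding f_def v_def q_def by (rule mid_dens_derivative)
    have dneg: "((\<lambda>w. - w) has_derivative (\<lambda>y. - y)) (at w)" for w :: 'a
      by (auto intro!: derivative_eq_intros)
    have der: "((\<lambda>w. f m w - f m (- w)) has_derivative \<psi>' m w) (at w)" for w
    proof -
      have "((\<lambda>w. f m w - f m (- w)) has_derivative (\<lambda>y. h\<^sup>2 / 4 * (f m w * (v m w \<bullet> Hs (q m w) y)) -
         h\<^sup>2 / 4 * (f m (- w) * (v m (- w) \<bullet> Hs (q m (- w)) (- y))))) (at w)"
        by (intro has_derivative_diff df has_derivative_compose[OF dneg df])
      then show ?thesis unfolding \<psi>'_def by (simp add: linear_neg[OF Hs_linear] distrib_left)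
    qed
    have cq: "continuous_on UNIV (\<lambda>p. q m (g p))" if "continuous_on UNIV g" for g :: "'a \<times> 'a \<Rightarrow> 'a"
      unfolding q_def mid_q_def by (intro continuous_intros that)
    have cv: "continuous_on UNIV (\<lambda>p. v m (g p))" if "continuous_on UNIV g" for g :: "'a \<times> 'a \<Rightarrow> 'a"
      unfolding v_def mid_v_def
      by (intro continuous_intros that continuous_on_compose2[OF continuous_G cq[OF that, unfolded q_def]]) auto
    have cf: "continuous_on UNIV (\<lambda>p. f m (g p))" if "continuous_on UNIV g" for g :: "'a \<times> 'a \<Rightarrow> 'a"
      unfolding f_def mid_dens_def
      by (intro continuous_intros that cv[OF that, unfolded v_def] continuous_on_compose2[OF continuous_U cq[OF that, unfolded q_def]])
         (use Z_pos in auto)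
    have cont: "continuous_on UNIV (\<lambda>p. \<psi>' m (fst p) (snd p))"
      unfolding \<psi>'_def by (intro continuous_intros cf cv continuous_Hs cq)
    have "(\<integral>\<^sup>+ w. ennreal \<bar>f m w - f m (- w)\<bar> \<partial>std_gaussian) \<le>
        ennreal (pi / 2) * (\<integral>\<^sup>+ w. (\<integral>\<^sup>+ y. ennreal \<bar>\<psi>' m w y\<bar> \<partial>std_gaussian) \<partial>std_gaussian)"
      by (rule nn_integral_odd_le_derivative[OF der cont]) simp
    \<comment> \<open>The Gaussian mean of a linear form is at most its norm, so averaging over y
      costs no dimension factor.\<close>
    also have "\<dots> \<le> ennreal (pi / 2) * (\<integral>\<^sup>+ w. ennreal (h\<^sup>2 / 4 * K m w) \<partial>std_gaussian)"
    proof (intro mult_left_mono nn_integral_mono nn_integral_std_gaussian_linear_le)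
      show "linear (\<psi>' m w)" for w using der by (rule has_derivative_linear)
      fix w y
      show "\<bar>\<psi>' m w y\<bar> \<le> h\<^sup>2 / 4 * K m w * norm y"
        unfolding \<psi>'_def using mult_left_mono[OF bound[of m w y], of "h\<^sup>2 / 4"] by (simp add: abs_mult mult.assoc)
    qed simp
    finally show ?thesis .
  qed
  define I where "I = (\<integral>\<^sup>+ q. (\<integral>\<^sup>+ v. ennreal (mid_asym_bound h q v) \<partial>std_gaussian) \<partial>gibbs U)"
  have [measurable]: "case_prod K \<in> borel_measurable (borel \<Otimes>\<^sub>M borel)" unfolding K_def by measurable
  have K: "(\<integral>\<^sup>+ m. (\<integral>\<^sup>+ w. ennreal (K m w) \<partial>std_gaussian) \<partial>lborel) = ennreal (L * ?D) * mid_asym h + I"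
  proof -
    have "ennreal (K m w) = ennreal (L * ?D) * ennreal \<bar>f m w - f m (- w)\<bar> +
       (ennreal (1/2) * (ennreal (f m w) * ennreal (mid_asym_bound h (q m w) (v m w))) +
        ennreal (1/2) * (ennreal (f m (- w)) * ennreal (mid_asym_bound h (q m (- w)) (v m (- w)))))" for m w
      unfolding K_def using f0[of m w] f0[of m "- w"] mid_asym_bound_nonneg L_nonneg
      by (simp add: ennreal_mult[symmetric] ennreal_plus[symmetric] add_divide_distrib less_imp_le del: ennreal_plus ennreal_half)
    then have "(\<integral>\<^sup>+ m. (\<integral>\<^sup>+ w. ennreal (K m w) \<partial>std_gaussian) \<partial>lborel) =
      ennreal (L * ?D) * (\<integral>\<^sup>+ m. (\<integral>\<^sup>+ w. ennreal \<bar>f m w - f m (- w)\<bar> \<partial>std_gaussian) \<partial>lborel) +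
      (ennreal (1/2) * (\<integral>\<^sup>+ m. (\<integral>\<^sup>+ w. ennreal (f m w) * ennreal (mid_asym_bound h (q m w) (v m w)) \<partial>std_gaussian) \<partial>lborel) +
       ennreal (1/2) * (\<integral>\<^sup>+ m. (\<integral>\<^sup>+ w. ennreal (f m (- w)) * ennreal (mid_asym_bound h (q m (- w)) (v m (- w))) \<partial>std_gaussian) \<partial>lborel))"
      by (simp add: nn_integral_add nn_integral_cmult del: ennreal_half)
    also have "\<dots> = ennreal (L * ?D) * mid_asym h + (ennreal (1/2) * I + ennreal (1/2) * I)"
      unfolding mid_asym_def I_def f_def q_def v_def
      using midpoint_transform[of "\<lambda>q v. ennreal (mid_asym_bound h q v)" h] midpoint_transform_neg[of "\<lambda>q v. ennreal (mid_asym_bound h q v)" h]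
      by simp
    also have "ennreal (1/2) * I + ennreal (1/2) * I = (ennreal (1/2) + ennreal (1/2)) * I"
      by (rule distrib_right[symmetric])
    also have "ennreal (1/2) + ennreal (1/2) = ennreal (1/2 + 1/2)"
      by (rule ennreal_plus[symmetric]) auto
    also have "ennreal (1/2 + 1/2) * I = I" by simp
    finally show ?thesis .
  qed
  have "mid_asym h \<le> (\<integral>\<^sup>+ m. ennreal (pi / 2) * (\<integral>\<^sup>+ w. ennreal (h\<^sup>2 / 4 * K m w) \<partial>std_gaussian) \<partial>lborel)"
    unfolding mid_asym_def f_def[symmetric] by (intro nn_integral_mono inner)
  also have "\<dots> = ennreal (pi / 2) * (ennreal (h\<^sup>2 / 4) * (\<integral>\<^sup>+ m. (\<integral>\<^sup>+ w. ennreal (K m w) \<partial>std_gaussian) \<partial>lborel))"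
  proof -
    have "ennreal (h\<^sup>2 / 4 * K m w) = ennreal (h\<^sup>2 / 4) * ennreal (K m w)" for m w
      using K0 by (intro ennreal_mult) auto
    then show ?thesis by (simp add: nn_integral_cmult)
  qed
  also have "\<dots> = ennreal (pi / 2 * (h\<^sup>2 / 4)) * (ennreal (L * ?D) * mid_asym h + I)"
  proof -
    have "ennreal (pi / 2 * (h\<^sup>2 / 4)) = ennreal (pi / 2) * ennreal (h\<^sup>2 / 4)" by (rule ennreal_mult) auto
    then show ?thesis unfolding K by (simp only: mult.assoc)
  qed
  finally show ?thesis by (simp add: I_def)
qed

end

section \<open>Numerical size of the asymmetry\<close>

lemma two_power_le: "(x + y) ^ Suc k \<le> 2 ^ k * (x ^ Suc k + y ^ Suc k)" if "0 \<le> x" "0 \<le> (y::real)"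
  using power_sum_le[of "UNIV :: bool set" "\<lambda>b. if b then x else y" k] that
  by (simp add: UNIV_bool add.commute)

text \<open>The scales are a, b, e of order D = sqrt d and x of order 1 / D. The weights in Young's
  inequality respect them, so every term is of order d; e^6 / (16 D^4) and 16 D^4 x^2 even have
  moment bounds of similar size, about 30 d and 32 d.\<close>

lemma spread_cubic_bound:
  fixes a b x D :: real
  assumes "0 \<le> a" "0 \<le> b" "0 \<le> x" "0 < D" and e_def: "e = a + 3/20 * b"
  shows "x * e ^ 3 / 8 + e * a \<le>
    (2 * a ^ 6 / D ^ 4 + b ^ 6 / (16000 * D ^ 4) + 16 * D ^ 4 * x\<^sup>2) / 16 + 43/40 * a\<^sup>2 + 3/40 * b\<^sup>2"
proof -
  have e6: "e ^ 6 \<le> 32 * a ^ 6 + b ^ 6 / 1000"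
  proof -
    have pw: "(3/20 * b) ^ 6 = 729/64000000 * b ^ 6" by (simp add: power_mult_distrib power_divide)
    have "e ^ 6 \<le> 32 * (a ^ 6 + (3/20 * b) ^ 6)"
      using two_power_le[of a "3/20 * b" 5] assms by (simp add: e_def)
    also have "\<dots> = 32 * a ^ 6 + (32 * 729/64000000) * b ^ 6" unfolding pw by simp
    also have "\<dots> \<le> 32 * a ^ 6 + 1/1000 * b ^ 6" using assms by (intro add_left_mono mult_right_mono) auto
    finally show ?thesis by simp
  qed
  have "0 \<le> (e ^ 3 / (4 * D\<^sup>2) - 4 * D\<^sup>2 * x)\<^sup>2" by simp
  also have "\<dots> = (e ^ 3 / (4 * D\<^sup>2))\<^sup>2 + (4 * D\<^sup>2 * x)\<^sup>2 - 2 * (x * e ^ 3)"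
    using assms by (simp add: power2_diff)
  also have "(e ^ 3 / (4 * D\<^sup>2))\<^sup>2 = e ^ 6 / (16 * D ^ 4)" by (simp add: power_divide power_mult_distrib flip: power_mult)
  also have "(4 * D\<^sup>2 * x)\<^sup>2 = 16 * D ^ 4 * x\<^sup>2" by (simp add: power_mult_distrib flip: power_mult)
  finally have 0: "2 * (x * e ^ 3) \<le> e ^ 6 / (16 * D ^ 4) + 16 * D ^ 4 * x\<^sup>2" by linarith
  have "e ^ 6 / (16 * D ^ 4) \<le> (32 * a ^ 6 + b ^ 6 / 1000) / (16 * D ^ 4)"
    using e6 assms by (intro divide_right_mono) auto
  also have "\<dots> = 2 * a ^ 6 / D ^ 4 + b ^ 6 / (16000 * D ^ 4)" by (simp add: add_divide_distrib)
  finally have "e ^ 6 / (16 * D ^ 4) \<le> 2 * a ^ 6 / D ^ 4 + b ^ 6 / (16000 * D ^ 4)" .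
  moreover have "p \<le> (r + t) / 2" if "2 * p \<le> s + t" "s \<le> r" for p r s t :: real using that by simp
  ultimately have 1: "x * e ^ 3 \<le> (2 * a ^ 6 / D ^ 4 + b ^ 6 / (16000 * D ^ 4) + 16 * D ^ 4 * x\<^sup>2) / 2" using 0 by blast
  have "0 \<le> (a - b)\<^sup>2" by simp
  then have 2: "a * b \<le> (a\<^sup>2 + b\<^sup>2) / 2" by (simp add: power2_diff)
  have "e * a = a\<^sup>2 + 3/20 * (a * b)" by (simp add: e_def power2_eq_square algebra_simps)
  moreover have "p / 8 + r \<le> s / 16 + 43/40 * A + 3/40 * B"
    if "p \<le> s / 2" "c \<le> (A + B) / 2" "r = A + 3/20 * c" for p r s c A B :: real using that by argo
  ultimately show ?thesis using 1 2 by blast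
qed

text \<open>The same scaling, now with all terms of order D: y is of order D^2, and the weight 4 D^3
  matches y^2 with x^2.\<close>

lemma spread_quadratic_bound:
  fixes a b x D :: real
  assumes "0 \<le> a" "0 \<le> b" "0 \<le> x" "0 < D" and e_def: "e = a + 3/20 * b"
  shows "x * (e * (2 * b + 3/10 * e)) / 32 + (2 * b + 3/10 * e) / 2 \<le>
    ((16 * a\<^sup>2 * b\<^sup>2 + 37/100 * b ^ 4 + 144/100 * a ^ 4) / (4 * D ^ 3) + 4 * D ^ 3 * x\<^sup>2) / 64 +
     103/100 * (5/17 * b\<^sup>2 / D + 17/20 * D) + 3/20 * (a\<^sup>2 / (2 * D) + D / 2)"
proof -
  define y where "y = e * (2 * b + 3/10 * e)"
  have e2: "e\<^sup>2 \<le> 2 * a\<^sup>2 + 9/200 * b\<^sup>2"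
    using two_power_le[of a "3/20 * b" 1] assms by (simp add: e_def power2_eq_square field_simps)
  have e4: "e ^ 4 \<le> 8 * a ^ 4 + 1/200 * b ^ 4"
  proof -
    have pw: "(3/20 * b) ^ 4 = 81/160000 * b ^ 4" by (simp add: power_mult_distrib power_divide)
    have "e ^ 4 \<le> 8 * (a ^ 4 + (3/20 * b) ^ 4)"
      using two_power_le[of a "3/20 * b" 3] assms by (simp add: e_def)
    also have "\<dots> = 8 * a ^ 4 + (8 * 81/160000) * b ^ 4" unfolding pw by simp
    also have "\<dots> \<le> 8 * a ^ 4 + 1/200 * b ^ 4" using assms by (intro add_left_mono mult_right_mono) auto
    finally show ?thesis .
  qed
  have "y\<^sup>2 = e\<^sup>2 * (2 * b + 3/10 * e)\<^sup>2" by (simp add: y_def power_mult_distrib)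
  also have "\<dots> \<le> e\<^sup>2 * (2 * ((2 * b)\<^sup>2 + (3/10 * e)\<^sup>2))"
    using two_power_le[of "2 * b" "3/10 * e" 1] assms
    by (intro mult_left_mono) (auto simp: e_def numeral_2_eq_2)
  also have "\<dots> = 8 * (e\<^sup>2 * b\<^sup>2) + 18/100 * e ^ 4"
    by (simp add: power_mult_distrib power_divide algebra_simps)
  also have "\<dots> \<le> 8 * ((2 * a\<^sup>2 + 9/200 * b\<^sup>2) * b\<^sup>2) + 18/100 * (8 * a ^ 4 + 1/200 * b ^ 4)"
    by (intro add_mono mult_left_mono mult_right_mono e2 e4) auto
  also have "\<dots> = 16 * a\<^sup>2 * b\<^sup>2 + (9/25 + 18/20000) * b ^ 4 + 144/100 * a ^ 4"
    by (simp add: algebra_simps)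
  also have "\<dots> \<le> 16 * a\<^sup>2 * b\<^sup>2 + 37/100 * b ^ 4 + 144/100 * a ^ 4"
    using assms by (intro add_right_mono add_left_mono mult_right_mono) auto
  finally have y2: "y\<^sup>2 \<le> 16 * a\<^sup>2 * b\<^sup>2 + 37/100 * b ^ 4 + 144/100 * a ^ 4" .
  define A where "A = 16 * a\<^sup>2 * b\<^sup>2 + 37/100 * b ^ 4 + 144/100 * a ^ 4"
  have "0 \<le> (y - 4 * D ^ 3 * x)\<^sup>2" by simp
  then have "8 * D ^ 3 * (x * y) \<le> y\<^sup>2 + 16 * (D ^ 3)\<^sup>2 * x\<^sup>2"
    by (simp add: power2_diff power_mult_distrib algebra_simps)
  also have "\<dots> \<le> A + 16 * (D ^ 3)\<^sup>2 * x\<^sup>2" using y2 by (simp add: A_def)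
  finally have "x * y \<le> (A + 16 * (D ^ 3)\<^sup>2 * x\<^sup>2) / (8 * D ^ 3)"
    using assms by (simp add: pos_le_divide_eq mult.commute)
  also have "\<dots> = (A / (4 * D ^ 3) + 4 * D ^ 3 * x\<^sup>2) / 2"
  proof -
    have "16 * (D ^ 3)\<^sup>2 * x\<^sup>2 / (8 * D ^ 3) = 2 * D ^ 3 * x\<^sup>2"
      using assms by (subst nonzero_divide_eq_eq) (auto simp: power2_eq_square)
    then show ?thesis by (simp only: add_divide_distrib) simp
  qed
  finally have "x * y / 32 \<le> (A / (4 * D ^ 3) + 4 * D ^ 3 * x\<^sup>2) / 2 / 32" by (rule divide_right_mono) simp
  then have 1: "x * y / 32 \<le> (A / (4 * D ^ 3) + 4 * D ^ 3 * x\<^sup>2) / 64" by simp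
  \<comment> \<open>Tangent at b = 1.7 D, because the mean of b^2 will be bounded by 3 d and sqrt 3
    is about 1.73.\<close>
  have 2: "b \<le> 5/17 * b\<^sup>2 / D + 17/20 * D"
  proof -
    have "0 \<le> (b - 17/10 * D)\<^sup>2" by simp
    then have "17/5 * D * b \<le> b\<^sup>2 + 289/100 * D\<^sup>2" by (simp add: power2_diff power_mult_distrib power_divide algebra_simps)
    then show ?thesis using assms by (simp add: field_simps power2_eq_square)
  qed
  have 3: "a \<le> a\<^sup>2 / (2 * D) + D / 2"
  proof -
    have "0 \<le> (a - D)\<^sup>2" by simp
    then have "2 * D * a \<le> a\<^sup>2 + D\<^sup>2" by (simp add: power2_diff algebra_simps)
    then show ?thesis using assms by (simp add: field_simps power2_eq_square)
  qed
  have "(2 * b + 3/10 * e) / 2 \<le> 103/100 * b + 3/20 * a" using assms(2) unfolding e_def by argo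
  also have "\<dots> \<le> 103/100 * (5/17 * b\<^sup>2 / D + 17/20 * D) + 3/20 * (a\<^sup>2 / (2 * D) + D / 2)"
    using 2 3 by (intro add_mono mult_left_mono) auto
  finally show ?thesis using 1 unfolding y_def A_def by argo
qed

lemma integrable_std_gaussian_norm6:
  "integrable std_gaussian (\<lambda>x::'a::euclidean_space. norm x ^ 6)"
  "(\<integral>x. norm (x::'a) ^ 6 \<partial>std_gaussian) \<le> 15 * real DIM('a) ^ 3"
proof -
  show i: "integrable std_gaussian (\<lambda>x::'a. norm x ^ 6)"
    using nn_integral_norm6_le[where 'a='a] by (intro integrableI_bounded) (auto intro: le_less_trans)
  then show "(\<integral>x. norm (x::'a) ^ 6 \<partial>std_gaussian) \<le> 15 * real DIM('a) ^ 3"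
    using nn_integral_norm6_le[where 'a='a] by (subst (asm) nn_integral_eq_integral) (auto simp: ennreal_le_iff)
qed

lemma nn_integral_std_gaussian_poly_le:
  assumes k: "0 \<le> k0" "0 \<le> k1" "0 \<le> k2" "0 \<le> k3" "0 \<le> k4"
  shows "(\<integral>\<^sup>+ v. ennreal (k0 + k1 * (norm (v::'a::euclidean_space))\<^sup>2 + k2 * norm v ^ 4 + k3 * norm v ^ 6 +
      k4 * ((norm v)\<^sup>2 - real DIM('a))\<^sup>2) \<partial>std_gaussian) \<le>
    ennreal (k0 + k1 * real DIM('a) + k2 * (3 * real DIM('a) ^ 2) + k3 * (15 * real DIM('a) ^ 3) + k4 * (2 * real DIM('a)))"
proof -
  let ?d = "real DIM('a)" and ?I6 = "\<integral>x. norm (x::'a) ^ 6 \<partial>std_gaussian"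
  have h0: "has_bochner_integral std_gaussian (\<lambda>v::'a. k0) k0"
    using has_bochner_integral_integrable[OF std_gaussian.integrable_const, of k0, where 'a1='a] by (simp add: std_gaussian.prob_space[simplified])
  have h6: "has_bochner_integral std_gaussian (\<lambda>x::'a. norm x ^ 6) ?I6"
    by (rule has_bochner_integral_integrable[OF integrable_std_gaussian_norm6(1)])
  have hb: "has_bochner_integral std_gaussian (\<lambda>v::'a. k0 + k1 * (norm v)\<^sup>2 + k2 * norm v ^ 4 + k3 * norm v ^ 6 +
      k4 * ((norm v)\<^sup>2 - ?d)\<^sup>2) (k0 + k1 * ?d + k2 * (?d\<^sup>2 + 2 * ?d) + k3 * ?I6 + k4 * (2 * ?d))"
    by (intro has_bochner_integral_add has_bochner_integral_mult_right h0 h6 integral_std_gaussian_norm2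
        integral_std_gaussian_norm4 integral_std_gaussian_norm2_variance)
  \<comment> \<open>Used to replace d^2 + 2 d by 3 d^2.\<close>
  have d1: "1 \<le> ?d" using DIM_positive[where 'a='a] by linarith
  have "(\<integral>\<^sup>+ v. ennreal (k0 + k1 * (norm (v::'a))\<^sup>2 + k2 * norm v ^ 4 + k3 * norm v ^ 6 +
      k4 * ((norm v)\<^sup>2 - ?d)\<^sup>2) \<partial>std_gaussian) = ennreal (k0 + k1 * ?d + k2 * (?d\<^sup>2 + 2 * ?d) + k3 * ?I6 + k4 * (2 * ?d))"
    using hb k by (subst nn_integral_eq_integral) (auto simp: has_bochner_integral_iff intro!: AE_I2)
  also have "\<dots> \<le> ennreal (k0 + k1 * ?d + k2 * (3 * ?d ^ 2) + k3 * (15 * ?d ^ 3) + k4 * (2 * ?d))"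
    using k integrable_std_gaussian_norm6(2)[where 'a='a] d1
    by (intro ennreal_leI add_mono mult_left_mono order_refl) (auto simp: power2_eq_square)
  finally show ?thesis .
qed

context gibbs_potential
begin

text \<open>For j = 1, 2, 3 the constant (2j)! (e / (2j))^j is about 2.72, 11.08 and 66.95.\<close>

lemma gradient_moments:
  shows "integrable (gibbs U) (\<lambda>x. (norm (G x))\<^sup>2)" "(\<integral>x. (norm (G x))\<^sup>2 \<partial>gibbs U) \<le> 3 * real DIM('a) * L"
    and "integrable (gibbs U) (\<lambda>x. norm (G x) ^ 4)" "(\<integral>x. norm (G x) ^ 4 \<partial>gibbs U) \<le> 12 * real DIM('a) ^ 2 * L ^ 2"
    and "integrable (gibbs U) (\<lambda>x. norm (G x) ^ 6)" "(\<integral>x. norm (G x) ^ 6 \<partial>gibbs U) \<le> 68 * real DIM('a) ^ 3 * L ^ 3"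
proof -
  have e: "exp 1 \<le> (272/100 :: real)" using e_less_272 by simp
  have 2: "fact (2 * Suc 0) * (exp 1 / (2 * real (Suc 0))) ^ Suc 0 \<le> (3::real)" using e by (simp add: fact_numeral)
  have 4: "fact (2 * Suc 1) * (exp 1 / (2 * real (Suc 1))) ^ Suc 1 \<le> (12::real)"
  proof -
    have "(exp 1 / 4) ^ 2 \<le> (68/100 :: real) ^ 2" using e by (intro power_mono) auto
    then show ?thesis by (simp add: fact_numeral numeral_2_eq_2)
  qed
  have 6: "fact (2 * Suc 2) * (exp 1 / (2 * real (Suc 2))) ^ Suc 2 \<le> (68::real)"
  proof -
    have "(exp 1 / 6) ^ 3 \<le> (272/600 :: real) ^ 3" using e by (intro power_mono) auto
    then have "720 * (exp 1 / 6) ^ 3 \<le> (68 :: real)" by (simp add: power3_eq_cube)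
    then show ?thesis by (simp add: fact_numeral eval_nat_numeral)
  qed
  show "integrable (gibbs U) (\<lambda>x. (norm (G x))\<^sup>2)" "(\<integral>x. (norm (G x))\<^sup>2 \<partial>gibbs U) \<le> 3 * real DIM('a) * L"
    using gradient_moment[OF 2] by (simp_all add: numeral_2_eq_2)
  show "integrable (gibbs U) (\<lambda>x. norm (G x) ^ 4)" "(\<integral>x. norm (G x) ^ 4 \<partial>gibbs U) \<le> 12 * real DIM('a) ^ 2 * L ^ 2"
    using gradient_moment[OF 4] by (simp_all add: eval_nat_numeral)
  show "integrable (gibbs U) (\<lambda>x. norm (G x) ^ 6)" "(\<integral>x. norm (G x) ^ 6 \<partial>gibbs U) \<le> 68 * real DIM('a) ^ 3 * L ^ 3"
    using gradient_moment[OF 6] by (simp_all add: eval_nat_numeral)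
qed

text \<open>Dividing the gradient by sqrt L gives a quantity of size sqrt d, comparable with the
  velocity; the bounds lose all dependence on L.\<close>

lemma nn_integral_gradient_poly_le:
  assumes l: "0 \<le> l0" "0 \<le> l1" "0 \<le> l2" "0 \<le> l3"
  defines "b \<equiv> \<lambda>q. norm (G q) / sqrt L"
  shows "(\<integral>\<^sup>+ q. ennreal (l0 + l1 * (b q)\<^sup>2 + l2 * b q ^ 4 + l3 * b q ^ 6) \<partial>gibbs U) \<le>
    ennreal (l0 + l1 * (3 * real DIM('a)) + l2 * (12 * real DIM('a) ^ 2) + l3 * (68 * real DIM('a) ^ 3))"
proof -
  let ?d = "real DIM('a)"
  have s4: "sqrt L ^ 4 = L ^ 2" and s6: "sqrt L ^ 6 = L ^ 3"
  proof -
    have "sqrt L ^ 4 = (sqrt L ^ 2) ^ 2" "sqrt L ^ 6 = (sqrt L ^ 2) ^ 3" by (simp_all flip: power_mult)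
    then show "sqrt L ^ 4 = L ^ 2" "sqrt L ^ 6 = L ^ 3" using L_pos by simp_all
  qed
  have b2: "(b q)\<^sup>2 = (norm (G q))\<^sup>2 / L" and b4: "b q ^ 4 = norm (G q) ^ 4 / L ^ 2" and b6: "b q ^ 6 = norm (G q) ^ 6 / L ^ 3" for q
    using L_pos by (simp_all add: b_def power_divide s4 s6)
  have i: "integrable (gibbs U) (\<lambda>q. l0 + l1 * ((norm (G q))\<^sup>2 / L) + l2 * (norm (G q) ^ 4 / L ^ 2) + l3 * (norm (G q) ^ 6 / L ^ 3))"
    using gradient_moments by auto
  have "(\<integral>\<^sup>+ q. ennreal (l0 + l1 * (b q)\<^sup>2 + l2 * b q ^ 4 + l3 * b q ^ 6) \<partial>gibbs U) =
     ennreal (\<integral>q. l0 + l1 * ((norm (G q))\<^sup>2 / L) + l2 * (norm (G q) ^ 4 / L ^ 2) + l3 * (norm (G q) ^ 6 / L ^ 3) \<partial>gibbs U)"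
    unfolding b2 b4 b6 using l L_pos by (intro nn_integral_eq_integral i AE_I2) auto
  also have "(\<integral>q. l0 + l1 * ((norm (G q))\<^sup>2 / L) + l2 * (norm (G q) ^ 4 / L ^ 2) + l3 * (norm (G q) ^ 6 / L ^ 3) \<partial>gibbs U) =
     l0 + l1 * ((\<integral>q. (norm (G q))\<^sup>2 \<partial>gibbs U) / L) + l2 * ((\<integral>q. norm (G q) ^ 4 \<partial>gibbs U) / L ^ 2) + l3 * ((\<integral>q. norm (G q) ^ 6 \<partial>gibbs U) / L ^ 3)"
    using gradient_moments by (simp add: gibbs.prob_space[simplified])
  also have "ennreal \<dots> \<le> ennreal (l0 + l1 * (3 * ?d) + l2 * (12 * ?d ^ 2) + l3 * (68 * ?d ^ 3))"
    using gradient_moments L_pos l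
    by (intro ennreal_leI add_mono mult_left_mono order_refl) (auto simp: pos_divide_le_eq mult_ac)
  finally show ?thesis .
qed

text \<open>The prefactor h^2 left over from the derivative is used differently in the two summands.
  With the energy error, already of order h^3, it turns L sqrt d into the number 1/4; with the
  change over a step, of order h, it produces h^3.\<close>

lemma mid_asym_bound_le:
  assumes h: "0 < h" and hL: "12 * (h\<^sup>2 * L) \<le> 1" and hd: "4 * (h\<^sup>2 * L * sqrt DIM('a)) \<le> 1"
    and a_def: "a = norm v" and b_def: "b = norm (G q) / sqrt L" and e_def: "e = a + 3/20 * b"
  shows "h\<^sup>2 * mid_asym_bound h q v \<le>
    h ^ 3 * (LH * (spread v * e ^ 3 / 8 + e * a) +
      L * sqrt L * (spread v * (e * (2 * b + 3/10 * e)) / 32 + (2 * b + 3/10 * e) / 2))"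
proof -
  define s where "s = sqrt L"
  have s: "0 < s" "s * s = L" using L_pos by (auto simp: s_def)
  have Gb: "norm (G q) = s * b" using s by (simp add: b_def s_def)
  have ab: "0 \<le> a" "0 \<le> b" using s by (auto simp: a_def b_def s_def)
  then have e0: "0 \<le> e" by (simp add: e_def)
  \<comment> \<open>Because 1/12 <= 9/100. Half of 3/10 is the coefficient 3/20 in \<open>e\<close>,
    which thereby bounds the half-step velocity.\<close>
  have hs: "h * s \<le> 3/10"
  proof (rule power2_le_imp_le)
    have "(h * s)\<^sup>2 = h\<^sup>2 * L" using s by (simp add: power2_eq_square mult_ac)
    then have "(h * s)\<^sup>2 \<le> 1 / 12" using hL by simp
    also have "\<dots> \<le> (3/10)\<^sup>2" by (simp add: power2_eq_square)
    finally show "(h * s)\<^sup>2 \<le> (3/10)\<^sup>2" .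
  qed simp
  define w where "w = norm (half_velocity h q v)"
  have w0: "0 \<le> w" by (simp add: w_def)
  have we: "w \<le> e"
  proof -
    have "w \<le> norm v + norm ((h / 2) *\<^sub>R G q)" unfolding w_def half_velocity_def by (rule norm_triangle_ineq4)
    also have "norm ((h / 2) *\<^sub>R G q) = (h * s) / 2 * b" using h Gb by simp
    also have "\<dots> \<le> (3/10) / 2 * b" using hs ab by (intro mult_right_mono divide_right_mono) auto
    finally show ?thesis by (simp add: e_def a_def)
  qed
  have k: "2 * norm (G q) + L * h * w \<le> s * (2 * b + 3/10 * e)"
  proof -
    have "L * h * w = s * ((h * s) * w)" using s by (simp add: mult_ac flip: s(2))
    also have "\<dots> \<le> s * (3/10 * e)" using s hs we w0 by (intro mult_left_mono mult_mono) auto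
    finally show ?thesis using Gb by (simp add: algebra_simps)
  qed
  have k0: "0 \<le> 2 * norm (G q) + L * h * w" using L_nonneg h w0 by simp
  have def: "defect h q v \<le> h ^ 3 * (LH * e ^ 3 / 2 + L * s / 8 * (e * (2 * b + 3/10 * e)))"
  proof -
    have "defect h q v \<le> LH * (h * w) ^ 3 / 2 + h ^ 3 * L / 8 * w * (2 * norm (G q) + L * h * w)"
      using energy_error[OF h, of q v] unfolding defect_def verlet_step_eq w_def half_velocity_def .
    also have "\<dots> \<le> LH * (h * e) ^ 3 / 2 + h ^ 3 * L / 8 * e * (s * (2 * b + 3/10 * e))"
      using h L_nonneg LH_nonneg we w0 k k0 e0
      by (intro add_mono divide_right_mono mult_left_mono power_mono mult_mono) auto
    also have "\<dots> = h ^ 3 * (LH * e ^ 3 / 2 + L * s / 8 * (e * (2 * b + 3/10 * e)))"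
      by (simp add: power_mult_distrib algebra_simps)
    finally show ?thesis .
  qed
  have sd: "step_diff h q v \<le> h * (L * s * ((2 * b + 3/10 * e) / 2) + LH * (e * a))"
  proof -
    have q': "q - next_q h q v = - h *\<^sub>R half_velocity h q v" by (simp add: next_q_def)
    have nq: "norm (q - next_q h q v) = h * w" unfolding q' w_def using h by simp
    have "v - next_v h q v = (h / 2) *\<^sub>R (G q + G (next_q h q v))"
      by (simp add: next_v_def half_velocity_def algebra_simps)
    then have "norm (v - next_v h q v) = (h / 2) * norm (G q + G (next_q h q v))" using h by simp
    moreover have "norm (G q + G (next_q h q v)) \<le> 2 * norm (G q) + L * h * w"
    proof -
      have "norm (G (next_q h q v) - G q) \<le> L * (h * w)"
        using G_lipschitz[of "next_q h q v" q] nq by (simp add: norm_minus_commute)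
      moreover have "norm (G q + G (next_q h q v)) \<le> norm (2 *\<^sub>R G q) + norm (G (next_q h q v) - G q)"
        using norm_triangle_ineq[of "2 *\<^sub>R G q" "G (next_q h q v) - G q"] by (simp add: scaleR_2)
      ultimately show ?thesis by (simp add: mult.assoc)
    qed
    moreover have "(h / 2) * norm (G q + G (next_q h q v)) \<le> (h / 2) * (s * (2 * b + 3/10 * e))"
      if "norm (G q + G (next_q h q v)) \<le> 2 * norm (G q) + L * h * w"
      using order_trans[OF that k] h by (intro mult_left_mono) auto
    ultimately have "norm (v - next_v h q v) \<le> (h / 2) * (s * (2 * b + 3/10 * e))" by simp
    then have "L * norm (v - next_v h q v) \<le> L * ((h / 2) * (s * (2 * b + 3/10 * e)))"
      using L_nonneg by (rule mult_left_mono)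
    moreover have "LH * norm (q - next_q h q v) * norm v \<le> LH * (h * e) * a"
      unfolding nq a_def using LH_nonneg h we by (intro mult_right_mono mult_left_mono) auto
    ultimately have "step_diff h q v \<le> L * ((h / 2) * (s * (2 * b + 3/10 * e))) + LH * (h * e) * a"
      unfolding step_diff_def by (rule add_mono)
    also have "\<dots> = h * (L * s * ((2 * b + 3/10 * e) / 2) + LH * (e * a))" by (simp add: algebra_simps)
    finally show ?thesis .
  qed
  define P where "P = LH * e ^ 3 / 2 + L * s / 8 * (e * (2 * b + 3/10 * e))"
  define Q where "Q = L * s * ((2 * b + 3/10 * e) / 2) + LH * (e * a)"
  have P0: "0 \<le> P" unfolding P_def using L_nonneg LH_nonneg s e0 ab by (intro add_nonneg_nonneg divide_nonneg_nonneg mult_nonneg_nonneg) auto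
  have x0: "0 \<le> spread v" by (simp add: spread_def)
  have "h\<^sup>2 * mid_asym_bound h q v = (h\<^sup>2 * L * sqrt DIM('a)) * (defect h q v * spread v) + h\<^sup>2 * step_diff h q v"
    unfolding mid_asym_bound_def by (simp add: algebra_simps)
  also have "\<dots> \<le> (1/4) * ((h ^ 3 * P) * spread v) + h\<^sup>2 * (h * Q)"
  proof (rule add_mono)
    have "(h\<^sup>2 * L * sqrt DIM('a)) * (defect h q v * spread v) \<le> (1/4) * (defect h q v * spread v)"
      using hd x0 by (intro mult_right_mono) (auto simp: defect_def)
    also have "\<dots> \<le> (1/4) * ((h ^ 3 * P) * spread v)"
      using def x0 unfolding P_def by (intro mult_left_mono mult_right_mono) auto
    finally show "(h\<^sup>2 * L * sqrt DIM('a)) * (defect h q v * spread v) \<le> (1/4) * ((h ^ 3 * P) * spread v)" .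
    show "h\<^sup>2 * step_diff h q v \<le> h\<^sup>2 * (h * Q)" using sd unfolding Q_def by (intro mult_left_mono) auto
  qed
  also have "\<dots> = h ^ 3 * (P * spread v / 4 + Q)" by (simp add: power2_eq_square power3_eq_cube algebra_simps)
  also have "P * spread v / 4 + Q = LH * (spread v * e ^ 3 / 8 + e * a) +
      L * s * (spread v * (e * (2 * b + 3/10 * e)) / 32 + (2 * b + 3/10 * e) / 2)"
    unfolding P_def Q_def by (simp add: field_simps)
  finally show ?thesis by (simp add: s_def)
qed

text \<open>The pointwise bound is a polynomial in |v|, in the scaled gradient and in the centred
  |v|^2. The coefficients \<open>k0\<close> to \<open>k4\<close> belong to the v-integral at fixed
  q, and \<open>l0\<close> to \<open>l3\<close> to the remaining integral over q.\<close>

lemma mid_asym_bound_integral: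
  assumes h: "0 < h" and hL: "12 * (h\<^sup>2 * L) \<le> 1" and hd: "4 * (h\<^sup>2 * L * sqrt DIM('a)) \<le> 1"
  shows "ennreal (h\<^sup>2) * (\<integral>\<^sup>+ q. (\<integral>\<^sup>+ v. ennreal (mid_asym_bound h q v) \<partial>std_gaussian) \<partial>gibbs U) \<le>
    ennreal (h ^ 3 * (6 * LH * real DIM('a) + 3 * L * sqrt L * sqrt DIM('a)))"
proof -
  define D where "D = sqrt DIM('a)"
  define s where "s = sqrt L"
  define b where "b = (\<lambda>q. norm (G q) / sqrt L)"
  have D: "0 < D" "D\<^sup>2 = real DIM('a)" by (simp_all add: D_def)
  have D4: "D ^ 4 = real DIM('a) ^ 2" and D6: "D ^ 6 = real DIM('a) ^ 3"
    unfolding D(2)[symmetric] by (simp_all flip: power_mult)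
  have s: "0 < s" using L_pos by (simp add: s_def)
  have b0: "0 \<le> b q" for q using L_pos by (simp add: b_def)
  have chi: "D ^ 4 * (spread v)\<^sup>2 = ((norm v)\<^sup>2 - real DIM('a))\<^sup>2" for v :: 'a
  proof -
    have "real DIM('a) * ((norm v)\<^sup>2 / real DIM('a) - 1) = (norm v)\<^sup>2 - real DIM('a)" by (simp add: right_diff_distrib)
    then have "((norm v)\<^sup>2 - real DIM('a))\<^sup>2 = (real DIM('a))\<^sup>2 * ((norm v)\<^sup>2 / real DIM('a) - 1)\<^sup>2"
      by (metis power_mult_distrib)
    then show ?thesis by (simp add: spread_def D4)
  qed
  define k0 where "k0 = (\<lambda>q. h ^ 3 * (LH * (b q ^ 6 / (256000 * D ^ 4) + 3/40 * (b q)\<^sup>2) +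
     L * s * (37/25600 * b q ^ 4 / D ^ 3 + 103/100 * (5/17 * (b q)\<^sup>2 / D + 17/20 * D) + 3/40 * D)))"
  define k1 where "k1 = (\<lambda>q. h ^ 3 * (LH * (43/40) + L * s * ((b q)\<^sup>2 / (16 * D ^ 3) + 3 / (40 * D))))"
  define k2 where "k2 = h ^ 3 * (L * s * (9 / (1600 * D ^ 3)))"
  define k3 where "k3 = h ^ 3 * (LH / (8 * D ^ 4))"
  define k4 where "k4 = h ^ 3 * (LH + L * s / (16 * D))"
  have k: "0 \<le> k0 q" "0 \<le> k1 q" "0 \<le> k2" "0 \<le> k3" "0 \<le> k4" for q
    unfolding k0_def k1_def k2_def k3_def k4_def using h LH_nonneg L_nonneg s D b0[of q] by auto
  have pt: "h\<^sup>2 * mid_asym_bound h q v \<le> k0 q + k1 q * (norm v)\<^sup>2 + k2 * norm v ^ 4 + k3 * norm v ^ 6 +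
      k4 * ((norm v)\<^sup>2 - real DIM('a))\<^sup>2" for q v
  proof -
    define e where "e = norm v + 3/20 * b q"
    have x0: "0 \<le> spread v" by (simp add: spread_def)
    have "h\<^sup>2 * mid_asym_bound h q v \<le>
      h ^ 3 * (LH * (spread v * e ^ 3 / 8 + e * norm v) +
       L * s * (spread v * (e * (2 * b q + 3/10 * e)) / 32 + (2 * b q + 3/10 * e) / 2))"
      unfolding s_def by (rule mid_asym_bound_le[OF h hL hd refl _ e_def]) (simp add: b_def)
    also have "\<dots> \<le> h ^ 3 * (LH * ((2 * norm v ^ 6 / D ^ 4 + b q ^ 6 / (16000 * D ^ 4) + 16 * D ^ 4 * (spread v)\<^sup>2) / 16 +
        43/40 * (norm v)\<^sup>2 + 3/40 * (b q)\<^sup>2) +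
       L * s * (((16 * (norm v)\<^sup>2 * (b q)\<^sup>2 + 37/100 * b q ^ 4 + 144/100 * norm v ^ 4) / (4 * D ^ 3) + 4 * D ^ 3 * (spread v)\<^sup>2) / 64 +
         103/100 * (5/17 * (b q)\<^sup>2 / D + 17/20 * D) + 3/20 * ((norm v)\<^sup>2 / (2 * D) + D / 2)))"
      using h LH_nonneg L_nonneg s
      by (intro mult_left_mono add_mono spread_cubic_bound[OF _ b0 x0 D(1) e_def] spread_quadratic_bound[OF _ b0 x0 D(1) e_def]) auto
    also have "\<dots> = k0 q + k1 q * (norm v)\<^sup>2 + k2 * norm v ^ 4 + k3 * norm v ^ 6 + k4 * (D ^ 4 * (spread v)\<^sup>2)"
    proof -
      define S where "S = D ^ 4 * (spread v)\<^sup>2"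
      have c3: "4 * D ^ 3 * (spread v)\<^sup>2 = 4 * S / D" using D(1) by (simp add: S_def power4_eq_xxxx power3_eq_cube)
      have c4: "16 * D ^ 4 * (spread v)\<^sup>2 = 16 * S" by (simp add: S_def)
      show ?thesis unfolding c3 c4 S_def[symmetric] k0_def k1_def k2_def k3_def k4_def
        by (simp add: add_divide_distrib distrib_left distrib_right mult_ac)
    qed
    finally show ?thesis unfolding chi .
  qed
  define l0 where "l0 = h ^ 3 * (LH * (43/40 + 15/8 + 2) * D\<^sup>2 + L * s * (103/100 * 17/20 + 3/40 + 3/40 + 27/1600 + 1/8) * D)"
  define l1 where "l1 = h ^ 3 * (LH * (3/40) + L * s * ((103/100 * 5/17 + 1/16) / D))"
  define l2 where "l2 = h ^ 3 * (L * s * (37/25600) / D ^ 3)"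
  define l3 where "l3 = h ^ 3 * (LH / (256000 * D ^ 4))"
  have l: "0 \<le> l0" "0 \<le> l1" "0 \<le> l2" "0 \<le> l3"
    unfolding l0_def l1_def l2_def l3_def using h LH_nonneg L_nonneg s D by auto
  have inner: "(\<integral>\<^sup>+ v. ennreal (h\<^sup>2 * mid_asym_bound h q v) \<partial>std_gaussian) \<le>
     ennreal (l0 + l1 * (b q)\<^sup>2 + l2 * b q ^ 4 + l3 * b q ^ 6)" for q
  proof -
    have "(\<integral>\<^sup>+ v. ennreal (h\<^sup>2 * mid_asym_bound h q v) \<partial>std_gaussian) \<le>
      (\<integral>\<^sup>+ v. ennreal (k0 q + k1 q * (norm (v::'a))\<^sup>2 + k2 * norm v ^ 4 + k3 * norm v ^ 6 +
      k4 * ((norm v)\<^sup>2 - real DIM('a))\<^sup>2) \<partial>std_gaussian)"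
      by (intro nn_integral_mono ennreal_leI pt)
    also have "\<dots> \<le> ennreal (k0 q + k1 q * real DIM('a) + k2 * (3 * real DIM('a) ^ 2) + k3 * (15 * real DIM('a) ^ 3) + k4 * (2 * real DIM('a)))"
      by (rule nn_integral_std_gaussian_poly_le[OF k])
    also have "k0 q + k1 q * real DIM('a) + k2 * (3 * real DIM('a) ^ 2) + k3 * (15 * real DIM('a) ^ 3) + k4 * (2 * real DIM('a)) =
       k0 q + k1 q * D\<^sup>2 + k2 * (3 * D ^ 4) + k3 * (15 * D ^ 6) + k4 * (2 * D\<^sup>2)"
      unfolding D4 D6 D(2) ..
    also have "\<dots> = l0 + l1 * (b q)\<^sup>2 + l2 * b q ^ 4 + l3 * b q ^ 6"
    proof -
      have "D\<^sup>2 = D * D" "D ^ 3 = D * D * D" "D ^ 4 = D * D * D * D" "D ^ 6 = D * D * D * D * D * D"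
        by (simp_all add: eval_nat_numeral)
      then show ?thesis unfolding k0_def k1_def k2_def k3_def k4_def l0_def l1_def l2_def l3_def using D(1)
        by (simp add: add_divide_distrib distrib_left distrib_right mult_ac)
    qed
    finally show ?thesis .
  qed
  have "ennreal (h\<^sup>2) * (\<integral>\<^sup>+ q. (\<integral>\<^sup>+ v. ennreal (mid_asym_bound h q v) \<partial>std_gaussian) \<partial>gibbs U) =
    (\<integral>\<^sup>+ q. (\<integral>\<^sup>+ v. ennreal (h\<^sup>2 * mid_asym_bound h q v) \<partial>std_gaussian) \<partial>gibbs U)"
    by (simp add: nn_integral_cmult ennreal_mult mid_asym_bound_nonneg)
  also have "\<dots> \<le> (\<integral>\<^sup>+ q. ennreal (l0 + l1 * (b q)\<^sup>2 + l2 * b q ^ 4 + l3 * b q ^ 6) \<partial>gibbs U)"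
    by (intro nn_integral_mono inner)
  also have "\<dots> \<le> ennreal (l0 + l1 * (3 * real DIM('a)) + l2 * (12 * real DIM('a) ^ 2) + l3 * (68 * real DIM('a) ^ 3))"
    unfolding b_def by (rule nn_integral_gradient_poly_le[OF l])
  also have "\<dots> \<le> ennreal (h ^ 3 * (6 * LH * real DIM('a) + 3 * L * sqrt L * sqrt DIM('a)))"
  proof (rule ennreal_leI)
    have "l0 + l1 * (3 * real DIM('a)) + l2 * (12 * real DIM('a) ^ 2) + l3 * (68 * real DIM('a) ^ 3) =
       l0 + l1 * (3 * D\<^sup>2) + l2 * (12 * D ^ 4) + l3 * (68 * D ^ 6)" unfolding D4 D6 D(2) ..
    \<comment> \<open>The two rational sums are about 5.18 and 2.29, which gives the rounded
      constants 6 and 3.\<close>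
    also have "\<dots> = h ^ 3 * ((43/40 + 15/8 + 2 + 9/40 + 68/256000) * (LH * D\<^sup>2) +
        (103/100 * 17/20 + 3/40 + 3/40 + 27/1600 + 1/8 + 3 * (103/100 * 5/17 + 1/16) + 12 * 37/25600) * (L * s * D))"
    proof -
      have "D\<^sup>2 = D * D" "D ^ 3 = D * D * D" "D ^ 4 = D * D * D * D" "D ^ 6 = D * D * D * D * D * D"
        by (simp_all add: eval_nat_numeral)
      then show ?thesis unfolding l0_def l1_def l2_def l3_def using D(1)
        by (simp add: field_simps)
    qed
    also have "\<dots> \<le> h ^ 3 * (6 * (LH * D\<^sup>2) + 3 * (L * s * D))"
      using h LH_nonneg L_nonneg s D by (intro mult_left_mono add_mono mult_right_mono) auto
    finally show "l0 + l1 * (3 * real DIM('a)) + l2 * (12 * real DIM('a) ^ 2) + l3 * (68 * real DIM('a) ^ 3) \<le>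
      h ^ 3 * (6 * LH * real DIM('a) + 3 * L * sqrt L * sqrt DIM('a))"
      by (simp add: D s_def[symmetric] D_def[symmetric] mult.assoc)
  qed
  finally show ?thesis .
qed

text \<open>With t the asymmetry and pi / 8 <= 4/10, the inequality becomes t <= (4/10) (t / 4 + B).
  Hence t <= B / 2.\<close>

lemma mid_asym_le:
  assumes h: "0 < h" and hL: "12 * (h\<^sup>2 * L) \<le> 1" and hd: "4 * (h\<^sup>2 * L * sqrt DIM('a)) \<le> 1"
  shows "mid_asym h \<le> ennreal (h ^ 3 * (3 * LH * real DIM('a) + 3/2 * L * sqrt L * sqrt DIM('a)))"
proof -
  define I where "I = (\<integral>\<^sup>+ q. (\<integral>\<^sup>+ v. ennreal (mid_asym_bound h q v) \<partial>std_gaussian) \<partial>gibbs U)"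
  define t where "t = enn2real (mid_asym h)"
  define B where "B = h ^ 3 * (6 * LH * real DIM('a) + 3 * L * sqrt L * sqrt DIM('a))"
  have B0: "0 \<le> B" using h LH_nonneg L_nonneg by (simp add: B_def)
  have t: "mid_asym h = ennreal t" "0 \<le> t"
    using mid_asym_le_2[of h] by (auto simp: t_def ennreal_enn2real_if top_unique)
  have "ennreal t \<le> ennreal (pi / 2 * (h\<^sup>2 / 4)) * (ennreal (L * sqrt DIM('a)) * ennreal t + I)"
    using mid_asym_inequality[of h] unfolding t I_def .
  also have "\<dots> = ennreal (pi / 8) * (ennreal (h\<^sup>2) * (ennreal (L * sqrt DIM('a)) * ennreal t) + ennreal (h\<^sup>2) * I)"
  proof -
    have "ennreal (pi / 2 * (h\<^sup>2 / 4)) = ennreal (pi / 8) * ennreal (h\<^sup>2)"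
      by (subst ennreal_mult[symmetric]) auto
    then show ?thesis by (simp only: mult.assoc distrib_left)
  qed
  also have "\<dots> \<le> ennreal (pi / 8) * (ennreal (h\<^sup>2 * (L * sqrt DIM('a) * t)) + ennreal B)"
    using mid_asym_bound_integral[OF assms] t L_nonneg unfolding B_def I_def
    by (intro mult_left_mono add_mono) (auto simp: ennreal_mult)
  also have "\<dots> = ennreal (pi / 8 * (h\<^sup>2 * (L * sqrt DIM('a) * t) + B))"
  proof -
    have "0 \<le> h\<^sup>2 * (L * sqrt DIM('a) * t)" using t L_nonneg by simp
    from ennreal_plus[OF this B0] show ?thesis
      using B0 t L_nonneg by (subst ennreal_mult) auto
  qed
  finally have 1: "t \<le> pi / 8 * (h\<^sup>2 * (L * sqrt DIM('a) * t) + B)"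
    using B0 t L_nonneg by (subst (asm) ennreal_le_iff) auto
  have "h\<^sup>2 * (L * sqrt DIM('a) * t) = (h\<^sup>2 * L * sqrt DIM('a)) * t" by simp
  also have "\<dots> \<le> (1/4) * t" using hd t by (intro mult_right_mono) auto
  finally have "pi / 8 * (h\<^sup>2 * (L * sqrt DIM('a) * t) + B) \<le> 4 / 10 * ((1/4) * t + B)"
    using pi_less_4 pi_approx B0 t L_nonneg by (intro mult_mono) auto
  then have "t \<le> 4 / 10 * ((1/4) * t + B)" using 1 by (rule order_trans[rotated])
  then have "t \<le> 1/2 * B" using B0 by argo
  then show ?thesis unfolding t B_def by (intro ennreal_leI) (simp add: algebra_simps)
qed

end

section \<open>The transition kernel\<close>

context potential
begin

lemma measurable_flow [measurable]: "(\<lambda>s. flow h k s) \<in> borel_measurable borel"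
proof (rule borel_measurable_continuous_onI)
  have "continuous_on UNIV (\<lambda>s. (fst (flow h k s), snd (flow h k s)))"
    using flow_continuous by (intro continuous_on_Pair) blast+
  then show "continuous_on UNIV (\<lambda>s. flow h k s)" by simp
qed

definition endpoint_kernel :: "real \<Rightarrow> nat \<Rightarrow> 'a \<Rightarrow> 'a measure" where
  "endpoint_kernel h n x = distr std_gaussian borel (\<lambda>v. fst (flow h n (x, v)))"

lemma measurable_endpoint [measurable]:
  "(\<lambda>p. fst (flow h n p)) \<in> borel_measurable (borel \<Otimes>\<^sub>M borel)"
  unfolding borel_prod by (rule borel_measurable_continuous_onI) (use flow_continuous in blast)

lemma measurable_endpoint_kernel [measurable]:
  "endpoint_kernel h n \<in> borel \<rightarrow>\<^sub>M subprob_algebra borel"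
proof -
  have "(\<lambda>x. distr std_gaussian borel (\<lambda>v. fst (flow h n (x, v)))) \<in> borel \<rightarrow>\<^sub>M subprob_algebra borel"
  proof (rule measurable_distr2[where M=borel])
    show "(\<lambda>(x, v). fst (flow h n (x, v))) \<in> borel \<Otimes>\<^sub>M borel \<rightarrow>\<^sub>M borel" by simp
    show "(\<lambda>x. std_gaussian) \<in> borel \<rightarrow>\<^sub>M subprob_algebra borel"
      by (rule measurable_const) (auto simp: space_subprob_algebra intro: prob_space_imp_subprob_space prob_space_std_gaussian)
  qed
  then show ?thesis by (simp add: endpoint_kernel_def[abs_def])
qed

lemma emeasure_endpoint_kernel:
  assumes [measurable]: "B \<in> sets borel"
  shows "emeasure (endpoint_kernel h n x) B = (\<integral>\<^sup>+ v. indicator B (fst (flow h n (x, v))) \<partial>std_gaussian)"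
proof -
  have m: "(\<lambda>v. fst (flow h n (x, v))) \<in> borel_measurable borel"
    using measurable_compose[OF measurable_Pair1'[of x borel borel] measurable_endpoint[where h=h and n=n]] by simp
  have "emeasure (endpoint_kernel h n x) B = emeasure std_gaussian ((\<lambda>v. fst (flow h n (x, v))) -` B)"
    unfolding endpoint_kernel_def using m by (subst emeasure_distr) auto
  also have "\<dots> = (\<integral>\<^sup>+ v. indicator ((\<lambda>v. fst (flow h n (x, v))) -` B) v \<partial>std_gaussian)"
    using measurable_sets[OF m assms] by (subst nn_integral_indicator) auto
  also have "\<dots> = (\<integral>\<^sup>+ v. indicator B (fst (flow h n (x, v))) \<partial>std_gaussian)"
    by (intro nn_integral_cong) (auto simp: indicator_def)
  finally show ?thesis .
qed

lemma prob_space_endpoint_kernel: "prob_space (endpoint_kernel h n x)"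
proof -
  have m: "(\<lambda>v. fst (flow h n (x, v))) \<in> borel_measurable borel"
    using measurable_compose[OF measurable_Pair1'[of x borel borel] measurable_endpoint[where h=h and n=n]] by simp
  show ?thesis unfolding endpoint_kernel_def by (rule std_gaussian.prob_space_distr) (use m in simp)
qed

end

context gibbs_potential
begin

text \<open>In n + 1 steps the first one is split off and the other n are put into the test
  function. Every comparison therefore starts from the same initial law and costs one
  \<open>mid_asym\<close>.\<close>

lemma n_steps:
  fixes J :: "'a \<times> 'a \<Rightarrow> ennreal" and h :: real
  assumes [measurable]: "J \<in> borel_measurable (borel \<Otimes>\<^sub>M borel)" and J: "\<And>p. J p \<le> 1"
  defines "A \<equiv> \<lambda>n. (\<integral>\<^sup>+ q. (\<integral>\<^sup>+ v. J (flow h n (q, v)) \<partial>std_gaussian) \<partial>gibbs U)"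
  shows "A n \<le> A 0 + of_nat n * mid_asym h \<and> A 0 \<le> A n + of_nat n * mid_asym h"
proof (induction n)
  case (Suc n)
  define J' where "J' = (\<lambda>q v. J (flow h n (q, v)))"
  have "(\<lambda>s. flow h n s) \<in> borel \<Otimes>\<^sub>M borel \<rightarrow>\<^sub>M borel \<Otimes>\<^sub>M borel"
    using measurable_flow[where h=h and k=n] unfolding borel_prod .
  then have m: "case_prod J' \<in> borel_measurable (borel \<Otimes>\<^sub>M borel)"
    unfolding J'_def by (simp add: measurable_compose[OF _ assms(1)])
  have J'1: "J' q v \<le> 1" for q v by (simp add: J'_def J)
  have "A (Suc n) = (\<integral>\<^sup>+ q. (\<integral>\<^sup>+ v. J' (next_q h q v) (next_v h q v) \<partial>std_gaussian) \<partial>gibbs U)"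
    unfolding A_def J'_def funpow_Suc_right o_def verlet_step_eq ..
  moreover have "A n = (\<integral>\<^sup>+ q. (\<integral>\<^sup>+ v. J' q v \<partial>std_gaussian) \<partial>gibbs U)"
    unfolding A_def J'_def ..
  ultimately have 1: "A (Suc n) \<le> A n + mid_asym h" "A n \<le> A (Suc n) + mid_asym h"
    using one_step[OF m J'1, of h] by simp_all
  have s: "of_nat (Suc n) * mid_asym h = mid_asym h + of_nat n * mid_asym h" by (simp add: distrib_right)
  have "A (Suc n) \<le> (A 0 + of_nat n * mid_asym h) + mid_asym h"
    using 1(1) add_right_mono[OF Suc[THEN conjunct1]] by (rule order_trans)
  moreover have "A 0 \<le> (A (Suc n) + mid_asym h) + of_nat n * mid_asym h"
    using Suc[THEN conjunct2] add_right_mono[OF 1(2)] by (rule order_trans)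
  ultimately show ?case unfolding s by (simp add: ac_simps)
qed simp

lemma emeasure_bind_endpoint:
  assumes \<nu>: "sets \<nu> = sets borel" and B: "B \<in> sets borel"
  shows "emeasure (\<nu> \<bind> endpoint_kernel h n) B = (\<integral>\<^sup>+ x. emeasure (endpoint_kernel h n x) B \<partial>\<nu>)"
proof (rule emeasure_bind[where N=borel])
  show "space \<nu> \<noteq> {}" using sets_eq_imp_space_eq[OF \<nu>] by simp
  show "endpoint_kernel h n \<in> \<nu> \<rightarrow>\<^sub>M subprob_algebra borel"
    using measurable_endpoint_kernel by (simp add: measurable_cong_sets[OF \<nu> refl])
qed (rule B)

lemma gibbs_step_bias:
  assumes [measurable]: "B \<in> sets borel"
    and \<tau>: "of_nat n * mid_asym h \<le> ennreal \<tau>" "0 \<le> \<tau>"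
  shows "\<bar>measure (gibbs U) B - measure (gibbs U \<bind> endpoint_kernel h n) B\<bar> \<le> \<tau>"
proof -
  let ?P = "gibbs U \<bind> endpoint_kernel h n"
  define J where "J = (\<lambda>p :: 'a \<times> 'a. indicator B (fst p) :: ennreal)"
  have [measurable]: "J \<in> borel_measurable (borel \<Otimes>\<^sub>M borel)" unfolding J_def by measurable
  have "prob_space ?P"
    by (rule gibbs.prob_space_bind[of _ borel])
       (auto simp: prob_space_endpoint_kernel measurable_endpoint_kernel measurable_cong_sets[OF sets_gibbs refl])
  then interpret P: prob_space ?P .
  have 0: "(\<integral>\<^sup>+ q. (\<integral>\<^sup>+ v. J (flow h 0 (q, v)) \<partial>std_gaussian) \<partial>gibbs U) = ennreal (measure (gibbs U) B)"
    by (simp add: J_def std_gaussian.emeasure_space_1[simplified] gibbs.emeasure_eq_measure)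
  have 1: "(\<integral>\<^sup>+ q. (\<integral>\<^sup>+ v. J (flow h n (q, v)) \<partial>std_gaussian) \<partial>gibbs U) = ennreal (measure ?P B)"
    unfolding P.emeasure_eq_measure[symmetric]
    by (simp add: emeasure_bind_endpoint emeasure_endpoint_kernel J_def)
  have "ennreal (measure ?P B) \<le> ennreal (measure (gibbs U) B) + ennreal \<tau>"
       "ennreal (measure (gibbs U) B) \<le> ennreal (measure ?P B) + ennreal \<tau>"
  proof -
    have "J p \<le> 1" for p by (simp add: J_def indicator_def)
    note n_steps[where J=J and h=h and n=n, OF _ this, unfolded 0 1]
    then have "ennreal (measure ?P B) \<le> ennreal (measure (gibbs U) B) + of_nat n * mid_asym h"
       "ennreal (measure (gibbs U) B) \<le> ennreal (measure ?P B) + of_nat n * mid_asym h" by simp_all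
    then show "ennreal (measure ?P B) \<le> ennreal (measure (gibbs U) B) + ennreal \<tau>"
       "ennreal (measure (gibbs U) B) \<le> ennreal (measure ?P B) + ennreal \<tau>"
      using add_left_mono[OF \<tau>(1)] by (blast intro: order_trans)+
  qed
  then have "measure ?P B \<le> measure (gibbs U) B + \<tau>" "measure (gibbs U) B \<le> measure ?P B + \<tau>"
    using \<tau>(2) by (simp_all add: ennreal_plus[symmetric] del: ennreal_plus)
  then show ?thesis by linarith
qed

end

text \<open>By the shooting map the velocities sending x into B are the preimage under \<Phi> of
  those sending y into B, so the overlap bound applies to \<Phi>.\<close>

lemma endpoint_kernel_lipschitz:
  fixes U :: "real^'n \<Rightarrow> real"
  assumes pot: "potential U G Hs L LH"
    and h: "0 < h" and n: "0 < n" and T_def: "T = real n * h" and LT: "L * T\<^sup>2 \<le> 1 / 6"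
    and B[measurable]: "B \<in> sets borel"
  shows "\<bar>measure (potential.endpoint_kernel U h n x) B - measure (potential.endpoint_kernel U h n y) B\<bar> \<le>
    3 / 2 * sqrt (1 / T^2 + 27 * real CARD('n) * LH^2 * T^4) * norm (x - y)"
proof -
  interpret potential U G Hs L LH by (rule pot)
  let ?d = "real CARD('n)"
  have T: "0 < T" using h n by (simp add: T_def)
  show ?thesis
  proof (cases "x = y")
    case False
    define r where "r = norm (x - y)"
    have r: "0 < r" using False by (simp add: r_def)
    define \<kappa> where "\<kappa> = 3 / 2 * sqrt (1 / T^2 + 27 * ?d * LH^2 * T^4) * r"
    define a where "a = 165 / 100 * LH * T\<^sup>2 * r"
    have a0: "0 \<le> a" using LH_nonneg r by (simp add: a_def)
    have arg: "0 < 1 / T^2 + 27 * ?d * LH^2 * T^4" using T by (intro add_pos_nonneg) auto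
    then have \<kappa>0: "0 < \<kappa>" using r by (simp add: \<kappa>_def)
    obtain \<Phi> D E where \<Phi>: "\<And>v. fst (flow h n (y, \<Phi> v)) = fst (flow h n (x, v))" "bij \<Phi>"
      "\<And>v. (\<Phi> has_derivative D v) (at v)"
      "\<And>v. linear (E v)" "\<And>v e. D v (E v e) = e"
      "\<And>v. norm (\<Phi> v - v) \<le> 12 / 10 * norm (x - y) / T"
      "\<And>v e. norm (D v e - e) \<le> 165 / 100 * LH * T\<^sup>2 * norm (x - y) * norm e"
      "\<And>v e. norm (E v e - e) \<le> 165 / 100 * LH * T\<^sup>2 * norm (x - y) * norm e"
      using shooting_map[OF h n LT[unfolded T_def], of y x] unfolding T_def by blast
    have m: "(\<lambda>v. fst (flow h n (x, v))) \<in> borel_measurable borel" for x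
      using measurable_compose[OF measurable_Pair1'[of x borel borel] measurable_endpoint[where h=h and n=n]] by simp
    define S where "S = (\<lambda>v. fst (flow h n (y, v))) -` B"
    have S: "S \<in> sets borel" unfolding S_def using measurable_sets[OF m B] by simp
    have S': "(\<lambda>v. fst (flow h n (x, v))) -` B = \<Phi> -` S" unfolding S_def using \<Phi>(1) by auto
    have "\<bar>measure std_gaussian (\<Phi> -` S) - measure std_gaussian S\<bar> \<le> \<kappa>"
    proof (rule std_gaussian_overlap[OF \<Phi>(3,2,4,5), where a=a and b=a and c="12 / 10 * r / T"])
      show "norm (\<Phi> v - v) \<le> 12 / 10 * r / T" for v using \<Phi>(6) by (simp add: r_def)
      show "norm (D v e - e) \<le> a * norm e" "norm (E v e - e) \<le> a * norm e" for v e
        using \<Phi>(7,8) by (simp_all add: a_def r_def)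
      \<comment> \<open>With a = b the determinant part is (3/2) a^2. The resulting coefficients
        0.72 and about 4.08 lie below 9/4 and 243/4, those in \<kappa>^2.\<close>
      have "(12 / 10 * r / T)\<^sup>2 / 2 = 72/100 * (r\<^sup>2 / T\<^sup>2)" by (simp add: power_mult_distrib power_divide)
      moreover have "a * a + a\<^sup>2 / 2 = 81675/20000 * (LH\<^sup>2 * T ^ 4 * r\<^sup>2)"
        by (simp add: a_def power2_eq_square power4_eq_xxxx)
      ultimately have "(12 / 10 * r / T)\<^sup>2 / 2 + ?d * (a * a + a\<^sup>2 / 2) =
          72/100 * (r\<^sup>2 / T\<^sup>2) + 81675/20000 * (?d * LH\<^sup>2 * T ^ 4 * r\<^sup>2)" by (simp add: mult_ac)
      also have "\<dots> \<le> 9/4 * (r\<^sup>2 / T\<^sup>2) + 243/4 * (?d * LH\<^sup>2 * T ^ 4 * r\<^sup>2)"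
        by (intro add_mono mult_right_mono) auto
      also have "\<dots> = \<kappa>\<^sup>2" using arg by (simp add: \<kappa>_def power_mult_distrib power_divide algebra_simps)
      finally show "(12 / 10 * r / T)\<^sup>2 / 2 + ?d * (a * a + a\<^sup>2 / 2) \<le> \<kappa>\<^sup>2" .
    qed (use a0 \<kappa>0 S in auto)
    moreover have md: "measure (endpoint_kernel h n x) B = measure std_gaussian ((\<lambda>v. fst (flow h n (x, v))) -` B)" for x
      unfolding endpoint_kernel_def using m by (subst measure_distr) auto
    have "measure (endpoint_kernel h n x) B = measure std_gaussian (\<Phi> -` S)"
      unfolding md S' ..
    moreover have "measure (endpoint_kernel h n y) B = measure std_gaussian S"
      unfolding md S_def ..
    ultimately show ?thesis by (simp add: \<kappa>_def r_def)
  qed simp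
qed

section \<open>From couplings to total variation\<close>

text \<open>Swapping the components of a coupling keeps its cost. The contraction assumption and the
  final bound take the two measures in opposite order.\<close>

lemma W1_commute: "W1 \<eta> \<nu> \<le> W1 \<nu> (\<eta> :: 'a::euclidean_space measure)"
  unfolding W1_def
proof (rule INF_greatest)
  fix \<gamma> assume \<gamma>: "\<gamma> \<in> couplings \<nu> \<eta>"
  then have ps: "prob_space \<gamma>" and sets[measurable_cong]: "sets \<gamma> = sets (borel \<Otimes>\<^sub>M borel)"
    and f: "distr \<gamma> borel fst = \<nu>" and s: "distr \<gamma> borel snd = \<eta>" by (auto simp: couplings_def)
  interpret prob_space \<gamma> by (rule ps)
  define \<gamma>' where "\<gamma>' = distr \<gamma> (borel \<Otimes>\<^sub>M borel) (\<lambda>p. (snd p, fst p))"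
  have [measurable]: "fst \<in> \<gamma> \<rightarrow>\<^sub>M borel" "snd \<in> \<gamma> \<rightarrow>\<^sub>M borel" by measurable
  have "\<gamma>' \<in> couplings \<eta> \<nu>"
    unfolding couplings_def
  proof (safe)
    show "prob_space \<gamma>'" unfolding \<gamma>'_def by (rule prob_space_distr) simp
    show "distr \<gamma>' borel fst = \<eta>" unfolding \<gamma>'_def by (subst distr_distr) (auto simp: comp_def s)
    show "distr \<gamma>' borel snd = \<nu>" unfolding \<gamma>'_def by (subst distr_distr) (auto simp: comp_def f)
  qed (simp_all add: \<gamma>'_def)
  then have "(INF \<gamma>\<in>couplings \<eta> \<nu>. \<integral>\<^sup>+ p. ennreal (norm (fst p - snd p)) \<partial>\<gamma>) \<le> (\<integral>\<^sup>+ p. ennreal (norm (fst p - snd p)) \<partial>\<gamma>')"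
    by (rule INF_lower)
  also have "\<dots> = (\<integral>\<^sup>+ p. ennreal (norm (fst p - snd p)) \<partial>\<gamma>)"
    unfolding \<gamma>'_def by (subst nn_integral_distr) (auto simp: norm_minus_commute)
  finally show "(INF \<gamma>\<in>couplings \<eta> \<nu>. \<integral>\<^sup>+ p. ennreal (norm (fst p - snd p)) \<partial>\<gamma>) \<le> (\<integral>\<^sup>+ p. ennreal (norm (fst p - snd p)) \<partial>\<gamma>)" .
qed

text \<open>Both probabilities are integrals of the function x \<mapsto> \<pi> x B, hence their
  difference is an integral over any coupling and is bounded by K times its cost.\<close>

lemma W1_smoothing:
  fixes \<pi> :: "'a::euclidean_space \<Rightarrow> 'a measure"
  assumes \<pi>[measurable]: "\<pi> \<in> borel \<rightarrow>\<^sub>M subprob_algebra borel" and prob: "\<And>x. prob_space (\<pi> x)"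
    and B[measurable]: "B \<in> sets borel"
    and lip: "\<And>x y. \<bar>measure (\<pi> x) B - measure (\<pi> y) B\<bar> \<le> K * norm (x - y)" and K: "0 < K"
    and \<nu>: "borel_prob \<nu>" and \<eta>: "borel_prob \<eta>"
  shows "ennreal \<bar>measure (\<nu> \<bind> \<pi>) B - measure (\<eta> \<bind> \<pi>) B\<bar> \<le> ennreal K * W1 \<nu> \<eta>"
proof -
  have mb: "measure (\<nu> \<bind> \<pi>) B = (\<integral>x. measure (\<pi> x) B \<partial>\<nu>)" if "borel_prob \<nu>" for \<nu>
  proof -
    have sets: "sets \<nu> = sets borel" and ps: "prob_space \<nu>" using that by (auto simp: borel_prob_def)
    interpret prob_space \<nu> by (rule ps)
    have m: "\<pi> \<in> \<nu> \<rightarrow>\<^sub>M subprob_algebra borel" using \<pi> by (simp add: measurable_cong_sets[OF sets refl])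
    have "emeasure (\<nu> \<bind> \<pi>) B = (\<integral>\<^sup>+ x. emeasure (\<pi> x) B \<partial>\<nu>)"
      using not_empty m B by (rule emeasure_bind)
    also have "\<dots> = (\<integral>\<^sup>+ x. ennreal (measure (\<pi> x) B) \<partial>\<nu>)"
      by (intro nn_integral_cong) (simp add: finite_measure.emeasure_eq_measure[OF prob_space.finite_measure[OF prob]])
    also have "\<dots> = ennreal (\<integral>x. measure (\<pi> x) B \<partial>\<nu>)"
    proof (rule nn_integral_eq_integral)
      show "integrable \<nu> (\<lambda>x. measure (\<pi> x) B)"
        by (rule integrable_const_bound[of _ 1])
           (use m B in \<open>auto simp: prob_space.prob_le_1[OF prob]\<close>)
    qed simp
    finally show ?thesis by (simp add: measure_def)
  qed
  have le: "ennreal \<bar>measure (\<nu> \<bind> \<pi>) B - measure (\<eta> \<bind> \<pi>) B\<bar> \<le>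
      ennreal K * (\<integral>\<^sup>+ p. ennreal (norm (fst p - snd p)) \<partial>\<gamma>)" if \<gamma>: "\<gamma> \<in> couplings \<nu> \<eta>" for \<gamma>
  proof -
    have ps: "prob_space \<gamma>" and sets[measurable_cong]: "sets \<gamma> = sets (borel \<Otimes>\<^sub>M borel)"
      and f: "distr \<gamma> borel fst = \<nu>" and s: "distr \<gamma> borel snd = \<eta>" using \<gamma> by (auto simp: couplings_def)
    interpret prob_space \<gamma> by (rule ps)
    have mF: "(\<lambda>x. measure (\<pi> x) B) \<in> borel_measurable borel" by measurable
    have mf: "fst \<in> \<gamma> \<rightarrow>\<^sub>M borel" and ms: "snd \<in> \<gamma> \<rightarrow>\<^sub>M borel" by measurable
    have i: "integrable \<gamma> (\<lambda>p. measure (\<pi> (g p)) B)" if g: "g \<in> \<gamma> \<rightarrow>\<^sub>M borel" for g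
      by (rule integrable_const_bound[of _ 1]) (use measurable_compose[OF g mF] in \<open>auto simp: prob_space.prob_le_1[OF prob]\<close>)
    have "measure (\<nu> \<bind> \<pi>) B - measure (\<eta> \<bind> \<pi>) B =
        (\<integral>x. measure (\<pi> x) B \<partial>distr \<gamma> borel fst) - (\<integral>x. measure (\<pi> x) B \<partial>distr \<gamma> borel snd)"
      unfolding f s mb[OF \<nu>] mb[OF \<eta>] ..
    also have "\<dots> = (\<integral>p. measure (\<pi> (fst p)) B \<partial>\<gamma>) - (\<integral>p. measure (\<pi> (snd p)) B \<partial>\<gamma>)"
      using mf ms mF by (simp add: integral_distr)
    also have "\<dots> = (\<integral>p. measure (\<pi> (fst p)) B - measure (\<pi> (snd p)) B \<partial>\<gamma>)"
      using i[OF mf] i[OF ms] by simp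
    finally have "ennreal \<bar>measure (\<nu> \<bind> \<pi>) B - measure (\<eta> \<bind> \<pi>) B\<bar> =
        ennreal (norm (\<integral>p. measure (\<pi> (fst p)) B - measure (\<pi> (snd p)) B \<partial>\<gamma>))" by simp
    also have "\<dots> \<le> (\<integral>\<^sup>+ p. ennreal (norm (measure (\<pi> (fst p)) B - measure (\<pi> (snd p)) B)) \<partial>\<gamma>)"
      using i[OF mf] i[OF ms] by (intro integral_norm_bound_ennreal) auto
    also have "\<dots> \<le> (\<integral>\<^sup>+ p. ennreal K * ennreal (norm (fst p - snd p)) \<partial>\<gamma>)"
      using lip K by (intro nn_integral_mono) (auto simp: ennreal_mult[symmetric] intro!: ennreal_leI)
    also have "\<dots> = ennreal K * (\<integral>\<^sup>+ p. ennreal (norm (fst p - snd p)) \<partial>\<gamma>)"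
      by (rule nn_integral_cmult) measurable
    finally show ?thesis .
  qed
  define x where "x = ennreal \<bar>measure (\<nu> \<bind> \<pi>) B - measure (\<eta> \<bind> \<pi>) B\<bar>"
  \<comment> \<open>Multiplying by 1 / K and back moves the constant past the infimum over
    couplings.\<close>
  have KK: "ennreal (1 / K) * (ennreal K * a) = a" "ennreal K * (ennreal (1 / K) * a) = a" for a
    using K by (simp_all add: mult.assoc[symmetric] ennreal_mult[symmetric])
  have "ennreal (1 / K) * x \<le> W1 \<nu> \<eta>"
    unfolding W1_def
  proof (rule INF_greatest)
    fix \<gamma> assume "\<gamma> \<in> couplings \<nu> \<eta>"
    from mult_left_mono[OF le[OF this], of "ennreal (1 / K)"]
    show "ennreal (1 / K) * x \<le> (\<integral>\<^sup>+ p. ennreal (norm (fst p - snd p)) \<partial>\<gamma>)"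
      by (simp add: KK x_def)
  qed
  from mult_left_mono[OF this, of "ennreal K"] show ?thesis by (simp add: KK x_def)
qed

section \<open>From iterated Frechet derivatives to gradient and Hessian\<close>

lemma deriv_blinfun_works:
  assumes "f differentiable at x"
  shows "(f has_derivative blinfun_apply (deriv_blinfun f x)) (at x)"
proof -
  have d: "(f has_derivative frechet_derivative f (at x)) (at x)"
    using assms by (rule frechet_derivative_works[THEN iffD1])
  then have "blinfun_apply (deriv_blinfun f x) = frechet_derivative f (at x)"
    unfolding deriv_blinfun_def by (intro bounded_linear_Blinfun_apply has_derivative_bounded_linear)
  then show ?thesis using d by simp
qed

definition riesz :: "('a::euclidean_space \<Rightarrow>\<^sub>L real) \<Rightarrow> 'a" where
  "riesz \<phi> = (\<Sum>b\<in>Basis. blinfun_apply \<phi> b *\<^sub>R b)"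

lemma riesz_inner: "riesz \<phi> \<bullet> y = blinfun_apply \<phi> y"
proof -
  have "blinfun_apply \<phi> y = blinfun_apply \<phi> (\<Sum>b\<in>Basis. (y \<bullet> b) *\<^sub>R b)" by (simp add: euclidean_representation)
  also have "\<dots> = (\<Sum>b\<in>Basis. (y \<bullet> b) * blinfun_apply \<phi> b)" by (simp add: blinfun.sum_right blinfun.scaleR_right)
  finally show ?thesis
    unfolding riesz_def inner_sum_left inner_scaleR_left by (simp add: inner_commute mult.commute)
qed

lemma norm_riesz_le: "norm (riesz \<phi>) \<le> norm \<phi>"
proof (cases "riesz \<phi> = 0")
  case False
  have "norm (riesz \<phi>) * norm (riesz \<phi>) = blinfun_apply \<phi> (riesz \<phi>)"
    using riesz_inner[of \<phi> "riesz \<phi>"] by (simp add: dot_square_norm power2_eq_square)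
  also have "\<dots> \<le> norm \<phi> * norm (riesz \<phi>)"
    using norm_blinfun[of \<phi> "riesz \<phi>"] by simp
  finally show ?thesis using False by simp
qed simp

lemma bounded_linear_riesz: "bounded_linear riesz"
  unfolding riesz_def by (intro bounded_linear_intros)

text \<open>\<open>riesz\<close> is linear and does not increase norms, so operator norm bounds pass
  to gradient and Hessian. The mean value inequality turns the bound on \<open>D3 U\<close> into the
  Lipschitz constant of the Hessian.\<close>

lemma C4_potential:
  fixes U :: "'a::euclidean_space \<Rightarrow> real"
  assumes smooth: "C4 U" and L: "\<And>x. norm (D2 U x) \<le> L" and LH: "\<And>x. norm (D3 U x) \<le> LH"
  shows "potential U (\<lambda>x. riesz (deriv_blinfun U x)) (\<lambda>x e. riesz (blinfun_apply (D2 U x) e)) L LH"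
proof
  have d1: "U differentiable at x" and d2: "deriv_blinfun U differentiable at x" and d3: "D2 U differentiable at x" for x
    using smooth by (auto simp: C4_def)
  fix x y e :: 'a
  show "(U has_derivative (\<lambda>e. riesz (deriv_blinfun U x) \<bullet> e)) (at x)"
    using deriv_blinfun_works[OF d1] by (simp add: riesz_inner)
  have "(deriv_blinfun U has_derivative blinfun_apply (D2 U x)) (at x)"
    using deriv_blinfun_works[OF d2] by (simp add: D2_def)
  then show "((\<lambda>x. riesz (deriv_blinfun U x)) has_derivative (\<lambda>e. riesz (blinfun_apply (D2 U x) e))) (at x)"
    by (rule bounded_linear.has_derivative[OF bounded_linear_riesz])
  have "norm (blinfun_apply (D2 U x) e) \<le> L * norm e"
    using norm_blinfun[of "D2 U x" e] L[of x] by (meson mult_right_mono norm_ge_zero order_trans)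
  then show "norm (riesz (blinfun_apply (D2 U x) e)) \<le> L * norm e"
    using norm_riesz_le order_trans by blast
  have D: "(D2 U has_derivative blinfun_apply (D3 U x)) (at x)" for x
    using deriv_blinfun_works[OF d3] by (simp add: D3_def)
  have LH0: "0 \<le> LH" using LH[of 0] norm_ge_zero order_trans by blast
  have "norm (D2 U x - D2 U y) \<le> LH * norm (x - y)"
  proof (rule differentiable_bound[of UNIV])
    show "onorm (blinfun_apply (D3 U z)) \<le> LH" for z using LH[of z] by (simp add: norm_blinfun.rep_eq)
  qed (auto intro: D has_derivative_at_withinI)
  then have "norm (blinfun_apply (D2 U x - D2 U y) e) \<le> LH * norm (x - y) * norm e"
    using norm_blinfun[of "D2 U x - D2 U y" e] by (meson mult_right_mono norm_ge_zero order_trans)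
  then show "norm (riesz (blinfun_apply (D2 U x) e) - riesz (blinfun_apply (D2 U y) e)) \<le> LH * norm (x - y) * norm e"
    using norm_riesz_le[of "blinfun_apply (D2 U x - D2 U y) e"]
    by (simp add: blinfun.diff_left linear_diff[OF bounded_linear.linear[OF bounded_linear_riesz], symmetric])
  show "0 \<le> L" using L[of 0] norm_ge_zero order_trans by blast
  show "0 \<le> LH" by (rule LH0)
qed

lemma ennreal_sqrt_mono_real:
  assumes "ennreal b \<le> a" "0 \<le> b"
  shows "ennreal (sqrt b) \<le> ennreal_sqrt a"
proof (cases "a = \<top>")
  case False
  then have "b \<le> enn2real a" using assms by (metis enn2real_ennreal enn2real_mono top.not_eq_extremum)
  then show ?thesis using False by (simp add: ennreal_sqrt_def ennreal_leI)
qed (simp add: ennreal_sqrt_def)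

text \<open>If L = 0 then the gradient is constant and U is affine. Being bounded below, U is
  constant, and exp (- U) would not be integrable.\<close>

lemma (in potential) L_pos_of_integrable:
  assumes "integrable lborel (\<lambda>x. exp (- U x))" and min: "\<And>x. U 0 \<le> U x"
  shows "0 < L"
proof (rule ccontr)
  assume "\<not> 0 < L"
  then have L0: "L = 0" using L_nonneg by simp
  have G0: "G x = G 0" for x using G_lipschitz[of x 0] by (simp add: L0)
  have Uc: "U x = U 0" for x
  proof -
    have "U (x - x) \<le> U x - x \<bullet> G x + L * (norm x)\<^sup>2 / 2" by (rule descent)
    moreover have "U (- x - - x) \<le> U (- x) - (- x) \<bullet> G (- x) + L * (norm (- x))\<^sup>2 / 2" by (rule descent)
    moreover have "U (0 - x) \<le> U 0 - x \<bullet> G 0 + L * (norm x)\<^sup>2 / 2" by (rule descent)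
    moreover have "U (0 - - x) \<le> U 0 - (- x) \<bullet> G 0 + L * (norm (- x))\<^sup>2 / 2" by (rule descent)
    moreover have "U 0 \<le> U x" "U 0 \<le> U (- x)" by (rule min)+
    ultimately show ?thesis using L0 G0[of x] G0[of "- x"] by simp
  qed
  have "(\<lambda>x. exp (- U x)) = (\<lambda>x. exp (- U 0))"
    by (rule ext, rule arg_cong[where f="\<lambda>u. exp (- u)"], rule Uc)
  then have "integrable (lborel :: 'a measure) (\<lambda>x. exp (- U 0))" using assms(1) by (simp only:)
  then have "(\<integral>\<^sup>+ x. ennreal (norm (exp (- U 0))) \<partial>(lborel :: 'a measure)) < \<infinity>"
    unfolding integrable_iff_bounded by blast
  then show False by (simp add: ennreal_mult_top)
qed

section \<open>Bias of a full run and assembly of the bound\<close>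

lemma (in potential) uhmc_kernel_eq:
  assumes "T = real n * h" "0 < h"
  shows "uhmc_kernel U T h = endpoint_kernel h n"
  using assms by (auto simp: uhmc_kernel_def endpoint_kernel_def)

text \<open>If 4 h^2 L sqrt d <= 1, the single-step estimate applies and n h^3 = T h^2. Otherwise
  the right-hand side exceeds 1, thanks to the summand 16 d L^2.\<close>

lemma (in gibbs_potential) gibbs_bias:
  assumes h: "0 < h" and n: "0 < n" and T_def: "T = real n * h" and LT: "L * (T\<^sup>2 + T * h) \<le> 1 / 6"
    and B: "B \<in> sets borel"
  shows "\<bar>measure (gibbs U) B - measure (gibbs U \<bind> endpoint_kernel h n) B\<bar> \<le>
    h\<^sup>2 * sqrt (35 * real DIM('a) ^ 2 * LH\<^sup>2 * T\<^sup>2 + 16 * real DIM('a) * L\<^sup>2)"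
proof -
  let ?d = "real DIM('a)"
  define C where "C = sqrt (35 * ?d ^ 2 * LH\<^sup>2 * T\<^sup>2 + 16 * ?d * L\<^sup>2)"
  define X where "X = LH * ?d * T"
  define Y where "Y = L * sqrt ?d"
  have T: "0 < T" "h \<le> T" using h n by (auto simp: T_def)
  have X0: "0 \<le> X" and Y0: "0 \<le> Y" using LH_nonneg L_nonneg T by (auto simp: X_def Y_def)
  have C: "C = sqrt (35 * X\<^sup>2 + 16 * Y\<^sup>2)" by (simp add: C_def X_def Y_def power_mult_distrib mult_ac)
  have "\<bar>measure (gibbs U) B - measure (gibbs U \<bind> endpoint_kernel h n) B\<bar> \<le> h\<^sup>2 * C"
  proof (cases "4 * (h\<^sup>2 * L * sqrt ?d) \<le> 1")
    case True
    have "L * h\<^sup>2 \<le> L * T\<^sup>2" "L * h\<^sup>2 \<le> L * (T * h)"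
      using T h L_nonneg by (auto intro!: mult_left_mono mult_mono simp: power2_eq_square)
    \<comment> \<open>As h <= T, both L T^2 and L T h dominate L h^2, so 2 L h^2 <= 1/6.\<close>
    then have hL: "12 * (h\<^sup>2 * L) \<le> 1" using LT unfolding distrib_left by (simp add: mult.commute)
    have TL: "T * sqrt L \<le> 1 / 2"
    proof (rule power2_le_imp_le)
      have "0 \<le> L * (T * h)" using L_nonneg T h by simp
      then have "L * T\<^sup>2 \<le> 1 / 6" using LT unfolding distrib_left by linarith
      moreover have "(T * sqrt L)\<^sup>2 = L * T\<^sup>2" using L_nonneg by (simp add: power_mult_distrib)
      ultimately have "(T * sqrt L)\<^sup>2 \<le> 1 / 6" by simp
      also have "\<dots> \<le> (1 / 2)\<^sup>2" by (simp add: power2_eq_square)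
      finally show "(T * sqrt L)\<^sup>2 \<le> (1 / 2)\<^sup>2" .
    qed simp
    define \<tau> where "\<tau> = real n * (h ^ 3 * (3 * LH * ?d + 3/2 * L * sqrt L * sqrt ?d))"
    have \<tau>0: "0 \<le> \<tau>" using h LH_nonneg L_nonneg by (simp add: \<tau>_def)
    have "\<tau> = h\<^sup>2 * (3 * X + 3/2 * (T * sqrt L) * Y)"
      by (simp add: \<tau>_def X_def Y_def T_def power2_eq_square power3_eq_cube algebra_simps)
    also have "\<dots> \<le> h\<^sup>2 * (3 * X + 3/2 * (1/2) * Y)"
      using TL Y0 by (intro mult_left_mono add_left_mono mult_right_mono) auto
    also have "\<dots> \<le> h\<^sup>2 * C"
    proof (rule mult_left_mono)
      have "0 \<le> (3 * X - 3/4 * Y)\<^sup>2" by simp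
      then have "(3 * X + 3/2 * (1/2) * Y)\<^sup>2 \<le> 2 * (3 * X)\<^sup>2 + 2 * (3/4 * Y)\<^sup>2" by (simp add: power2_sum power2_diff)
      also have "\<dots> \<le> 35 * X\<^sup>2 + 16 * Y\<^sup>2" by (simp add: power_mult_distrib power_divide)
      finally show "3 * X + 3/2 * (1/2) * Y \<le> C" unfolding C by (rule real_le_rsqrt)
    qed simp
    finally have \<tau>C: "\<tau> \<le> h\<^sup>2 * C" .
    have "of_nat n * mid_asym h \<le> of_nat n * ennreal (h ^ 3 * (3 * LH * ?d + 3/2 * L * sqrt L * sqrt ?d))"
      by (intro mult_left_mono mid_asym_le[OF h hL True]) simp
    also have "\<dots> = ennreal \<tau>"
      unfolding \<tau>_def ennreal_of_nat_eq_real_of_nat by (rule ennreal_mult'[symmetric]) simp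
    finally show ?thesis using gibbs_step_bias[OF B _ \<tau>0] \<tau>C by (blast intro: order_trans)
  next
    case False
    \<comment> \<open>4 Y is the square root of the summand 16 d L^2 of C^2.\<close>
    have "1 \<le> h\<^sup>2 * (4 * Y)" using False by (simp add: Y_def mult_ac)
    also have "\<dots> \<le> h\<^sup>2 * C"
      unfolding C by (intro mult_left_mono real_le_rsqrt) (auto simp: power_mult_distrib)
    finally have "1 \<le> h\<^sup>2 * C" .
    moreover have "prob_space (gibbs U \<bind> endpoint_kernel h n)"
      by (rule gibbs.prob_space_bind[of _ borel])
         (auto simp: prob_space_endpoint_kernel measurable_endpoint_kernel measurable_cong_sets[OF sets_gibbs refl])
    then have "measure (gibbs U \<bind> endpoint_kernel h n) B \<le> 1" by (rule prob_space.prob_le_1)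
    moreover have "measure (gibbs U) B \<le> 1" by (rule gibbs.prob_le_1)
    ultimately show ?thesis
      using measure_nonneg[of "gibbs U" B] measure_nonneg[of "gibbs U \<bind> endpoint_kernel h n" B] by linarith
  qed
  then show ?thesis by (simp add: C_def)
qed

theorem corollary8:
  fixes U :: "real ^ 'n \<Rightarrow> real"
    and \<mu> \<mu>' :: "(real ^ 'n) measure"
    and d L L\<^sub>H L\<^sub>I T h M\<^sub>1 M\<^sub>2 c :: real
    and \<pi> :: "real ^ 'n \<Rightarrow> (real ^ 'n) measure"
  assumes d: "d = real CARD('n)"
    and smooth: "C4 U"
    and integrable: "integrable lborel (\<lambda>x. exp (- U x))"
    and minimum: "\<forall>x. U 0 \<le> U x" and U0: "U 0 = 0"
    and L_bdd: "bdd_above (range (\<lambda>x. norm (D2 U x)))" and L: "L = (SUP x. norm (D2 U x))"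
    and LH_bdd: "bdd_above (range (\<lambda>x. norm (D3 U x)))" and LH: "L\<^sub>H = (SUP x. norm (D3 U x))"
    and LI_bdd: "bdd_above (range (\<lambda>x. norm (D4 U x)))" and LI: "L\<^sub>I = (SUP x. norm (D4 U x))"
    and \<mu>: "\<mu> = gibbs U"
    and T: "T > 0" and h: "h > 0" and steps: "T / h \<in> \<nat>"
    and LT: "L * (T^2 + T * h) \<le> 1 / 6"
    and \<pi>: "\<pi> = uhmc_kernel U T h"
    and \<mu>': "borel_prob \<mu>'" and invariant: "\<mu>' \<bind> \<pi> = \<mu>'"
    and M1: "M\<^sub>1 > 0" and c: "c > 0"
    and A5: "\<forall>m \<nu>. borel_prob \<nu> \<longrightarrow>
       W1 (\<nu> \<bind> kernel_pow \<pi> m) \<mu>' \<le> ennreal (M\<^sub>1 * exp (- c * real m)) * W1 \<nu> \<mu>'"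
    and M2: "M\<^sub>2 > 0"
    and A6: "W1 \<mu> \<mu>' \<le> ennreal (M\<^sub>2 * h^2)"
  shows "\<forall>m \<nu>. borel_prob \<nu> \<longrightarrow>
       ennreal (TV \<mu> (\<nu> \<bind> kernel_pow \<pi> (m + 1)))
       \<le> ennreal (3 / 2 * sqrt (1 / T^2 + 27 * d * L\<^sub>H^2 * T^4) * M\<^sub>1) * W1 \<mu>' \<nu>
           * ennreal (exp (- c * real m))
         + ennreal (h^2) * (ennreal (3 / 2 * sqrt (1 / T^2 + 27 * d * L\<^sub>H^2 * T^4) * M\<^sub>2)
           + bias_const d L L\<^sub>H L\<^sub>I T \<mu>)"
proof (intro allI impI)
  fix m :: nat and \<nu> :: "(real^'n) measure"
  assume \<nu>: "borel_prob \<nu>"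
  define G where "G = (\<lambda>x. riesz (deriv_blinfun U x))"
  define Hs where "Hs = (\<lambda>x e. riesz (blinfun_apply (D2 U x) e))"
  have L_le: "norm (D2 U x) \<le> L" and LH_le: "norm (D3 U x) \<le> L\<^sub>H" and LI_le: "norm (D4 U x) \<le> L\<^sub>I" for x
    unfolding L LH LI by (auto intro: cSUP_upper[OF _ L_bdd] cSUP_upper[OF _ LH_bdd] cSUP_upper[OF _ LI_bdd])
  have pot: "potential U G Hs L L\<^sub>H"
    unfolding G_def Hs_def by (rule C4_potential[OF smooth L_le LH_le])
  interpret potential U G Hs L L\<^sub>H by (rule pot)
  have "0 < L" by (rule L_pos_of_integrable[OF integrable]) (use minimum in blast)
  then interpret gibbs_potential U G Hs L L\<^sub>H
    using integrable by unfold_locales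
  have LI0: "0 \<le> L\<^sub>I" using LI_le[of 0] norm_ge_zero order_trans by blast
  obtain n where "T / h = real n" using steps by (auto simp: Nats_def)
  then have Tn: "T = real n * h" using h by (simp add: field_simps)
  then have n: "0 < n" using T h by (cases n) auto
  have ker: "\<pi> = endpoint_kernel h n" unfolding \<pi> by (rule uhmc_kernel_eq[OF Tn h])
  have LT2: "L * T\<^sup>2 \<le> 1 / 6"
  proof -
    have "0 \<le> L * (T * h)" using L_nonneg T h by simp
    then show ?thesis using LT unfolding distrib_left by linarith
  qed
  have dim: "real DIM(real^'n) = d" by (simp add: d)
  have d1: "1 \<le> d" unfolding d by (simp add: Suc_leI)
  define K where "K = 3 / 2 * sqrt (1 / T^2 + 27 * d * L\<^sub>H^2 * T^4)"
  have "0 < 1 / T^2 + 27 * d * L\<^sub>H^2 * T^4" using T d1 by (intro add_pos_nonneg) auto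
  then have K: "0 < K" by (simp add: K_def)
  have lip: "\<bar>measure (\<pi> x) B - measure (\<pi> y) B\<bar> \<le> K * norm (x - y)" if "B \<in> sets borel" for x y B
    unfolding ker K_def d by (rule endpoint_kernel_lipschitz[OF pot h n Tn LT2 that])
  have m\<pi>: "\<pi> \<in> borel \<rightarrow>\<^sub>M subprob_algebra borel" and p\<pi>: "prob_space (\<pi> x)" for x
    unfolding ker by (simp_all add: prob_space_endpoint_kernel)
  have bp\<mu>: "borel_prob \<mu>" unfolding \<mu> borel_prob_def using prob_space_gibbs by simp
  have bind_prob: "borel_prob (\<eta> \<bind> k)"
    if "borel_prob \<eta>" "k \<in> borel \<rightarrow>\<^sub>M subprob_algebra borel" "\<And>x. prob_space (k x)" for \<eta> :: "(real^'n) measure" and k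
  proof -
    have s: "sets \<eta> = sets borel" and ps: "prob_space \<eta>" using that by (auto simp: borel_prob_def)
    have k: "k \<in> \<eta> \<rightarrow>\<^sub>M subprob_algebra borel" using that(2) by (simp add: measurable_cong_sets[OF s refl])
    have "prob_space (\<eta> \<bind> k)" using k that(3) by (intro prob_space.prob_space_bind[OF ps]) auto
    moreover have "sets (\<eta> \<bind> k) = sets borel"
      using sets_bind[of \<eta> k borel] sets_kernel[OF k] prob_space.not_empty[OF ps] by simp
    ultimately show ?thesis by (simp add: borel_prob_def)
  qed
  have kp: "kernel_pow \<pi> j \<in> borel \<rightarrow>\<^sub>M subprob_algebra borel \<and> (\<forall>x. prob_space (kernel_pow \<pi> j x))" for j
  proof (induction j)
    case 0
    show ?case by (auto simp: return_measurable intro: prob_space_return)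
  next
    case (Suc j)
    have 1: "kernel_pow \<pi> (Suc j) \<in> borel \<rightarrow>\<^sub>M subprob_algebra borel"
      unfolding kernel_pow.simps using Suc m\<pi> by (intro measurable_bind2[where N=borel]) auto
    have "prob_space (kernel_pow \<pi> j x \<bind> \<pi>)" for x
    proof -
      have "sets (kernel_pow \<pi> j x) = sets borel" using sets_kernel[of "kernel_pow \<pi> j" borel borel x] Suc by simp
      then have "borel_prob (kernel_pow \<pi> j x)" using Suc by (simp add: borel_prob_def)
      from bind_prob[OF this m\<pi> p\<pi>] show ?thesis by (simp add: borel_prob_def)
    qed
    with 1 show ?case by simp
  qed
  \<comment> \<open>The last step is split off: m steps contract in Wasserstein distance, and the
    final one converts this into total variation.\<close>
  define \<nu>m where "\<nu>m = \<nu> \<bind> kernel_pow \<pi> m"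
  have bp\<nu>m: "borel_prob \<nu>m" unfolding \<nu>m_def using kp by (intro bind_prob \<nu>) auto
  have s\<nu>: "sets \<nu> = sets borel" using \<nu> by (simp add: borel_prob_def)
  have Suc: "\<nu> \<bind> kernel_pow \<pi> (m + 1) = \<nu>m \<bind> \<pi>"
  proof -
    have "kernel_pow \<pi> m \<in> \<nu> \<rightarrow>\<^sub>M subprob_algebra borel" using kp by (simp add: measurable_cong_sets[OF s\<nu> refl])
    from bind_assoc[OF this m\<pi>] show ?thesis by (simp add: \<nu>m_def)
  qed
  define C where "C = sqrt (35 * d ^ 2 * L\<^sub>H\<^sup>2 * T\<^sup>2 + 16 * d * L\<^sup>2)"
  have C0: "0 \<le> C" using d1 by (simp add: C_def)
  \<comment> \<open>Both summands of C^2 occur in the bias constant, whose terms are all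
    nonnegative.\<close>
  have Cb: "ennreal C \<le> bias_const d L L\<^sub>H L\<^sub>I T \<mu>"
    unfolding C_def bias_const_def
  proof (rule ennreal_sqrt_mono_real)
    show "0 \<le> 35 * d ^ 2 * L\<^sub>H\<^sup>2 * T\<^sup>2 + 16 * d * L\<^sup>2" using d1 by simp
    have "35 * d ^ 2 * L\<^sub>H\<^sup>2 * T\<^sup>2 + 16 * d * L\<^sup>2 \<le>
        d^3 * (4 * L\<^sub>I^2 * T^4 + 14 * L\<^sub>H^2 * L\<^sub>I * T^6 + 14 * L\<^sub>H^4 * T^8)
       + d^2 * (35 * L\<^sub>H^2 * T^2 + 8 * L\<^sub>I^2 * T^4 + 28 * L\<^sub>H^2 * L\<^sub>I * T^6 + 28 * L\<^sub>H^4 * T^8)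
       + d * (16 * L^2 + 4 * L\<^sub>H^2 * T^2)"
    proof -
      have "0 \<le> d^3 * (4 * L\<^sub>I^2 * T^4 + 14 * L\<^sub>H^2 * L\<^sub>I * T^6 + 14 * L\<^sub>H^4 * T^8)"
        "0 \<le> d^2 * (8 * L\<^sub>I^2 * T^4 + 28 * L\<^sub>H^2 * L\<^sub>I * T^6 + 28 * L\<^sub>H^4 * T^8)"
        "0 \<le> d * (4 * L\<^sub>H^2 * T^2)"
        using d1 T LI0 by auto
      then show ?thesis by (simp add: algebra_simps)
    qed
    then show "ennreal (35 * d ^ 2 * L\<^sub>H\<^sup>2 * T\<^sup>2 + 16 * d * L\<^sup>2) \<le>
      ennreal (d^3 * (4 * L\<^sub>I^2 * T^4 + 14 * L\<^sub>H^2 * L\<^sub>I * T^6 + 14 * L\<^sub>H^4 * T^8)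
       + d^2 * (35 * L\<^sub>H^2 * T^2 + 8 * L\<^sub>I^2 * T^4 + 28 * L\<^sub>H^2 * L\<^sub>I * T^6 + 28 * L\<^sub>H^4 * T^8)
       + d * (16 * L^2 + 4 * L\<^sub>H^2 * T^2))
     + ennreal (2 * d * L\<^sub>H^2 + L^2 / T^2) * moment \<mu> 2
     + ennreal (d * L\<^sub>I^2 + d * L\<^sub>H^2 * L\<^sub>I * T^2 + d * L\<^sub>H^4 * T^4 + L\<^sub>H^2 / T^2) * moment \<mu> 4"
      by (meson add_increasing2 ennreal_leI order_trans zero_le)
  qed
  define R where "R = ennreal (K * M\<^sub>1) * W1 \<mu>' \<nu> * ennreal (exp (- c * real m)) +
      ennreal (h\<^sup>2) * (ennreal (K * M\<^sub>2) + bias_const d L L\<^sub>H L\<^sub>I T \<mu>)"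
  have each: "ennreal \<bar>measure \<mu> B - measure (\<nu>m \<bind> \<pi>) B\<bar> \<le> R" if B: "B \<in> sets borel" for B
  proof -
    have 1: "\<bar>measure \<mu> B - measure (\<mu> \<bind> \<pi>) B\<bar> \<le> h\<^sup>2 * C"
      using gibbs_bias[OF h n Tn LT B] unfolding \<mu> ker C_def dim .
    have 2: "ennreal \<bar>measure (\<mu> \<bind> \<pi>) B - measure (\<mu>' \<bind> \<pi>) B\<bar> \<le> ennreal K * ennreal (M\<^sub>2 * h\<^sup>2)"
      by (rule order_trans[OF W1_smoothing[OF m\<pi> p\<pi> B lip[OF B] K bp\<mu> \<mu>'] mult_left_mono[OF A6]]) simp
    have 3: "ennreal \<bar>measure (\<nu>m \<bind> \<pi>) B - measure (\<mu>' \<bind> \<pi>) B\<bar> \<le>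
        ennreal K * (ennreal (M\<^sub>1 * exp (- c * real m)) * W1 \<mu>' \<nu>)"
    proof (rule order_trans[OF W1_smoothing[OF m\<pi> p\<pi> B lip[OF B] K bp\<nu>m \<mu>']], rule mult_left_mono)
      have "W1 \<nu>m \<mu>' \<le> ennreal (M\<^sub>1 * exp (- c * real m)) * W1 \<nu> \<mu>'"
        using A5 \<nu> unfolding \<nu>m_def by blast
      also have "\<dots> \<le> ennreal (M\<^sub>1 * exp (- c * real m)) * W1 \<mu>' \<nu>"
        by (intro mult_left_mono W1_commute) simp
      finally show "W1 \<nu>m \<mu>' \<le> ennreal (M\<^sub>1 * exp (- c * real m)) * W1 \<mu>' \<nu>" .
    qed simp
    \<comment> \<open>The comparison measures are \<mu> \<bind> \<pi> and \<mu>' \<bind> \<pi>, so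
      that both Wasserstein bounds are used after one smoothing step.\<close>
    have "\<bar>measure \<mu> B - measure (\<nu>m \<bind> \<pi>) B\<bar> \<le> \<bar>measure (\<nu>m \<bind> \<pi>) B - measure (\<mu>' \<bind> \<pi>) B\<bar> +
        (\<bar>measure (\<mu> \<bind> \<pi>) B - measure (\<mu>' \<bind> \<pi>) B\<bar> + \<bar>measure \<mu> B - measure (\<mu> \<bind> \<pi>) B\<bar>)"
      by linarith
    then have "ennreal \<bar>measure \<mu> B - measure (\<nu>m \<bind> \<pi>) B\<bar> \<le> ennreal \<bar>measure (\<nu>m \<bind> \<pi>) B - measure (\<mu>' \<bind> \<pi>) B\<bar> +
        (ennreal \<bar>measure (\<mu> \<bind> \<pi>) B - measure (\<mu>' \<bind> \<pi>) B\<bar> + ennreal \<bar>measure \<mu> B - measure (\<mu> \<bind> \<pi>) B\<bar>)"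
      by (simp add: ennreal_leI flip: ennreal_plus)
    also have "\<dots> \<le> ennreal K * (ennreal (M\<^sub>1 * exp (- c * real m)) * W1 \<mu>' \<nu>) +
        (ennreal K * ennreal (M\<^sub>2 * h\<^sup>2) + ennreal (h\<^sup>2) * bias_const d L L\<^sub>H L\<^sub>I T \<mu>)"
    proof (intro add_mono 2 3)
      have "ennreal \<bar>measure \<mu> B - measure (\<mu> \<bind> \<pi>) B\<bar> \<le> ennreal (h\<^sup>2 * C)" using 1 by (rule ennreal_leI)
      also have "\<dots> = ennreal (h\<^sup>2) * ennreal C" using C0 by (simp add: ennreal_mult)
      also have "\<dots> \<le> ennreal (h\<^sup>2) * bias_const d L L\<^sub>H L\<^sub>I T \<mu>" using Cb by (rule mult_left_mono) simp
      finally show "ennreal \<bar>measure \<mu> B - measure (\<mu> \<bind> \<pi>) B\<bar> \<le> ennreal (h\<^sup>2) * bias_const d L L\<^sub>H L\<^sub>I T \<mu>" .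
    qed
    also have "\<dots> = R"
    proof -
      have "ennreal K * (ennreal (M\<^sub>1 * exp (- c * real m)) * W1 \<mu>' \<nu>) = ennreal (K * M\<^sub>1) * W1 \<mu>' \<nu> * ennreal (exp (- c * real m))"
        using K M1 by (simp add: ennreal_mult mult_ac)
      moreover have "ennreal K * ennreal (M\<^sub>2 * h\<^sup>2) = ennreal (h\<^sup>2) * ennreal (K * M\<^sub>2)"
        using K M2 by (simp add: ennreal_mult mult_ac)
      ultimately show ?thesis by (simp add: R_def distrib_left)
    qed
    finally show ?thesis .
  qed
  have "ennreal (TV \<mu> (\<nu>m \<bind> \<pi>)) \<le> R"
  \<comment> \<open>\<open>TV\<close> is a real supremum while R may be infinite, when a moment or a
    Wasserstein distance is. A finite R bounds every event as a real number.\<close>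
  proof (cases "R = \<top>")
    case False
    have "TV \<mu> (\<nu>m \<bind> \<pi>) \<le> enn2real R"
      unfolding TV_def
    proof (rule cSUP_least)
      fix B :: "(real^'n) set" assume "B \<in> sets borel"
      from each[OF this] show "\<bar>measure \<mu> B - measure (\<nu>m \<bind> \<pi>) B\<bar> \<le> enn2real R"
        using False by (metis abs_ge_zero enn2real_ennreal enn2real_mono top.not_eq_extremum)
    qed auto
    then have "ennreal (TV \<mu> (\<nu>m \<bind> \<pi>)) \<le> ennreal (enn2real R)" by (rule ennreal_leI)
    then show ?thesis using False by (simp add: ennreal_enn2real_if)
  qed simp
  then show "ennreal (TV \<mu> (\<nu> \<bind> kernel_pow \<pi> (m + 1)))
       \<le> ennreal (3 / 2 * sqrt (1 / T^2 + 27 * d * L\<^sub>H^2 * T^4) * M\<^sub>1) * W1 \<mu>' \<nu>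
           * ennreal (exp (- c * real m))
         + ennreal (h^2) * (ennreal (3 / 2 * sqrt (1 / T^2 + 27 * d * L\<^sub>H^2 * T^4) * M\<^sub>2)
           + bias_const d L L\<^sub>H L\<^sub>I T \<mu>)"
    unfolding Suc R_def K_def .
qed

end
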